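(* Let $F=\{\sigma_1,\dots,\sigma_n\}\subset\partial\mathbb{D}$ consist of pairwise distinct points and let $\tau\in\overline{\mathbb{D}}\setminus F$. A function $G\not\equiv0$ is an extreme point of $\mathsf{Gen}_\tau(F)$ if and only if $$G(z)=\frac{(\tau-z)(1-\overline\tau z)}{ib+p_0(z;F,L)},\quad z\in\mathbb{D},$$ for some $b\in\mathbb{R}$ and some $L=(\lambda_1,\dots,\lambda_n)\in(-\infty,0)^n$ with $\sum_{k=1}^n|\lambda_k|=1$.
   Context: $\mathbb{D}$ is the open unit disk. A one-parameter semigroup $(\phi_t)_{t\ge0}$ of holomorphic self-maps of $\mathbb{D}$ satisfies $\phi_0=\mathrm{id}$, $\phi_s\circ\phi_t=\phi_{s+t}$, and $\phi_t\to\mathrm{id}$ pointwise as $t\to 0^+$. Its infinitesimal generator $G$ satisfies $\frac{d}{dt}\phi_t(z)=G(\phi_t(z))$. $\mathsf{Gen}_\tau$ is the set of generators with Denjoy–Wolff point $\tau$, together with $G\equiv0$. A point $\sigma\in\partial\mathbb{D}$ is a boundary regular fixed point (BRFP) if each $\phi_t$ has angular limit $\sigma$ and a finite angular derivative at $\sigma$. The spectral value there is $\lambda$ with $\phi_t'(\sigma)=e^{-\lambda t}$, equivalently $\lambda=\angle\lim_{z\to\sigma}G(z)/(\sigma-z)$; at BRFPs other than the Denjoy–Wolff point it is negative. $\mathsf{Gen}_\tau(F)$ is the class of $G\in\mathsf{Gen}_\tau$ whose semigroup has BRFPs at all $\sigma_k$ with spectral values $\lambda_k$ satisfying $\sum_{k=1}^n|\lambda_k|\le1$,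 together with $G\equiv0$; it is a compact convex subset of $\mathsf{Hol}(\mathbb{D})$. $p_0(z;F,L):=\sum_{k=1}^n\frac{|\tau-\sigma_k|^2}{2|\lambda_k|}\frac{\sigma_k+z}{\sigma_k-z}$. *)

theory Defs
  imports "HOL-Analysis.Analysis"
begin

abbreviation unit_disk :: "complex set" where
  "unit_disk \<equiv> ball 0 1"

definition angular_limit :: "(complex \<Rightarrow> complex) \<Rightarrow> complex \<Rightarrow> complex \<Rightarrow> bool" where
  "angular_limit f \<sigma> L \<longleftrightarrow>
     (\<forall>M>1. (f \<longlongrightarrow> L) (at \<sigma> within {z. cmod z < 1 \<and> cmod (\<sigma> - z) < M * (1 - cmod z)}))"

definition holo_semigroup :: "(real \<Rightarrow> complex \<Rightarrow> complex) \<Rightarrow> bool" where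
  "holo_semigroup \<phi> \<longleftrightarrow>
     (\<forall>t\<ge>0. \<phi> t holomorphic_on unit_disk \<and> \<phi> t ` unit_disk \<subseteq> unit_disk) \<and>
     (\<forall>z\<in>unit_disk. \<phi> 0 z = z) \<and>
     (\<forall>s\<ge>0. \<forall>t\<ge>0. \<forall>z\<in>unit_disk. \<phi> s (\<phi> t z) = \<phi> (s + t) z) \<and>
     (\<forall>z\<in>unit_disk. ((\<lambda>t. \<phi> t z) \<longlongrightarrow> z) (at_right 0))"

definition generates :: "(complex \<Rightarrow> complex) \<Rightarrow> (real \<Rightarrow> complex \<Rightarrow> complex) \<Rightarrow> bool" where
  "generates G \<phi> \<longleftrightarrow> G holomorphic_on unit_disk \<and>
     (\<forall>z\<in>unit_disk. \<forall>t\<ge>0.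
        ((\<lambda>s. \<phi> s z) has_vector_derivative G (\<phi> t z)) (at t within {0..}))"

definition dw_point :: "(real \<Rightarrow> complex \<Rightarrow> complex) \<Rightarrow> complex \<Rightarrow> bool" where
  "dw_point \<phi> \<tau> \<longleftrightarrow>
     (if cmod \<tau> < 1 then
        (\<exists>t\<ge>0. \<exists>z\<in>unit_disk. \<phi> t z \<noteq> z) \<and> (\<forall>t\<ge>0. \<phi> t \<tau> = \<tau>)
      else cmod \<tau> = 1 \<and> (\<forall>z\<in>unit_disk. ((\<lambda>t. \<phi> t z) \<longlongrightarrow> \<tau>) at_top))"

definition brfp_spectral :: "(real \<Rightarrow> complex \<Rightarrow> complex) \<Rightarrow> complex \<Rightarrow> real \<Rightarrow> bool" where
  "brfp_spectral \<phi> \<sigma> lam \<longleftrightarrow> cmod \<sigma> = 1 \<and>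
     (\<forall>t\<ge>0. angular_limit (\<phi> t) \<sigma> \<sigma> \<and>
             angular_limit (\<lambda>z. (\<phi> t z - \<sigma>) / (z - \<sigma>)) \<sigma> (of_real (exp (- lam * t))))"

definition GenF :: "complex \<Rightarrow> (nat \<Rightarrow> complex) \<Rightarrow> nat \<Rightarrow> (complex \<Rightarrow> complex) set" where
  "GenF \<tau> \<sigma> n = {G. G holomorphic_on unit_disk \<and>
     ((\<forall>z\<in>unit_disk. G z = 0) \<or>
      (\<exists>\<phi> lam. holo_semigroup \<phi> \<and> generates G \<phi> \<and> dw_point \<phi> \<tau> \<and>
         (\<forall>k<n. brfp_spectral \<phi> (\<sigma> k) (lam k)) \<and> (\<Sum>k<n. \<bar>lam k\<bar>) \<le> 1))}"

text \<open>Extreme point of a convex set of holomorphic functions on D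
  (functions identified when they agree on D).\<close>
definition extreme_point_Hol :: "(complex \<Rightarrow> complex) set \<Rightarrow> (complex \<Rightarrow> complex) \<Rightarrow> bool" where
  "extreme_point_Hol K G \<longleftrightarrow> G \<in> K \<and>
     (\<forall>G1\<in>K. \<forall>G2\<in>K. \<forall>t::real. 0 < t \<and> t < 1 \<and>
        (\<forall>z\<in>unit_disk. G z = of_real t * G1 z + of_real (1 - t) * G2 z) \<longrightarrow>
        (\<forall>z\<in>unit_disk. G1 z = G2 z))"

definition p0 :: "complex \<Rightarrow> (nat \<Rightarrow> complex) \<Rightarrow> (nat \<Rightarrow> real) \<Rightarrow> nat \<Rightarrow> complex \<Rightarrow> complex" where
  "p0 \<tau> \<sigma> lam n z =
     (\<Sum>k<n. of_real (cmod (\<tau> - \<sigma> k) ^ 2 / (2 * \<bar>lam k\<bar>)) * ((\<sigma> k + z) / (\<sigma> k - z)))"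

end

theory Submission
  imports Defs "HOL-Complex_Analysis.Complex_Analysis"
begin

text \<open>
  Every generator with Denjoy--Wolff point \<open>\<tau>\<close> has the form \<open>G(z) = (\<tau> - z)(1 - cnj \<tau> z) p(z)\<close>
  with \<open>Re p \<ge> 0\<close> (Berkson--Porta), and \<open>\<sigma>\<^sub>k\<close> is a boundary regular fixed point with spectral value
  \<open>\<lambda>\<^sub>k\<close> iff \<open>p(z) / (1 - cnj \<sigma>\<^sub>k z)\<close> has the angular limit \<open>a\<^sub>k = \<bar>\<lambda>\<^sub>k\<bar> / \<bar>\<tau> - \<sigma>\<^sub>k\<bar>\<^sup>2 > 0\<close>.

  If \<open>1 / p = \<i> b + p0\<close>, then Julia's inequality \<open>\<bar>p\<bar>\<^sup>2 \<Sum>\<^sub>k P(\<sigma>\<^sub>k, z) / (2 a\<^sub>k) \<le> Re p\<close> (with the Poisson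
  kernel \<open>P\<close>) is an equality; since \<open>(x, a) \<mapsto> \<bar>x\<bar>\<^sup>2 / a\<close> is convex, a decomposition of \<open>p\<close> has
  proportional summands, and \<open>\<Sum>\<^sub>k \<bar>\<lambda>\<^sub>k\<bar> = 1\<close> makes them equal.

  Conversely, multiply the Herglotz measure of \<open>p\<close> by \<open>1 \<plusminus> \<epsilon> u\<close>, where \<open>u\<close> is a real rational function
  on the circle with \<open>n + 1\<close> parameters, and add an imaginary correction with \<open>n + 1\<close> parameters. All
  constraints amount to \<open>2 n + 1\<close> real linear equations, so a nontrivial choice exists; if it does not
  move \<open>p\<close>, the resulting linear relation for \<open>p\<close> is the claimed formula.
\<close>

subsection \<open>Boundary behaviour of functions with nonnegative real part\<close>

text \<open>\<open>GenF\<close> is defined through semigroups, so \<open>p\<close> must be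
  translated into a flow and back; the obstacle is that trajectories have to exist for all time.
  Measures are only a guide: masses are infima or angular limits here, and positivity comes from
  Schwarz-Pick or the maximum principle. The weight \<open>u\<close> and the imaginary correction
  are both built from real combinations of 1 and \<i> times Herglotz kernels, because a vanishing
  perturbation then expresses \<open>p\<close> as a quotient of such combinations. Their poles at
  \<open>\<sigma>\<^sub>k\<close> are removed by a factor that is real on the circle and has a
  double zero there. The plain choice \<open>\<bar>\<sigma>\<^sub>k - z\<bar>\<^sup>2 = -
  (\<sigma>\<^sub>k - z)\<^sup>2 / (\<sigma>\<^sub>k z)\<close> has its pole at 0 for every k;
  division by \<open>\<bar>\<sigma>\<^sub>k - 2 z\<bar>\<^sup>2\<close> moves it to the distinct
  points \<open>\<sigma>\<^sub>k / 2\<close>, where cancelling a simple pole is one complex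
  equation. The changes of the \<open>a\<^sub>k\<close> are automatically real, and keeping their
  weighted sum is the last equation.\<close>

definition stolz :: "complex \<Rightarrow> real \<Rightarrow> complex set" where
  "stolz \<sigma> M = {z. cmod z < 1 \<and> cmod (\<sigma> - z) < M * (1 - cmod z)}"

definition herglotz :: "complex \<Rightarrow> complex \<Rightarrow> complex" where
  "herglotz \<sigma> z = (\<sigma> + z) / (\<sigma> - z)"

definition poisson :: "complex \<Rightarrow> complex \<Rightarrow> real" where
  "poisson \<sigma> z = (1 - (cmod z)\<^sup>2) / (cmod (\<sigma> - z))\<^sup>2"

lemma angular_limit_stolz:
  "angular_limit f \<sigma> L \<longleftrightarrow> (\<forall>M>1. (f \<longlongrightarrow> L) (at \<sigma> within stolz \<sigma> M))"
  by (simp add: angular_limit_def stolz_def)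

lemma Re_herglotz: "cmod \<sigma> = 1 \<Longrightarrow> cmod z < 1 \<Longrightarrow> Re (herglotz \<sigma> z) = poisson \<sigma> z"
proof -
  assume a: "cmod \<sigma> = 1" "cmod z < 1"
  have "Re (herglotz \<sigma> z) = ((cmod \<sigma>)\<^sup>2 - (cmod z)\<^sup>2) / (cmod (\<sigma> - z))\<^sup>2"
    unfolding herglotz_def Re_divide cmod_power2 
    by (simp add: power2_eq_square algebra_simps)
  then show ?thesis using a by (simp add: poisson_def)
qed

lemma circle_cnj: "cmod \<sigma> = 1 \<Longrightarrow> \<sigma> * cnj \<sigma> = 1"
  by (simp add: complex_norm_square[symmetric])

lemma one_minus_cnj_circle: "cmod \<sigma> = 1 \<Longrightarrow> 1 - cnj \<sigma> * z = cnj \<sigma> * (\<sigma> - z)"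
  using circle_cnj[of \<sigma>] by (simp add: algebra_simps)

lemma norm_one_minus_cnj_circle: "cmod \<sigma> = 1 \<Longrightarrow> cmod (1 - cnj \<sigma> * z) = cmod (\<sigma> - z)"
  by (simp add: one_minus_cnj_circle norm_mult)

lemma circle_neq_disk: "cmod \<sigma> = 1 \<Longrightarrow> cmod z < 1 \<Longrightarrow> \<sigma> - z \<noteq> 0"
  by auto

lemma poisson_pos: "cmod \<sigma> = 1 \<Longrightarrow> cmod z < 1 \<Longrightarrow> poisson \<sigma> z > 0"
  unfolding poisson_def using circle_neq_disk[of \<sigma> z]
  by (intro divide_pos_pos) (auto simp: power_less_one_iff abs_square_less_1)

lemma holomorphic_herglotz: "cmod \<sigma> = 1 \<Longrightarrow> herglotz \<sigma> holomorphic_on ball 0 1"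
  unfolding herglotz_def[abs_def] by (intro holomorphic_intros) auto

section \<open>Disk automorphisms and the Schwarz-Pick inequality\<close>

lemma disk_cnj_neq: "cmod a \<le> 1 \<Longrightarrow> cmod z < 1 \<Longrightarrow> 1 - cnj a * z \<noteq> 0"
proof
  assume a: "cmod a \<le> 1" "cmod z < 1" "1 - cnj a * z = 0"
  then have "cmod (cnj a * z) = 1" by (metis eq_iff_diff_eq_0 norm_one)
  moreover have "cmod (cnj a * z) \<le> 1 * cmod z"
    unfolding norm_mult using a by (intro mult_right_mono) auto
  ultimately show False using a by simp
qed

lemma moebius_norm_identity:
  "(cmod (1 - cnj a * z))\<^sup>2 - (cmod (z - a))\<^sup>2 = (1 - (cmod a)\<^sup>2) * (1 - (cmod z)\<^sup>2)"
  unfolding cmod_power2 by (simp add: power2_eq_square algebra_simps)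

lemma moebius_lt_1:
  assumes "cmod a < 1" "cmod z < 1"
  shows "cmod ((z - a) / (1 - cnj a * z)) < 1"
proof -
  have "(1 - (cmod a)\<^sup>2) * (1 - (cmod z)\<^sup>2) > 0"
    using assms by (intro mult_pos_pos) (auto simp: abs_square_less_1)
  then have "(cmod (z - a))\<^sup>2 < (cmod (1 - cnj a * z))\<^sup>2"
    using moebius_norm_identity[of a z] by simp
  then have "cmod (z - a) < cmod (1 - cnj a * z)"
    by (rule power_less_imp_less_base) simp
  then show ?thesis
    using disk_cnj_neq[of a z] assms by (simp add: norm_divide)
qed

lemma divide_le_cross: "0 < b \<Longrightarrow> 0 < d \<Longrightarrow> a / b \<le> c / d \<Longrightarrow> a * d \<le> c * (b::real)"
  by (simp add: field_simps)

text \<open>The Schwarz lemma for \<open>F\<close>, which is \<open>f\<close> between two disk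
  automorphisms, one sending 0 to \<open>w\<close> and one sending \<open>f w\<close> to 0. Without
  quotients the inequality survives the passage to boundary points.\<close>

lemma schwarz_pick_disk:
  assumes holf: "f holomorphic_on ball 0 1" and f: "f ` ball 0 1 \<subseteq> ball 0 1"
    and z: "cmod z < 1" and w: "cmod w < 1"
  shows "(1 - (cmod z)\<^sup>2) * (1 - (cmod w)\<^sup>2) * (cmod (1 - cnj (f w) * f z))\<^sup>2
     \<le> (1 - (cmod (f z))\<^sup>2) * (1 - (cmod (f w))\<^sup>2) * (cmod (1 - cnj w * z))\<^sup>2"
proof -
  have f1: "cmod (f u) < 1" if "cmod u < 1" for u
    using f that by (auto simp: image_subset_iff)
  define \<mu> where "\<mu> = (\<lambda>u. (u + w) / (1 + cnj w * u))"
  have mu1: "cmod (\<mu> u) < 1" if "cmod u < 1" for u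
    using moebius_lt_1[of "-w" u] w that by (simp add: \<mu>_def)
  have nz: "1 + cnj w * u \<noteq> 0" if "cmod u < 1" for u
    using disk_cnj_neq[of "-w" u] w that by simp
  define F where "F = (\<lambda>u. (f (\<mu> u) - f w) / (1 - cnj (f w) * f (\<mu> u)))"
  have "\<mu> holomorphic_on ball 0 1"
    unfolding \<mu>_def by (intro holomorphic_intros) (use nz in auto)
  then have fm: "(\<lambda>u. f (\<mu> u)) holomorphic_on ball 0 1"
    using holomorphic_on_compose_gen[OF _ holf, of \<mu> "ball 0 1"] mu1 by (auto simp: o_def image_subset_iff)
  have holF: "F holomorphic_on ball 0 1"
    unfolding F_def by (intro holomorphic_intros fm) (use disk_cnj_neq f1 mu1 w in \<open>auto simp: less_imp_le\<close>)
  have F0: "F 0 = 0" by (simp add: F_def \<mu>_def)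
  have F1: "cmod (F u) < 1" if "cmod u < 1" for u
    unfolding F_def using that by (intro moebius_lt_1 f1 mu1 w)
  define u where "u = (z - w) / (1 - cnj w * z)"
  have u1: "cmod u < 1" unfolding u_def by (intro moebius_lt_1 z w)
  have nzw: "1 - cnj w * z \<noteq> 0" using disk_cnj_neq[of w z] z w by simp
  have ww: "w * cnj w \<noteq> 1"
    using disk_cnj_neq[of w w] w by (auto simp: mult.commute)
  have "\<mu> u = z"
  proof -
    have d: "1 + cnj w * u \<noteq> 0" by (rule nz[OF u1])
    have "u + w = z * (1 + cnj w * u)"
      unfolding u_def using nzw by (simp add: divide_simps) (simp add: algebra_simps)
    then show ?thesis unfolding \<mu>_def using d by simp
  qed
  then have Fu: "F u = (f z - f w) / (1 - cnj (f w) * f z)" by (simp add: F_def)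
  have S: "cmod (F u) \<le> cmod u"
    by (rule Schwarz_Lemma(1)[OF holF F0 F1 u1])
  have nzf: "1 - cnj (f w) * f z \<noteq> 0" using disk_cnj_neq f1 z w by (simp add: less_imp_le)
  have "cmod (f z - f w) * cmod (1 - cnj w * z) \<le> cmod (z - w) * cmod (1 - cnj (f w) * f z)"
    using S[unfolded Fu] nzf nzw unfolding u_def norm_divide by (intro divide_le_cross) auto
  then have "(cmod (f z - f w) * cmod (1 - cnj w * z))\<^sup>2 \<le> (cmod (z - w) * cmod (1 - cnj (f w) * f z))\<^sup>2"
    by (intro power_mono) auto
  \<comment> \<open>By \<open>moebius_norm_identity\<close> each squared difference is a squared
    denominator minus a product; the common term cancels, and the inequality between the products
    remains with its direction reversed.\<close>
  then show ?thesis
    using moebius_norm_identity[of "f w" "f z"] moebius_norm_identity[of w z]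
    unfolding power_mult_distrib
  proof -
    assume "(cmod (f z - f w))\<^sup>2 * (cmod (1 - cnj w * z))\<^sup>2 \<le> (cmod (z - w))\<^sup>2 * (cmod (1 - cnj (f w) * f z))\<^sup>2"
    moreover assume "(cmod (1 - cnj (f w) * f z))\<^sup>2 - (cmod (f z - f w))\<^sup>2 = (1 - (cmod (f w))\<^sup>2) * (1 - (cmod (f z))\<^sup>2)"
    then have "(cmod (f z - f w))\<^sup>2 = (cmod (1 - cnj (f w) * f z))\<^sup>2 - (1 - (cmod (f w))\<^sup>2) * (1 - (cmod (f z))\<^sup>2)" by simp
    moreover assume "(cmod (1 - cnj w * z))\<^sup>2 - (cmod (z - w))\<^sup>2 = (1 - (cmod w)\<^sup>2) * (1 - (cmod z)\<^sup>2)"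
    then have "(cmod (z - w))\<^sup>2 = (cmod (1 - cnj w * z))\<^sup>2 - (1 - (cmod w)\<^sup>2) * (1 - (cmod z)\<^sup>2)" by simp
    ultimately show ?thesis by (simp add: algebra_simps)
  qed
qed

text \<open>\<open>schwarz_pick_disk\<close> for the Cayley transform \<open>f\<close> of
  \<open>q\<close>; the powers of \<open>cmod (q z + 1)\<close> and \<open>cmod (q w + 1)\<close>
  occur equally on both sides and cancel.\<close>

lemma pick_half_plane_strict:
  assumes holq: "q holomorphic_on ball 0 1" and q: "\<And>z. cmod z < 1 \<Longrightarrow> Re (q z) > 0"
    and z: "cmod z < 1" and w: "cmod w < 1"
  shows "(1 - (cmod z)\<^sup>2) * (1 - (cmod w)\<^sup>2) * (cmod (q z + cnj (q w)))\<^sup>2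
     \<le> 4 * Re (q z) * Re (q w) * (cmod (1 - cnj w * z))\<^sup>2"
proof -
  define f where "f = (\<lambda>z. (q z - 1) / (q z + 1))"
  have nz: "q u + 1 \<noteq> 0" if "cmod u < 1" for u
    using q[OF that] by (auto simp: complex_eq_iff)
  have holf: "f holomorphic_on ball 0 1"
    unfolding f_def by (intro holomorphic_intros holq) (use nz in auto)
  have nf: "1 - (cmod (f u))\<^sup>2 = 4 * Re (q u) / (cmod (q u + 1))\<^sup>2" if "cmod u < 1" for u
  proof -
    have "(cmod (q u + 1))\<^sup>2 - (cmod (q u - 1))\<^sup>2 = 4 * Re (q u)"
      unfolding cmod_power2 by (simp add: power2_eq_square algebra_simps)
    then show ?thesis
      using nz[OF that] unfolding f_def norm_divide power_divide
      by (simp add: divide_simps)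
  qed
  have f1: "cmod (f u) < 1" if "cmod u < 1" for u
  proof -
    have "1 - (cmod (f u))\<^sup>2 > 0"
      unfolding nf[OF that] using q[OF that] nz[OF that] by simp
    then show ?thesis by (simp add: abs_square_less_1)
  qed
  then have im: "f ` ball 0 1 \<subseteq> ball 0 1" by auto
  have eq: "1 - cnj (f w) * f z = 2 * (q z + cnj (q w)) / ((q z + 1) * (cnj (q w) + 1))"
  proof -
    have "cnj (q w) + 1 \<noteq> 0"
      using nz[OF w] by (metis complex_cnj_add complex_cnj_one complex_cnj_zero_iff)
    then show ?thesis
      unfolding f_def using nz[OF z] by (simp add: divide_simps) (simp add: algebra_simps)
  qed
  have n1: "cmod (cnj (q w) + 1) = cmod (q w + 1)"
    by (metis complex_cnj_add complex_cnj_one complex_mod_cnj)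
  define A where "A = (cmod (q z + 1))\<^sup>2"
  define B where "B = (cmod (q w + 1))\<^sup>2"
  have AB: "A > 0" "B > 0" using nz[OF z] nz[OF w] by (auto simp: A_def B_def)
  have e2: "(cmod (1 - cnj (f w) * f z))\<^sup>2 = 4 * (cmod (q z + cnj (q w)))\<^sup>2 / (A * B)"
    unfolding eq by (simp only: norm_divide norm_mult power_divide power_mult_distrib n1 A_def B_def) simp
  have "(1 - (cmod z)\<^sup>2) * (1 - (cmod w)\<^sup>2) * (4 * (cmod (q z + cnj (q w)))\<^sup>2 / (A * B))
     \<le> (4 * Re (q z) / A) * (4 * Re (q w) / B) * (cmod (1 - cnj w * z))\<^sup>2"
    using schwarz_pick_disk[OF holf im z w] unfolding nf[OF z] nf[OF w] e2 A_def B_def .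
  then have "((1 - (cmod z)\<^sup>2) * (1 - (cmod w)\<^sup>2) * (4 * (cmod (q z + cnj (q w)))\<^sup>2)) / (A * B)
     \<le> ((4 * Re (q z)) * (4 * Re (q w)) * (cmod (1 - cnj w * z))\<^sup>2) / (A * B)"
    by simp
  then show ?thesis
    using AB by (simp add: divide_le_cancel mult_ac)
qed

text \<open>The limit of the strict version for \<open>q + e\<close>. It is needed because
  subtracting a boundary mass from a function leaves only a nonnegative real part.\<close>

lemma pick_half_plane:
  assumes holq: "q holomorphic_on ball 0 1" and q: "\<And>z. cmod z < 1 \<Longrightarrow> Re (q z) \<ge> 0"
    and z: "cmod z < 1" and w: "cmod w < 1"
  shows "(1 - (cmod z)\<^sup>2) * (1 - (cmod w)\<^sup>2) * (cmod (q z + cnj (q w)))\<^sup>2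
     \<le> 4 * Re (q z) * Re (q w) * (cmod (1 - cnj w * z))\<^sup>2"
proof -
  let ?L = "\<lambda>e::real. (1 - (cmod z)\<^sup>2) * (1 - (cmod w)\<^sup>2) * (cmod ((q z + of_real e) + cnj (q w + of_real e)))\<^sup>2"
  let ?R = "\<lambda>e::real. 4 * Re (q z + of_real e) * Re (q w + of_real e) * (cmod (1 - cnj w * z))\<^sup>2"
  have le: "?L e \<le> ?R e" if "e > 0" for e
    using that q by (intro pick_half_plane_strict[where q = "\<lambda>z. q z + of_real e"] z w holomorphic_intros holq)
       (auto intro: add_nonneg_pos)
  have L: "(?L \<longlongrightarrow> ?L 0) (at_right 0)" by (intro tendsto_intros)
  have R: "(?R \<longlongrightarrow> ?R 0) (at_right 0)" by (intro tendsto_intros)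
  have "?L 0 \<le> ?R 0"
    by (rule tendsto_le[OF _ R L eventually_at_rightI[of 0 1]]) (simp, rule le, simp_all)
  then show ?thesis by simp
qed

section \<open>Stolz angles and angular limits\<close>

lemma stolz_radial:
  assumes "cmod \<sigma> = 1" "M > 1" "0 < r" "r < 1"
  shows "of_real r * \<sigma> \<in> stolz \<sigma> M"
proof -
  have "\<sigma> - of_real r * \<sigma> = of_real (1 - r) * \<sigma>" by (simp add: algebra_simps)
  then have "cmod (\<sigma> - of_real r * \<sigma>) = \<bar>1 - r\<bar>"
    using assms by (simp only: norm_mult norm_of_real) simp
  then have "cmod (\<sigma> - of_real r * \<sigma>) = 1 - r" using assms by simp
  then show ?thesis using assms by (simp add: stolz_def norm_mult)
qed

text \<open>Each Stolz angle contains the radius, hence accumulates at \<sigma>; this is what makes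
  angular limits unique.\<close>

lemma filterlim_radial_stolz:
  assumes "cmod \<sigma> = 1" "M > 1"
  shows "filterlim (\<lambda>r. of_real r * \<sigma>) (at \<sigma> within stolz \<sigma> M) (at_left (1::real))"
proof -
  have "((\<lambda>r::real. of_real r * \<sigma>) \<longlongrightarrow> of_real 1 * \<sigma>) (at_left 1)"
    by (intro tendsto_intros)
  moreover have "\<forall>\<^sub>F r in at_left (1::real). of_real r * \<sigma> \<noteq> \<sigma> \<and> of_real r * \<sigma> \<in> stolz \<sigma> M"
  proof (rule eventually_at_leftI[of 0])
    fix r :: real assume "r \<in> {0<..<1}"
    then show "of_real r * \<sigma> \<noteq> \<sigma> \<and> of_real r * \<sigma> \<in> stolz \<sigma> M"
      using assms stolz_radial[of \<sigma> M r] by (auto simp: stolz_def)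
  qed simp
  ultimately show ?thesis
    by (simp add: filterlim_at conj_commute)
qed

lemma stolz_nontrivial: "cmod \<sigma> = 1 \<Longrightarrow> M > 1 \<Longrightarrow> at \<sigma> within stolz \<sigma> M \<noteq> bot"
  using eventually_compose_filterlim[OF _ filterlim_radial_stolz, of "\<lambda>_. False" \<sigma> M]
    trivial_limit_at_left_real[of 1]
  unfolding trivial_limit_def by blast

lemma angular_limit_unique:
  assumes "cmod \<sigma> = 1" "angular_limit f \<sigma> L" "angular_limit f \<sigma> L'"
  shows "L = L'"
  using assms stolz_nontrivial[of \<sigma> 2] tendsto_unique[of "at \<sigma> within stolz \<sigma> 2" f L L']
  by (auto simp: angular_limit_stolz)

lemma angular_limit_cong:
  assumes "\<And>z. cmod z < 1 \<Longrightarrow> f z = g z"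
  shows "angular_limit f \<sigma> L \<longleftrightarrow> angular_limit g \<sigma> L"
  unfolding angular_limit_stolz
  by (intro all_cong1 imp_cong refl tendsto_cong)
     (auto simp: eventually_at_filter stolz_def assms)

lemma angular_limit_of_tendsto:
  "(f \<longlongrightarrow> L) (at \<sigma>) \<Longrightarrow> angular_limit f \<sigma> L"
  by (auto simp: angular_limit_stolz intro: tendsto_within_subset)

lemma angular_limit_mult:
  "angular_limit f \<sigma> L \<Longrightarrow> angular_limit g \<sigma> L' \<Longrightarrow> angular_limit (\<lambda>z. f z * g z) \<sigma> (L * L')"
  by (auto simp: angular_limit_stolz intro: tendsto_mult)

lemma angular_limit_add:
  "angular_limit f \<sigma> L \<Longrightarrow> angular_limit g \<sigma> L' \<Longrightarrow> angular_limit (\<lambda>z. f z + g z) \<sigma> (L + L')"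
  by (auto simp: angular_limit_stolz intro: tendsto_add)

lemma angular_limit_inverse:
  "angular_limit f \<sigma> L \<Longrightarrow> L \<noteq> 0 \<Longrightarrow> angular_limit (\<lambda>z. inverse (f z)) \<sigma> (inverse L)"
  by (auto simp: angular_limit_stolz intro: tendsto_inverse)

text \<open>This 2 is the source of the limits \<open>2 * m\<close> for a point mass
  \<open>m\<close> and, after inversion, of the masses \<open>1 / (2 * a k)\<close>.\<close>

lemma tendsto_herglotz_pole:
  assumes "cmod \<sigma> = 1"
  shows "((\<lambda>z. (1 - cnj \<sigma> * z) * herglotz \<sigma> z) \<longlongrightarrow> 2) (at \<sigma>)"
proof -
  have 1: "((\<lambda>z. cnj \<sigma> * (\<sigma> + z)) \<longlongrightarrow> cnj \<sigma> * (\<sigma> + \<sigma>)) (at \<sigma>)" by (intro tendsto_intros)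
  have 2: "cnj \<sigma> * (\<sigma> + \<sigma>) = 2" using circle_cnj[OF assms] by (simp add: algebra_simps)
  have "\<forall>\<^sub>F z in at \<sigma>. cnj \<sigma> * (\<sigma> + z) = (1 - cnj \<sigma> * z) * herglotz \<sigma> z"
    unfolding eventually_at_filter one_minus_cnj_circle[OF assms] herglotz_def
    by (intro always_eventually allI impI) simp
  from Lim_transform_eventually[OF 1 this] show ?thesis unfolding 2 .
qed

text \<open>\<open>m\<close> is the mass at \<sigma> of the Herglotz measure of \<open>q\<close>,
  obtained as the infimum of \<open>Re q / poisson \<sigma>\<close>. Subtracting its kernel leaves
  \<open>q1\<close> with infimum 0, and Pick's inequality against a point \<open>w\<close> that
  nearly attains the infimum shows that \<open>q1\<close> has no mass at \<sigma>.\<close>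

theorem julia_caratheodory:
  assumes holq: "q holomorphic_on ball 0 1" and q: "\<And>z. cmod z < 1 \<Longrightarrow> Re (q z) \<ge> 0"
    and \<sigma>: "cmod \<sigma> = 1"
  obtains m :: real where "m \<ge> 0" "angular_limit (\<lambda>z. (1 - cnj \<sigma> * z) * q z) \<sigma> (of_real (2 * m))"
    "\<And>z. cmod z < 1 \<Longrightarrow> m * poisson \<sigma> z \<le> Re (q z)"
proof -
  define S where "S = (\<lambda>z. Re (q z) / poisson \<sigma> z) ` ball 0 1"
  define m where "m = Inf S"
  have S0: "x \<ge> 0" if "x \<in> S" for x
    using that q poisson_pos[OF \<sigma>] by (auto simp: S_def less_imp_le)
  have Sne: "S \<noteq> {}" by (auto simp: S_def)
  have bdd: "bdd_below S" using S0 by (auto simp: bdd_below_def)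
  have m0: "m \<ge> 0" unfolding m_def by (rule cInf_greatest[OF Sne S0])
  have mP: "m * poisson \<sigma> z \<le> Re (q z)" if z: "cmod z < 1" for z
  proof -
    have "m \<le> Re (q z) / poisson \<sigma> z"
      unfolding m_def by (rule cInf_lower[OF _ bdd]) (use z in \<open>auto simp: S_def\<close>)
    then show ?thesis using poisson_pos[OF \<sigma> z] by (simp add: pos_le_divide_eq)
  qed
  define q1 where "q1 = (\<lambda>z. q z - of_real m * herglotz \<sigma> z)"
  have holq1: "q1 holomorphic_on ball 0 1"
    unfolding q1_def by (intro holomorphic_intros holq holomorphic_herglotz \<sigma>)
  have Req1: "Re (q1 z) = Re (q z) - m * poisson \<sigma> z" if "cmod z < 1" for z
    using that by (simp add: q1_def Re_herglotz \<sigma>)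
  have q1: "Re (q1 z) \<ge> 0" if "cmod z < 1" for z
    using mP[OF that] by (simp add: Req1 that)
  have lim1: "((\<lambda>z. (1 - cnj \<sigma> * z) * q1 z) \<longlongrightarrow> 0) (at \<sigma> within stolz \<sigma> M)" if M: "M > 1" for M
  proof (rule tendstoI)
    fix e :: real assume e: "e > 0"
    \<comment> \<open>The 4 is that of Pick's inequality and \<open>M\<close> is the opening of the
      Stolz angle; with this choice of \<open>w\<close> the bound \<open>?B\<close> below is less
      than \<open>e\<close> at \<sigma>.\<close>
    have "m + e / (4 * M) > Inf S" using e M by (simp add: m_def)
    then obtain x where "x \<in> S" "x < m + e / (4 * M)"
      by (auto simp: cInf_less_iff[OF Sne bdd])
    then obtain w where w: "cmod w < 1" "Re (q w) / poisson \<sigma> w < m + e / (4 * M)"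
      by (auto simp: S_def)
    have Pw: "poisson \<sigma> w > 0" by (rule poisson_pos[OF \<sigma> w(1)])
    have "Re (q w) < m * poisson \<sigma> w + e / (4 * M) * poisson \<sigma> w"
      using w(2) Pw by (simp add: divide_less_eq algebra_simps)
    then have "4 * M * Re (q1 w) < e * poisson \<sigma> w"
      using M by (simp add: Req1[OF w(1)] field_simps)
    then have small: "4 * M * Re (q1 w) / poisson \<sigma> w < e" using Pw by (simp add: divide_less_eq)
    let ?B = "\<lambda>z. 4 * M * Re (q1 w) * (cmod (1 - cnj w * z))\<^sup>2 / (1 - (cmod w)\<^sup>2) + cmod (\<sigma> - z) * cmod (q1 w)"
    have w2: "1 - (cmod w)\<^sup>2 > 0" using w(1) by (simp add: abs_square_less_1)
    have "(?B \<longlongrightarrow> ?B \<sigma>) (at \<sigma> within stolz \<sigma> M)"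
      by (intro tendsto_intros) (use w2 in auto)
    moreover have "?B \<sigma> = 4 * M * Re (q1 w) / poisson \<sigma> w"
    proof -
      have "cmod (1 - cnj w * \<sigma>) = cmod (1 - cnj \<sigma> * w)"
        using complex_mod_cnj[of "1 - cnj \<sigma> * w"] by (simp add: mult.commute)
      then have "cmod (1 - cnj w * \<sigma>) = cmod (\<sigma> - w)"
        using norm_one_minus_cnj_circle[OF \<sigma>] by simp
      then show ?thesis by (simp add: poisson_def)
    qed
    ultimately have ev: "\<forall>\<^sub>F z in at \<sigma> within stolz \<sigma> M. ?B z < e"
      using small by (intro order_tendstoD(2)) auto
    have "cmod ((1 - cnj \<sigma> * z) * q1 z) \<le> ?B z" if z: "z \<in> stolz \<sigma> M" for z
    proof -
      have z1: "cmod z < 1" and zM: "cmod (\<sigma> - z) < M * (1 - cmod z)" using z by (auto simp: stolz_def)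
      \<comment> \<open>\<open>X\<close> dominates \<open>Re (q1 z)\<close>. Replacing
        \<open>Re (q1 z)\<close> by \<open>X\<close> on the right and cancelling one
        \<open>X\<close> turns the quadratic inequality into a linear bound of order
        \<open>1 / (1 - (cmod z)\<^sup>2)\<close>.\<close>
      define X where "X = cmod (q1 z + cnj (q1 w))"
      have z2: "1 - (cmod z)\<^sup>2 > 0" using z1 by (simp add: abs_square_less_1)
      have ReX: "Re (q1 z) \<le> X"
        using complex_Re_le_cmod[of "q1 z + cnj (q1 w)"] q1[OF w(1)] by (simp add: X_def)
      have "(1 - (cmod z)\<^sup>2) * (1 - (cmod w)\<^sup>2) * X\<^sup>2 \<le> 4 * Re (q1 z) * Re (q1 w) * (cmod (1 - cnj w * z))\<^sup>2"
        unfolding X_def by (rule pick_half_plane[OF holq1 q1 z1 w(1)])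
      also have "\<dots> \<le> 4 * X * Re (q1 w) * (cmod (1 - cnj w * z))\<^sup>2"
        using ReX q1[OF w(1)] by (intro mult_right_mono mult_left_mono) auto
      finally have "((1 - (cmod z)\<^sup>2) * (1 - (cmod w)\<^sup>2) * X) * X \<le> (4 * Re (q1 w) * (cmod (1 - cnj w * z))\<^sup>2) * X"
        by (simp add: power2_eq_square algebra_simps)
      moreover have "X \<ge> 0" by (simp add: X_def)
      ultimately have 1: "(1 - (cmod z)\<^sup>2) * (1 - (cmod w)\<^sup>2) * X \<le> 4 * Re (q1 w) * (cmod (1 - cnj w * z))\<^sup>2"
        using q1[OF w(1)] by (cases "X = 0") (auto simp: mult_le_cancel_right)
      have "1 - cmod z \<le> 1 - (cmod z)\<^sup>2"
        using z1 by (simp add: power2_eq_square mult_left_le)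
      then have d: "cmod (\<sigma> - z) \<le> M * (1 - (cmod z)\<^sup>2)"
        using zM M mult_left_mono[of "1 - cmod z" "1 - (cmod z)\<^sup>2" M] by linarith
      have "cmod (\<sigma> - z) * X * (1 - (cmod w)\<^sup>2) \<le> (M * (1 - (cmod z)\<^sup>2)) * X * (1 - (cmod w)\<^sup>2)"
        using d w2 \<open>X \<ge> 0\<close> by (intro mult_right_mono) auto
      also have "\<dots> = M * ((1 - (cmod z)\<^sup>2) * (1 - (cmod w)\<^sup>2) * X)" by simp
      also have "\<dots> \<le> M * (4 * Re (q1 w) * (cmod (1 - cnj w * z))\<^sup>2)"
        using M 1 by (intro mult_left_mono) auto
      finally have 2: "cmod (\<sigma> - z) * X \<le> 4 * M * Re (q1 w) * (cmod (1 - cnj w * z))\<^sup>2 / (1 - (cmod w)\<^sup>2)"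
        using w2 by (simp add: pos_le_divide_eq algebra_simps)
      have "cmod (q1 z) \<le> X + cmod (q1 w)"
        unfolding X_def using norm_triangle_ineq4[of "q1 z + cnj (q1 w)" "cnj (q1 w)"] by simp
      then have "cmod ((1 - cnj \<sigma> * z) * q1 z) \<le> cmod (\<sigma> - z) * (X + cmod (q1 w))"
        unfolding norm_mult norm_one_minus_cnj_circle[OF \<sigma>] by (intro mult_left_mono) auto
      then show ?thesis using 2 by (simp add: algebra_simps)
    qed
    then have "\<forall>\<^sub>F z in at \<sigma> within stolz \<sigma> M. cmod ((1 - cnj \<sigma> * z) * q1 z) \<le> ?B z"
      by (auto simp: eventually_at_filter)
    with ev show "\<forall>\<^sub>F z in at \<sigma> within stolz \<sigma> M. dist ((1 - cnj \<sigma> * z) * q1 z) 0 < e"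
      by eventually_elim simp
  qed
  have "angular_limit (\<lambda>z. (1 - cnj \<sigma> * z) * q1 z + of_real m * ((1 - cnj \<sigma> * z) * herglotz \<sigma> z)) \<sigma> (0 + of_real m * 2)"
    by (intro angular_limit_add angular_limit_mult[of "\<lambda>_. of_real m"] angular_limit_of_tendsto[OF tendsto_herglotz_pole[OF \<sigma>]])
       (auto simp: angular_limit_stolz lim1)
  moreover have "(\<lambda>z. (1 - cnj \<sigma> * z) * q1 z + of_real m * ((1 - cnj \<sigma> * z) * herglotz \<sigma> z)) = (\<lambda>z. (1 - cnj \<sigma> * z) * q z)"
    by (auto simp: q1_def algebra_simps)
  ultimately have "angular_limit (\<lambda>z. (1 - cnj \<sigma> * z) * q z) \<sigma> (of_real (2 * m))"
    by (simp add: mult.commute)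
  from m0 this mP show thesis by (rule that)
qed

subsection \<open>Holomorphic flows on the half-plane\<close>

abbreviation half_plane :: "complex set" where
  "half_plane \<equiv> {\<zeta>. Re \<zeta> > 0}"

lemma open_half_plane: "open half_plane" by (rule open_halfspace_Re_gt)

lemma convex_half_plane: "convex half_plane"
  by (rule convex_halfspace_Re_gt)

section \<open>Schwarz-Pick inequalities on the half-plane\<close>

lemma cmod_add_cnj_square: "(cmod (a + cnj b))\<^sup>2 = (cmod (a - b))\<^sup>2 + 4 * Re a * Re b"
  unfolding cmod_power2 by (simp add: power2_eq_square algebra_simps)

text \<open>Pulled back to the disk by the Cayley map \<open>C\<close>.
  \<open>cmod_add_cnj_square\<close> changes sums into differences, the form that can be divided by
  \<open>(cmod (a - b))\<^sup>2\<close> as \<open>b\<close> tends to \<open>a\<close>.\<close>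

lemma schwarz_pick_half_plane:
  assumes holP: "P holomorphic_on half_plane" and P: "\<And>\<zeta>. Re \<zeta> > 0 \<Longrightarrow> Re (P \<zeta>) > 0"
    and a: "Re a > 0" and b: "Re b > 0"
  shows "Re a * Re b * (cmod (P a - P b))\<^sup>2 \<le> Re (P a) * Re (P b) * (cmod (a - b))\<^sup>2"
proof -
  define C where "C = (\<lambda>z::complex. (1 + z) / (1 - z))"
  have ReC: "Re (C z) > 0" if "cmod z < 1" for z
    using Re_herglotz[of 1 z] poisson_pos[of 1 z] that by (simp add: C_def herglotz_def)
  have holC: "C holomorphic_on ball 0 1"
    unfolding C_def by (intro holomorphic_intros) auto
  define q where "q = (\<lambda>z. P (C z))"
  have holq: "q holomorphic_on ball 0 1"
    using holomorphic_on_compose_gen[OF holC holP] ReC by (auto simp: q_def o_def image_subset_iff)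
  have D: "cmod ((\<zeta> - 1) / (\<zeta> + 1)) < 1" "C ((\<zeta> - 1) / (\<zeta> + 1)) = \<zeta>"
    "1 - (cmod ((\<zeta> - 1) / (\<zeta> + 1)))\<^sup>2 = 4 * Re \<zeta> / (cmod (\<zeta> + 1))\<^sup>2"
    if "Re \<zeta> > 0" for \<zeta>
  proof -
    have nz: "\<zeta> + 1 \<noteq> 0" using that by (auto simp: complex_eq_iff)
    have "(cmod (\<zeta> + 1))\<^sup>2 - (cmod (\<zeta> - 1))\<^sup>2 = 4 * Re \<zeta>"
      unfolding cmod_power2 by (simp add: power2_eq_square algebra_simps)
    then show 3: "1 - (cmod ((\<zeta> - 1) / (\<zeta> + 1)))\<^sup>2 = 4 * Re \<zeta> / (cmod (\<zeta> + 1))\<^sup>2"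
      using nz unfolding norm_divide power_divide by (simp add: divide_simps)
    have "4 * Re \<zeta> / (cmod (\<zeta> + 1))\<^sup>2 > 0" using that nz by simp
    then show "cmod ((\<zeta> - 1) / (\<zeta> + 1)) < 1" unfolding 3[symmetric] by (simp add: abs_square_less_1)
    show "C ((\<zeta> - 1) / (\<zeta> + 1)) = \<zeta>" unfolding C_def using nz by (simp add: divide_simps)
  qed
  have nz: "a + 1 \<noteq> 0" "b + 1 \<noteq> 0" "cnj b + 1 \<noteq> 0" using a b by (auto simp: complex_eq_iff)
  define A where "A = (cmod (a + 1))\<^sup>2"
  define B where "B = (cmod (b + 1))\<^sup>2"
  have AB: "A > 0" "B > 0" using nz by (auto simp: A_def B_def)
  define u where "u = (a - 1) / (a + 1)"
  define v where "v = (b - 1) / (b + 1)"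
  have uv: "cmod u < 1" "cmod v < 1" "q u = P a" "q v = P b"
    "1 - (cmod u)\<^sup>2 = 4 * Re a / A" "1 - (cmod v)\<^sup>2 = 4 * Re b / B"
    using D[OF a] D[OF b] by (simp_all add: u_def v_def q_def A_def B_def)
  have e: "1 - cnj v * u = 2 * (a + cnj b) / ((a + 1) * (cnj b + 1))"
    unfolding u_def v_def using nz by (simp add: divide_simps) (simp add: algebra_simps)
  have n1: "cmod (cnj b + 1) = cmod (b + 1)"
    by (metis complex_cnj_add complex_cnj_one complex_mod_cnj)
  have e2: "(cmod (1 - cnj v * u))\<^sup>2 = 4 * (cmod (a + cnj b))\<^sup>2 / (A * B)"
    unfolding e by (simp only: norm_divide norm_mult power_divide power_mult_distrib n1 A_def B_def) simp
  have "(1 - (cmod u)\<^sup>2) * (1 - (cmod v)\<^sup>2) * (cmod (q u + cnj (q v)))\<^sup>2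
     \<le> 4 * Re (q u) * Re (q v) * (cmod (1 - cnj v * u))\<^sup>2"
    by (rule pick_half_plane[OF holq _ uv(1,2)]) (use P ReC in \<open>auto simp: q_def less_imp_le\<close>)
  then have "(16 * (Re a * Re b * (cmod (P a + cnj (P b)))\<^sup>2)) / (A * B)
     \<le> (16 * (Re (P a) * Re (P b) * (cmod (a + cnj b))\<^sup>2)) / (A * B)"
    unfolding uv e2 by (simp add: mult_ac)
  then have "Re a * Re b * (cmod (P a + cnj (P b)))\<^sup>2 \<le> Re (P a) * Re (P b) * (cmod (a + cnj b))\<^sup>2"
    using AB by (simp add: divide_le_cancel mult_ac)
  then show ?thesis unfolding cmod_add_cnj_square by (simp add: algebra_simps)
qed

lemma schwarz_pick_half_plane_deriv:
  assumes holP: "P holomorphic_on half_plane" and P: "\<And>\<zeta>. Re \<zeta> > 0 \<Longrightarrow> Re (P \<zeta>) > 0"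
    and a: "Re a > 0"
  shows "cmod (deriv P a) * Re a \<le> Re (P a)"
proof -
  have dP: "(P has_field_derivative deriv P a) (at a)"
    using holomorphic_derivI[OF holP open_half_plane] a by auto
  have contP: "(P \<longlongrightarrow> P a) (at a)"
    using dP DERIV_isCont isCont_def by blast
  have "((\<lambda>b. (cmod ((P b - P a) / (b - a)))\<^sup>2 * (Re a * Re b)) \<longlongrightarrow> (cmod (deriv P a))\<^sup>2 * (Re a * Re a)) (at a)"
    using dP by (intro tendsto_intros) (auto simp: has_field_derivative_iff)
  moreover have "((\<lambda>b. Re (P a) * Re (P b)) \<longlongrightarrow> Re (P a) * Re (P a)) (at a)"
    by (intro tendsto_intros contP)
  moreover have "\<forall>\<^sub>F b in at a. b \<in> half_plane - {a}"
    by (rule eventually_at_in_open[OF open_half_plane]) (use a in auto)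
  then have "\<forall>\<^sub>F b in at a. (cmod ((P b - P a) / (b - a)))\<^sup>2 * (Re a * Re b) \<le> Re (P a) * Re (P b)"
  proof eventually_elim
    case (elim b)
    then show ?case
      using schwarz_pick_half_plane[OF holP P a, of b]
      by (simp add: norm_divide power_divide divide_simps norm_minus_commute mult_ac)
  qed
  ultimately have "(cmod (deriv P a))\<^sup>2 * (Re a * Re a) \<le> Re (P a) * Re (P a)"
    by (intro tendsto_le[of "at a"]) auto
  then have "(cmod (deriv P a) * Re a)\<^sup>2 \<le> (Re (P a))\<^sup>2"
    by (simp add: power2_eq_square mult_ac)
  then show ?thesis using P[OF a] by (simp add: power2_le_iff_abs_le abs_le_square_iff less_imp_le power_mono_iff)
qed

lemma DERIV_mult_exp:
  fixes x :: "real \<Rightarrow> real"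
  assumes "(x has_real_derivative x') (at r)"
  shows "((\<lambda>s. x s * exp (- C * s)) has_real_derivative (x' - C * x r) * exp (- C * r)) (at r)"
  using assms by (auto intro!: derivative_eq_intros simp: algebra_simps)

lemma DERIV_sum_squares_divide_square:
  fixes u v x :: "real \<Rightarrow> real"
  assumes "(u has_real_derivative u') (at s)" "(v has_real_derivative v') (at s)"
    "(x has_real_derivative x') (at s)" "x s \<noteq> 0"
  shows "((\<lambda>s. ((u s)\<^sup>2 + (v s)\<^sup>2) / (x s)\<^sup>2) has_real_derivative
    ((2 * u s * u' + 2 * v s * v') * (x s)\<^sup>2 - ((u s)\<^sup>2 + (v s)\<^sup>2) * (2 * x s * x')) / ((x s)\<^sup>2 * (x s)\<^sup>2)) (at s)"
  using assms by (auto intro!: derivative_eq_intros simp: mult_ac)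

text \<open>The primitive \<open>h\<close> of \<open>1 / P\<close> increases at unit rate along
  trajectories, so the flow is \<open>g (h \<zeta> + t)\<close> with \<open>g\<close> the inverse of
  \<open>h\<close>. It exists for all time once the image \<open>W\<close> of \<open>h\<close> is
  mapped into itself by positive translations. The escape to infinity becomes convergence to a
  boundary point \<tau>, and the commutation with periods lets a flow descend through the
  exponential map.\<close>

theorem half_plane_flow:
  assumes holP: "P holomorphic_on half_plane" and P: "\<And>\<zeta>. Re \<zeta> > 0 \<Longrightarrow> Re (P \<zeta>) > 0"
  obtains \<Phi> :: "real \<Rightarrow> complex \<Rightarrow> complex" where
    "\<And>t. t \<ge> 0 \<Longrightarrow> \<Phi> t holomorphic_on half_plane"
    "\<And>t \<zeta>. t \<ge> 0 \<Longrightarrow> Re \<zeta> > 0 \<Longrightarrow> Re (\<Phi> t \<zeta>) \<ge> Re \<zeta>"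
    "\<And>\<zeta>. Re \<zeta> > 0 \<Longrightarrow> \<Phi> 0 \<zeta> = \<zeta>"
    "\<And>s t \<zeta>. s \<ge> 0 \<Longrightarrow> t \<ge> 0 \<Longrightarrow> Re \<zeta> > 0 \<Longrightarrow> \<Phi> s (\<Phi> t \<zeta>) = \<Phi> (s + t) \<zeta>"
    "\<And>t \<zeta>. t \<ge> 0 \<Longrightarrow> Re \<zeta> > 0 \<Longrightarrow>
       ((\<lambda>s. \<Phi> s \<zeta>) has_vector_derivative P (\<Phi> t \<zeta>)) (at t within {0..})"
    "\<And>\<zeta>. Re \<zeta> > 0 \<Longrightarrow> filterlim (\<lambda>t. \<Phi> t \<zeta>) at_infinity at_top"
    "\<forall>c. Re c = 0 \<longrightarrow> (\<forall>\<omega>. Re \<omega> > 0 \<longrightarrow> P (\<omega> + c) = P \<omega>) \<longrightarrow>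
       (\<forall>t\<ge>0. \<forall>\<zeta>. Re \<zeta> > 0 \<longrightarrow> \<Phi> t (\<zeta> + c) = \<Phi> t \<zeta> + c)"
proof -
  have Pnz: "P \<zeta> \<noteq> 0" if "Re \<zeta> > 0" for \<zeta> using P[OF that] by auto
  have "(\<lambda>\<zeta>. 1 / P \<zeta>) holomorphic_on half_plane"
    by (intro holomorphic_intros holP) (use Pnz in auto)
  from holomorphic_convex_primitive'[OF convex_half_plane open_half_plane this]
  obtain h where "\<And>\<zeta>. \<zeta> \<in> half_plane \<Longrightarrow> (h has_field_derivative 1 / P \<zeta>) (at \<zeta> within half_plane)" by blast
  then have h: "(h has_field_derivative 1 / P \<zeta>) (at \<zeta>)" if "Re \<zeta> > 0" for \<zeta>
    using that by (metis at_within_open mem_Collect_eq open_half_plane)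
  have holh: "h holomorphic_on half_plane"
    unfolding holomorphic_on_open[OF open_half_plane] using h by auto
  have seg: "closed_segment a b \<subseteq> half_plane" if "Re a > 0" "Re b > 0" for a b
    using that convex_half_plane by (intro closed_segment_subset) auto
  have injh: "inj_on h half_plane"
  proof (rule inj_onI, rule ccontr)
    fix a b assume ab: "a \<in> half_plane" "b \<in> half_plane" "h a = h b" "a \<noteq> b"
    \<comment> \<open>Noshiro-Warschawski argument: equal values of \<open>h\<close> at the ends of
      a segment force its derivative \<open>1 / P\<close> to have zero real part at some point of
      the segment.\<close>
    have "\<exists>u. u \<in> closed_segment a b \<and> Re ((h b) / (b - a)) - Re (h a / (b - a)) = Re (1 / P u / (b - a) * (b - a))"
    proof (rule complex_mvt_line[of a b "\<lambda>z. h z / (b - a)" "\<lambda>u. 1 / P u / (b - a)"])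
      fix u assume "u \<in> closed_segment a b"
      then have "Re u > 0" using seg[of a b] ab by auto
      from DERIV_cdivide[OF h[OF this]]
      show "((\<lambda>z. h z / (b - a)) has_field_derivative 1 / P u / (b - a)) (at u)" by simp
    qed
    then obtain u where u: "u \<in> closed_segment a b" "Re (1 / P u) = 0" using ab by auto
    then have "Re (P u) > 0" using seg[of a b] ab P[of u] by auto
    then have "Re (1 / P u) > 0"
      by (auto simp: Re_divide intro!: divide_pos_pos sum_power2_gt_zero_iff[THEN iffD2])
    then show False using u by simp
  qed
  define W where "W = h ` half_plane"
  obtain g where holg: "g holomorphic_on W" and
    dg: "\<And>z. z \<in> half_plane \<Longrightarrow> deriv h z * deriv g (h z) = 1" and gh: "\<And>z. z \<in> half_plane \<Longrightarrow> g (h z) = z"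
    unfolding W_def using holomorphic_has_inverse[OF holh open_half_plane injh] by metis
  have openW: "open W" unfolding W_def by (rule open_mapping_thm3[OF holh open_half_plane injh])
  have gW: "Re (g w) > 0" "h (g w) = w" if "w \<in> W" for w
    using that gh by (auto simp: W_def)
  have dgW: "(g has_field_derivative P (g w)) (at w)" if w: "w \<in> W" for w
  proof -
    have dh: "deriv h (g w) = 1 / P (g w)" by (rule DERIV_imp_deriv[OF h[OF gW(1)[OF w]]])
    then have "deriv g w = P (g w)"
      using dg[of "g w"] gW[OF w] Pnz[of "g w"] dh by simp
    then show ?thesis using holomorphic_derivI[OF holg openW w] by simp
  qed
  have dw: "((\<lambda>s. g (c + of_real s)) has_vector_derivative P (g (c + of_real t))) (at t)"
    if "c + of_real t \<in> W" for c t
  proof -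
    have "((\<lambda>s. c + of_real s) has_vector_derivative 1) (at t)"
      by (auto intro!: derivative_eq_intros)
    from field_vector_diff_chain_at[OF this, of g "P (g (c + of_real t))"] dgW[OF that]
    show ?thesis by (simp add: o_def)
  qed
  have dRe: "((\<lambda>s. Re (g (c + of_real s))) has_real_derivative Re (P (g (c + of_real t)))) (at t)"
    if "c + of_real t \<in> W" for c t
    using bounded_linear.has_vector_derivative[OF bounded_linear_Re dw[OF that]] by (simp add: has_real_derivative_iff_has_vector_derivative)
  have mono: "Re (g c) \<le> Re (g (c + of_real t))"
    if "t \<ge> 0" "\<And>s. 0 \<le> s \<Longrightarrow> s \<le> t \<Longrightarrow> c + of_real s \<in> W" for c t
  proof -
    have "Re (g (c + of_real 0)) \<le> Re (g (c + of_real t))"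
      by (rule DERIV_nonneg_imp_nondecreasing[OF that(1)])
         (metis dRe gW(1) P that(2) less_imp_le)
    then show ?thesis by simp
  qed
  text \<open>The hyperbolic speed \<open>\<bar>P\<bar> / Re\<close> does not increase along trajectories, so a trajectory
    cannot leave every compact subset of the half-plane in finite time.\<close>
  have speed: "cmod (P (g (c + of_real t))) / Re (g (c + of_real t)) \<le> cmod (P (g c)) / Re (g c)"
    if t: "t \<ge> 0" and cW: "\<And>s. 0 \<le> s \<Longrightarrow> s \<le> t \<Longrightarrow> c + of_real s \<in> W" for c t
  proof -
    define w where "w = (\<lambda>s. g (c + of_real s))"
    have w0: "Re (w s) > 0" if "0 \<le> s" "s \<le> t" for s using gW(1)[OF cW[OF that]] by (simp add: w_def)
    define f where "f = (\<lambda>s. ((Re (P (w s)))\<^sup>2 + (Im (P (w s)))\<^sup>2) / (Re (w s))\<^sup>2)"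
    have "f t \<le> f 0"
    proof (rule DERIV_nonpos_imp_nonincreasing[OF t])
      fix s assume s: "0 \<le> s" "s \<le> t"
      let ?D = "deriv P (w s)" and ?p = "P (w s)" and ?x = "Re (w s)"
      have "(w has_vector_derivative ?p) (at s)" using dw[OF cW[OF s]] by (simp add: w_def)
      from field_vector_diff_chain_at[OF this, of P ?D] holomorphic_derivI[OF holP open_half_plane, of "w s"] w0[OF s]
      have v: "((\<lambda>s. P (w s)) has_vector_derivative ?p * ?D) (at s)" by (simp add: o_def)
      have r: "((\<lambda>s. Re (P (w s))) has_real_derivative Re (?p * ?D)) (at s)"
        "((\<lambda>s. Im (P (w s))) has_real_derivative Im (?p * ?D)) (at s)"
        using bounded_linear.has_vector_derivative[OF bounded_linear_Re v] bounded_linear.has_vector_derivative[OF bounded_linear_Im v]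
        by (simp_all add: has_real_derivative_iff_has_vector_derivative)
      have x: "((\<lambda>s. Re (w s)) has_real_derivative Re ?p) (at s)"
        using dRe[OF cW[OF s]] by (simp add: w_def)
      have x0: "?x > 0" by (rule w0[OF s])
      have "(f has_real_derivative ((2 * Re ?p * Re (?p * ?D) + 2 * Im ?p * Im (?p * ?D)) * ?x\<^sup>2 -
          ((Re ?p)\<^sup>2 + (Im ?p)\<^sup>2) * (2 * ?x * Re ?p)) / (?x\<^sup>2 * ?x\<^sup>2)) (at s)"
        unfolding f_def by (rule DERIV_sum_squares_divide_square[OF r x]) (use x0 in simp)
      moreover have "((2 * Re ?p * Re (?p * ?D) + 2 * Im ?p * Im (?p * ?D)) * ?x\<^sup>2 -
          ((Re ?p)\<^sup>2 + (Im ?p)\<^sup>2) * (2 * ?x * Re ?p)) = 2 * ((Re ?p)\<^sup>2 + (Im ?p)\<^sup>2) * ?x * (Re ?D * ?x - Re ?p)"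
        by (simp add: power2_eq_square algebra_simps)
      moreover have "Re ?D * ?x \<le> Re ?p"
        using schwarz_pick_half_plane_deriv[OF holP P x0] complex_Re_le_cmod[of ?D] x0
        by (meson less_imp_le mult_right_mono order_trans)
      then have "2 * ((Re ?p)\<^sup>2 + (Im ?p)\<^sup>2) * ?x * (Re ?D * ?x - Re ?p) \<le> 0"
        using x0 by (intro mult_nonneg_nonpos) auto
      ultimately show "\<exists>y. (f has_real_derivative y) (at s) \<and> y \<le> 0"
        by (metis divide_nonpos_nonneg zero_le_mult_iff zero_le_power2)
    qed
    then have "(cmod (P (w t)) / Re (w t))\<^sup>2 \<le> (cmod (P (w 0)) / Re (w 0))\<^sup>2"
      by (simp add: f_def power_divide cmod_power2)
    then have "cmod (P (w t)) / Re (w t) \<le> cmod (P (w 0)) / Re (w 0)"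
      by (rule power2_le_imp_le) (use w0[of 0] t in auto)
    then show ?thesis by (simp add: w_def)
  qed
  \<comment> \<open>\<open>T\<close> is the first time outside \<open>W\<close>; it belongs to
    \<open>A\<close> because \<open>W\<close> is open. Up to \<open>T\<close> the trajectory lies in
    a compact \<open>K\<close>, so the closed image of \<open>K\<close> under \<open>h\<close>
    contains the limit \<open>c + T\<close>, a contradiction.\<close>
  have shift: "c + of_real t \<in> W" if c: "c \<in> W" and "t \<ge> 0" for c and t :: real
  proof (rule ccontr)
    assume nW: "c + of_real t \<notin> W"
    define A where "A = {t. t \<ge> 0 \<and> c + of_real t \<notin> W}"
    define T where "T = Inf A"
    have "closed A"
    proof -
      have "A = {0..} \<inter> (\<lambda>t. c + of_real t) -` (- W)" by (auto simp: A_def)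
      moreover have "closed ((\<lambda>t::real. c + of_real t) -` (- W))"
        using openW by (intro closed_vimage continuous_intros) auto
      ultimately show ?thesis by (simp add: closed_Int)
    qed
    moreover have "A \<noteq> {}" using nW that by (auto simp: A_def)
    moreover have bdA: "bdd_below A" by (auto simp: A_def bdd_below_def)
    ultimately have TA: "T \<in> A" unfolding T_def by (intro closed_contains_Inf)
    then have T0: "T > 0" using c by (cases "T = 0") (auto simp: A_def)
    have inW: "c + of_real s \<in> W" if "0 \<le> s" "s < T" for s
      using that cInf_lower[OF _ bdA, of s] by (force simp: A_def T_def)
    define w where "w = (\<lambda>s::real. g (c + of_real s))"
    define C where "C = cmod (P (g c)) / Re (g c)"
    have gc: "Re (g c) > 0" using gW(1)[OF c] .
    then have C0: "C \<ge> 0" by (simp add: C_def)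
    have sp: "cmod (P (w s)) \<le> C * Re (w s)" if s: "0 \<le> s" "s < T" for s
    proof -
      have "cmod (P (w s)) / Re (w s) \<le> C"
        unfolding w_def C_def by (rule speed) (use s inW in auto)
      moreover have "Re (w s) > 0" unfolding w_def by (rule gW(1)[OF inW[OF s]])
      ultimately show ?thesis by (simp add: pos_divide_le_eq)
    qed
    \<comment> \<open>A Gronwall estimate: by \<open>sp\<close> the derivative of
      \<open>Re (w s)\<close> is at most \<open>C * Re (w s)\<close>.\<close>
    have growth: "Re (w s) \<le> Re (g c) * exp (C * s)" if s: "0 \<le> s" "s < T" for s
    proof -
      have "Re (w s) * exp (- C * s) \<le> Re (w 0) * exp (- C * 0)"
      proof (rule DERIV_nonpos_imp_nonincreasing[OF s(1), of "\<lambda>s. Re (w s) * exp (- C * s)"])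
        fix r assume r: "0 \<le> r" "r \<le> s"
        then have rW: "c + of_real r \<in> W" using inW s by auto
        have "((\<lambda>s. Re (w s) * exp (- C * s)) has_real_derivative
            (Re (P (w r)) - C * Re (w r)) * exp (- C * r)) (at r)"
          using dRe[OF rW] unfolding w_def by (rule DERIV_mult_exp)
        moreover have "Re (P (w r)) - C * Re (w r) \<le> 0"
          using sp[of r] complex_Re_le_cmod[of "P (w r)"] r s by linarith
        ultimately show "\<exists>y. ((\<lambda>s. Re (w s) * exp (- C * s)) has_real_derivative y) (at r) \<and> y \<le> 0"
          by (meson exp_ge_zero mult_nonpos_nonneg)
      qed
      then have "Re (w s) * exp (- C * s) * exp (C * s) \<le> Re (g c) * exp (C * s)"
        by (intro mult_right_mono) (auto simp: w_def)
      then show ?thesis by (simp add: mult.assoc exp_minus)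
    qed
    define B where "B = C * (Re (g c) * exp (C * T))"
    have B: "cmod (P (w s)) \<le> B" if s: "0 \<le> s" "s < T" for s
    proof -
      have "Re (w s) \<le> Re (g c) * exp (C * T)"
        using growth[OF s] s C0 gc
        by (smt (verit, best) exp_le_cancel_iff mult_left_mono)
      then show ?thesis unfolding B_def using sp[OF s] C0 by (meson mult_left_mono order_trans)
    qed
    \<comment> \<open>A path of speed at most \<open>B\<close> travels at most \<open>B * T\<close>
      before time \<open>T\<close>, and its real part never falls below the initial one, which keeps
      it away from the imaginary axis.\<close>
    define K where "K = cball (g c) (B * T) \<inter> {z. Re z \<ge> Re (g c)}"
    have "compact K" unfolding K_def
      by (intro compact_Int_closed compact_cball closed_halfspace_Re_ge)
    moreover have KH: "K \<subseteq> half_plane" using gc by (auto simp: K_def)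
    ultimately have "compact (h ` K)"
      using holomorphic_on_imp_continuous_on[OF holh] by (intro compact_continuous_image) (auto intro: continuous_on_subset)
    then have clK: "closed (h ` K)" by (rule compact_imp_closed)
    have B0: "B \<ge> 0" using C0 gc by (simp add: B_def)
    have wK: "w s \<in> K" if s: "0 \<le> s" "s < T" for s
    proof -
      have "norm (w s - w 0) \<le> B * norm (s - 0)"
      proof (rule differentiable_bound[where S = "{0..s}" and f' = "\<lambda>r x. x *\<^sub>R P (w r)"])
        fix r assume "r \<in> {0..s}"
        then have r: "0 \<le> r" "r < T" using s by auto
        from dw[OF inW[OF r]] have "(w has_derivative (\<lambda>x. x *\<^sub>R P (w r))) (at r)"
          by (simp add: w_def has_vector_derivative_def)
        then show "(w has_derivative (\<lambda>x. x *\<^sub>R P (w r))) (at r within {0..s})"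
          by (rule has_derivative_at_withinI)
        have "onorm (\<lambda>x::real. x *\<^sub>R P (w r)) = cmod (P (w r))"
          using onorm_scaleR_left[of "\<lambda>x::real. x" "P (w r)"] by (simp add: onorm_id bounded_linear_ident)
        then show "onorm (\<lambda>x. x *\<^sub>R P (w r)) \<le> B" using B[OF r] by simp
      qed (use s in auto)
      also have "\<dots> \<le> B * T" using s B0 by (intro mult_left_mono) auto
      finally have "dist (g c) (w s) \<le> B * T" by (simp add: w_def dist_norm norm_minus_commute)
      moreover have "Re (g c) \<le> Re (w s)" unfolding w_def by (rule mono) (use s inW in auto)
      ultimately show ?thesis by (auto simp: K_def)
    qed
    have lim: "((\<lambda>s. c + of_real s) \<longlongrightarrow> c + of_real T) (at_left T)" by (intro tendsto_intros)
    have ev: "\<forall>\<^sub>F s in at_left T. c + of_real s \<in> h ` K"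
    proof (rule eventually_at_leftI[OF _ T0])
      fix s assume "s \<in> {0<..<T}"
      then have s: "0 \<le> s" "s < T" by auto
      have "h (w s) = c + of_real s" unfolding w_def by (rule gW(2)[OF inW[OF s]])
      then show "c + of_real s \<in> h ` K" using wK[OF s] by (metis imageI)
    qed
    have "c + of_real T \<in> h ` K"
      by (rule Lim_in_closed_set[OF clK ev _ lim]) simp
    then show False using TA KH by (auto simp: A_def W_def)
  qed
  define \<Phi> where "\<Phi> = (\<lambda>t \<zeta>. g (h \<zeta> + of_real t))"
  have hW: "h \<zeta> \<in> W" if "Re \<zeta> > 0" for \<zeta> using that by (auto simp: W_def)
  have h\<Phi>: "h (\<Phi> t \<zeta>) = h \<zeta> + of_real t" if "t \<ge> 0" "Re \<zeta> > 0" for t \<zeta>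
    unfolding \<Phi>_def by (intro gW(2) shift hW that)
  have 2: "Re (\<Phi> t \<zeta>) \<ge> Re \<zeta>" if "t \<ge> 0" "Re \<zeta> > 0" for t \<zeta>
  proof -
    have "Re (g (h \<zeta>)) \<le> Re (g (h \<zeta> + of_real t))"
      by (rule mono) (use that shift hW in auto)
    then show ?thesis using gh[of \<zeta>] that by (simp add: \<Phi>_def)
  qed
  show thesis
  proof (rule that[of \<Phi>])
    fix t :: real assume t: "t \<ge> 0"
    have "(\<lambda>\<zeta>. h \<zeta> + of_real t) holomorphic_on half_plane" by (intro holomorphic_intros holh)
    from holomorphic_on_compose_gen[OF this holg] show "\<Phi> t holomorphic_on half_plane"
      using shift hW t by (auto simp: \<Phi>_def o_def image_subset_iff)
  next
    fix t :: real and \<zeta> assume t: "t \<ge> 0" "Re \<zeta> > 0"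
    then show "Re (\<Phi> t \<zeta>) \<ge> Re \<zeta>" by (rule 2)
  next
    fix \<zeta> :: complex assume "Re \<zeta> > 0"
    then show "\<Phi> 0 \<zeta> = \<zeta>" using gh by (simp add: \<Phi>_def)
  next
    fix s t :: real and \<zeta> assume "s \<ge> 0" "t \<ge> 0" "Re \<zeta> > 0"
    then show "\<Phi> s (\<Phi> t \<zeta>) = \<Phi> (s + t) \<zeta>"
      using h\<Phi>[of t \<zeta>] by (simp add: \<Phi>_def add_ac)
  next
    fix t :: real and \<zeta> assume t: "t \<ge> 0" "Re \<zeta> > 0"
    show "((\<lambda>s. \<Phi> s \<zeta>) has_vector_derivative P (\<Phi> t \<zeta>)) (at t within {0..})"
      unfolding \<Phi>_def by (rule has_vector_derivative_at_within, rule dw) (intro shift hW t)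
  next
    fix \<zeta> :: complex assume \<zeta>: "Re \<zeta> > 0"
    show "filterlim (\<lambda>t. \<Phi> t \<zeta>) at_infinity at_top"
      unfolding filterlim_at_infinity[OF order_refl]
    proof (intro allI impI)
      fix r :: real assume "r > 0"
      \<comment> \<open>The real part does not decrease, so a trajectory point within distance
        \<open>r\<close> of 0 lies in this compact set. There \<open>h\<close> is bounded, whereas
        \<open>h\<close> grows by \<open>t\<close> along the trajectory.\<close>
      define K where "K = cball 0 r \<inter> {z. Re z \<ge> Re \<zeta>}"
      have "compact K" unfolding K_def by (intro compact_Int_closed compact_cball closed_halfspace_Re_ge)
      moreover have KH: "K \<subseteq> half_plane" using \<zeta> by (auto simp: K_def)
      ultimately have "compact (h ` K)"
        using holomorphic_on_imp_continuous_on[OF holh] by (intro compact_continuous_image) (auto intro: continuous_on_subset)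
      then obtain b where b: "\<And>z. z \<in> K \<Longrightarrow> cmod (h z) \<le> b"
        using compact_imp_bounded[of "h ` K"] by (auto simp: bounded_iff)
      show "\<forall>\<^sub>F t in at_top. r \<le> cmod (\<Phi> t \<zeta>)"
        using eventually_gt_at_top[of "b + cmod (h \<zeta>)"] eventually_ge_at_top[of 0]
      proof eventually_elim
        case (elim t)
        show ?case
        proof (rule ccontr)
          assume "\<not> r \<le> cmod (\<Phi> t \<zeta>)"
          then have "\<Phi> t \<zeta> \<in> K" using 2[OF elim(2) \<zeta>] by (auto simp: K_def)
          then have "cmod (h \<zeta> + of_real t) \<le> b" using b h\<Phi>[OF elim(2) \<zeta>] by metis
          moreover have "t \<le> cmod (h \<zeta> + of_real t) + cmod (h \<zeta>)"
            using norm_triangle_ineq4[of "h \<zeta> + of_real t" "h \<zeta>"] elim by simp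
          ultimately show False using elim by simp
        qed
      qed
    qed
  next
    show "\<forall>c. Re c = 0 \<longrightarrow> (\<forall>\<omega>. Re \<omega> > 0 \<longrightarrow> P (\<omega> + c) = P \<omega>) \<longrightarrow>
       (\<forall>t\<ge>0. \<forall>\<zeta>. Re \<zeta> > 0 \<longrightarrow> \<Phi> t (\<zeta> + c) = \<Phi> t \<zeta> + c)"
    proof (intro allI impI)
      fix c \<zeta> :: complex and t :: real
      assume c: "Re c = 0" "\<forall>\<omega>. Re \<omega> > 0 \<longrightarrow> P (\<omega> + c) = P \<omega>" and t: "t \<ge> 0" and \<zeta>: "Re \<zeta> > 0"
      \<comment> \<open>By periodicity of \<open>P\<close> the difference has derivative 0. Thus
        \<open>h\<close> turns the translation by \<open>c\<close> into a translation by
        \<open>k\<close>, which commutes with the translation by \<open>t\<close>.\<close>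
      have "\<exists>k. \<forall>\<omega>\<in>half_plane. h (\<omega> + c) - h \<omega> = k"
      proof (rule has_field_derivative_zero_constant[OF convex_half_plane])
        fix \<omega> assume w: "\<omega> \<in> half_plane"
        have "((\<lambda>\<omega>. h (\<omega> + c)) has_field_derivative 1 / P (\<omega> + c)) (at \<omega>)"
          using h[of "\<omega> + c"] w c(1) DERIV_shift[of h _ \<omega> c] by simp
        from DERIV_diff[OF this h[of \<omega>]] w c(2)
        show "((\<lambda>\<omega>. h (\<omega> + c) - h \<omega>) has_field_derivative 0) (at \<omega> within half_plane)"
          by (auto intro: has_field_derivative_at_within)
      qed
      then obtain k where k: "\<And>\<omega>. Re \<omega> > 0 \<Longrightarrow> h (\<omega> + c) = h \<omega> + k"
        by (metis add.commute diff_add_cancel mem_Collect_eq)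
      have p: "Re (\<Phi> t \<zeta>) > 0" using 2[OF t \<zeta>] \<zeta> by simp
      have "h (\<Phi> t \<zeta> + c) = h (\<zeta> + c) + of_real t"
        using k[OF p] k[OF \<zeta>] h\<Phi>[OF t \<zeta>] by simp
      then show "\<Phi> t (\<zeta> + c) = \<Phi> t \<zeta> + c"
        using gh[of "\<Phi> t \<zeta> + c"] p c(1) by (simp add: \<Phi>_def)
    qed
  qed
qed

subsection \<open>Berkson--Porta: sufficiency\<close>

lemma has_vector_derivative_chain_within:
  assumes "(f has_vector_derivative f') (at t within A)" "(M has_field_derivative M') (at (f t))"
  shows "((\<lambda>s. M (f s)) has_vector_derivative f' * M') (at t within A)"
  using field_vector_diff_chain_within[OF assms(1) has_field_derivative_at_within[OF assms(2)]]
  by (simp add: o_def)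

lemma semigroup_continuous_at_0:
  assumes "\<phi> 0 z = z" "((\<lambda>s. \<phi> s z) has_vector_derivative v) (at 0 within {0::real..})"
  shows "((\<lambda>t. \<phi> t z) \<longlongrightarrow> z) (at_right 0)"
proof -
  have "continuous (at 0 within {0..}) (\<lambda>s. \<phi> s z)"
    by (rule has_vector_derivative_continuous[OF assms(2)])
  then have "((\<lambda>s. \<phi> s z) \<longlongrightarrow> \<phi> 0 z) (at 0 within {0..})"
    by (simp add: continuous_within)
  then have "((\<lambda>s. \<phi> s z) \<longlongrightarrow> \<phi> 0 z) (at 0 within {0<..})"
    by (rule tendsto_within_subset) auto
  then show ?thesis using assms(1) by simp
qed

text \<open>\<open>C\<close> carries \<tau> to infinity and the field to
  \<open>2 * p (Ci \<zeta>)\<close>: the derivative \<open>2 * \<tau> / (\<tau> - z)\<^sup>2\<close>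
  of \<open>C\<close> cancels \<open>(\<tau> - z) * (1 - cnj \<tau> * z)\<close> up to the factor
  2.\<close>

lemma boundary_flow:
  assumes holp: "p holomorphic_on ball 0 1" and p: "\<And>z. cmod z < 1 \<Longrightarrow> Re (p z) > 0"
    and \<tau>: "cmod \<tau> = 1"
  obtains \<phi> where "holo_semigroup \<phi>" "dw_point \<phi> \<tau>"
    "generates (\<lambda>z. (\<tau> - z) * (1 - cnj \<tau> * z) * p z) \<phi>"
proof -
  define C where "C = herglotz \<tau>"
  define Ci where "Ci = (\<lambda>\<zeta>. \<tau> * (\<zeta> - 1) / (\<zeta> + 1))"
  have "\<tau> \<noteq> 0" using \<tau> by auto
  then have tau0: "\<tau> \<noteq> 0" "cnj \<tau> = 1 / \<tau>"
    using circle_cnj[OF \<tau>] by (simp_all add: eq_divide_eq mult.commute)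
  have nz: "\<zeta> + 1 \<noteq> 0" if "Re \<zeta> > 0" for \<zeta> using that by (auto simp: complex_eq_iff)
  have ReC: "Re (C z) > 0" if "cmod z < 1" for z
    using that \<tau> by (simp add: C_def Re_herglotz poisson_pos)
  have CiC: "Ci (C z) = z" if "cmod z < 1" for z
  proof -
    have d: "\<tau> - z \<noteq> 0" using circle_neq_disk \<tau> that by blast
    then have "C z + 1 = 2 * \<tau> / (\<tau> - z)" "C z - 1 = 2 * z / (\<tau> - z)"
      by (auto simp: C_def herglotz_def field_simps)
    then show ?thesis using d tau0 by (simp add: Ci_def)
  qed
  have Ci1: "cmod (Ci \<zeta>) < 1" if "Re \<zeta> > 0" for \<zeta>
  proof -
    have "(cmod (\<zeta> + 1))\<^sup>2 - (cmod (\<zeta> - 1))\<^sup>2 = 4 * Re \<zeta>"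
      unfolding cmod_power2 by (simp add: power2_eq_square algebra_simps)
    then have "(cmod (\<zeta> - 1))\<^sup>2 < (cmod (\<zeta> + 1))\<^sup>2" using that by simp
    then have "cmod (\<zeta> - 1) < cmod (\<zeta> + 1)" by (rule power_less_imp_less_base) simp
    then show ?thesis using nz[OF that] \<tau> by (simp add: Ci_def norm_divide norm_mult)
  qed
  have CCi: "C (Ci \<zeta>) = \<zeta>" if "Re \<zeta> > 0" for \<zeta>
  proof -
    have "\<tau> + Ci \<zeta> = 2 * \<tau> * \<zeta> / (\<zeta> + 1)" "\<tau> - Ci \<zeta> = 2 * \<tau> / (\<zeta> + 1)"
      using nz[OF that] by (auto simp: Ci_def field_simps)
    then show ?thesis using nz[OF that] tau0 by (simp add: C_def herglotz_def)
  qed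
  have holCi: "Ci holomorphic_on half_plane"
    unfolding Ci_def by (intro holomorphic_intros) (use nz in auto)
  have holC: "C holomorphic_on ball 0 1" unfolding C_def by (rule holomorphic_herglotz[OF \<tau>])
  have dCi: "(Ci has_field_derivative (\<tau> - Ci \<zeta>) * (1 - cnj \<tau> * Ci \<zeta>) / 2) (at \<zeta>)" if "Re \<zeta> > 0" for \<zeta>
  proof -
    have "(Ci has_field_derivative 2 * \<tau> / (\<zeta> + 1)\<^sup>2) (at \<zeta>)"
      unfolding Ci_def using nz[OF that]
      by (auto intro!: derivative_eq_intros simp: power2_eq_square field_simps)
    moreover have "\<tau> - Ci \<zeta> = 2 * \<tau> / (\<zeta> + 1)" using nz[OF that] by (auto simp: Ci_def field_simps)
    moreover have "1 - cnj \<tau> * Ci \<zeta> = 2 / (\<zeta> + 1)" using nz[OF that] tau0 by (auto simp: Ci_def field_simps)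
    ultimately show ?thesis by (simp add: power2_eq_square)
  qed
  define P where "P = (\<lambda>\<zeta>. 2 * p (Ci \<zeta>))"
  have holP: "P holomorphic_on half_plane"
    unfolding P_def using holomorphic_on_compose_gen[OF holCi holp] Ci1
    by (intro holomorphic_intros) (auto simp: o_def image_subset_iff)
  have P: "Re (P \<zeta>) > 0" if "Re \<zeta> > 0" for \<zeta> using p[OF Ci1[OF that]] by (simp add: P_def)
  obtain \<Phi> :: "real \<Rightarrow> complex \<Rightarrow> complex" where
    hol: "\<And>t. t \<ge> 0 \<Longrightarrow> \<Phi> t holomorphic_on half_plane" and
    mono: "\<And>t \<zeta>. t \<ge> 0 \<Longrightarrow> Re \<zeta> > 0 \<Longrightarrow> Re (\<Phi> t \<zeta>) \<ge> Re \<zeta>" and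
    \<Phi>0: "\<And>\<zeta>. Re \<zeta> > 0 \<Longrightarrow> \<Phi> 0 \<zeta> = \<zeta>" and
    semi: "\<And>s t \<zeta>. s \<ge> 0 \<Longrightarrow> t \<ge> 0 \<Longrightarrow> Re \<zeta> > 0 \<Longrightarrow> \<Phi> s (\<Phi> t \<zeta>) = \<Phi> (s + t) \<zeta>" and
    der: "\<And>t \<zeta>. t \<ge> 0 \<Longrightarrow> Re \<zeta> > 0 \<Longrightarrow>
       ((\<lambda>s. \<Phi> s \<zeta>) has_vector_derivative P (\<Phi> t \<zeta>)) (at t within {0..})" and
    inf: "\<And>\<zeta>. Re \<zeta> > 0 \<Longrightarrow> filterlim (\<lambda>t. \<Phi> t \<zeta>) at_infinity at_top"
    by (rule half_plane_flow[OF holP P]) (assumption | rule that)+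
  have Phip: "Re (\<Phi> t \<zeta>) > 0" if "t \<ge> 0" "Re \<zeta> > 0" for t \<zeta> using mono[OF that] that by simp
  define \<phi> where "\<phi> = (\<lambda>t z. Ci (\<Phi> t (C z)))"
  have d\<phi>: "((\<lambda>s. \<phi> s z) has_vector_derivative (\<tau> - \<phi> t z) * (1 - cnj \<tau> * \<phi> t z) * p (\<phi> t z)) (at t within {0..})"
    if "cmod z < 1" "t \<ge> 0" for z t
    using has_vector_derivative_chain_within[OF der dCi, of t "C z"] Phip ReC that
    by (simp add: \<phi>_def P_def mult_ac)
  show thesis
  proof (rule that[of \<phi>])
    show "holo_semigroup \<phi>"
      unfolding holo_semigroup_def
    proof (intro conjI allI ballI impI)
      fix t :: real assume t: "t \<ge> 0"
      have "(\<Phi> t \<circ> C) holomorphic_on ball 0 1"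
        by (rule holomorphic_on_compose_gen[OF holC hol[OF t]]) (use ReC in auto)
      from holomorphic_on_compose_gen[OF this holCi] show "\<phi> t holomorphic_on ball 0 1"
        using Phip ReC t by (auto simp: \<phi>_def o_def image_subset_iff)
      show "\<phi> t ` ball 0 1 \<subseteq> ball 0 1" using Ci1 Phip ReC t by (auto simp: \<phi>_def)
    next
      fix z :: complex assume "z \<in> ball 0 1"
      then show "\<phi> 0 z = z" using \<Phi>0 ReC CiC by (simp add: \<phi>_def)
    next
      fix s t :: real and z :: complex assume "s \<ge> 0" "t \<ge> 0" "z \<in> ball 0 1"
      then show "\<phi> s (\<phi> t z) = \<phi> (s + t) z"
        using semi ReC CCi Phip by (simp add: \<phi>_def)
    next
      fix z :: complex assume z: "z \<in> ball 0 1"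
      then have "\<phi> 0 z = z" using \<Phi>0 ReC CiC by (simp add: \<phi>_def)
      from semigroup_continuous_at_0[of \<phi>, OF this d\<phi>[of z 0]] z
      show "((\<lambda>t. \<phi> t z) \<longlongrightarrow> z) (at_right 0)" by simp
    qed
    show "generates (\<lambda>z. (\<tau> - z) * (1 - cnj \<tau> * z) * p z) \<phi>"
      unfolding generates_def by (auto intro!: holomorphic_intros holp d\<phi>)
    have "((\<lambda>t. \<phi> t z) \<longlongrightarrow> \<tau>) at_top" if z: "cmod z < 1" for z
    proof -
      have "filterlim (\<lambda>t. 1 + \<Phi> t (C z)) at_infinity at_top"
        by (rule tendsto_add_filterlim_at_infinity[OF tendsto_const inf[OF ReC[OF z]]])
      then have "((\<lambda>t. - 2 * \<tau> / (1 + \<Phi> t (C z))) \<longlongrightarrow> 0) at_top"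
        by (rule tendsto_divide_0[OF tendsto_const])
      then have "((\<lambda>t. \<tau> + - 2 * \<tau> / (1 + \<Phi> t (C z))) \<longlongrightarrow> \<tau> + 0) at_top"
        by (intro tendsto_add tendsto_const)
      moreover have "\<forall>\<^sub>F t in at_top. \<tau> + - 2 * \<tau> / (1 + \<Phi> t (C z)) = \<phi> t z"
        using eventually_ge_at_top[of 0]
      proof eventually_elim
        case (elim t)
        have "\<Phi> t (C z) + 1 \<noteq> 0" using nz[OF Phip[OF elim ReC[OF z]]] .
        then show ?case by (simp add: \<phi>_def Ci_def field_simps)
      qed
      ultimately show ?thesis by (auto intro: Lim_transform_eventually)
    qed
    then show "dw_point \<phi> \<tau>" using \<tau> by (simp add: dw_point_def)
  qed
qed

section \<open>Flows with an interior Denjoy-Wolff point\<close>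

lemma exp_eq_period: "exp a = exp b \<Longrightarrow> \<exists>k::int. a = b + 2 * of_int k * of_real pi * \<i>"
  using exp_eq[of a b] by (auto simp: mult_ac)

text \<open>The substitution \<open>u = exp (- \<zeta>)\<close> turns the field \<open>- u r(u)\<close> into the
  \<open>2\<pi>\<i>\<close>-periodic field \<open>r(exp (- \<zeta>))\<close> on the half-plane, whose flow descends to the disk.\<close>
lemma origin_flow:
  assumes holr: "r holomorphic_on ball 0 1" and r: "\<And>z. cmod z < 1 \<Longrightarrow> Re (r z) > 0"
  obtains \<psi> :: "real \<Rightarrow> complex \<Rightarrow> complex" where
    "\<And>t. t \<ge> 0 \<Longrightarrow> \<psi> t holomorphic_on ball 0 1"
    "\<And>t u. t \<ge> 0 \<Longrightarrow> cmod u < 1 \<Longrightarrow> cmod (\<psi> t u) \<le> cmod u"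
    "\<And>u. cmod u < 1 \<Longrightarrow> \<psi> 0 u = u"
    "\<And>s t u. s \<ge> 0 \<Longrightarrow> t \<ge> 0 \<Longrightarrow> cmod u < 1 \<Longrightarrow> \<psi> s (\<psi> t u) = \<psi> (s + t) u"
    "\<And>t u. t \<ge> 0 \<Longrightarrow> cmod u < 1 \<Longrightarrow>
       ((\<lambda>s. \<psi> s u) has_vector_derivative - \<psi> t u * r (\<psi> t u)) (at t within {0..})"
proof -
  define P where "P = (\<lambda>\<zeta>. r (exp (- \<zeta>)))"
  have e1: "cmod (exp (- \<zeta>)) < 1" if "Re \<zeta> > 0" for \<zeta> using that by simp
  have "(\<lambda>\<zeta>. exp (- \<zeta>)) holomorphic_on half_plane" by (intro holomorphic_intros)
  from holomorphic_on_compose_gen[OF this holr] have holP: "P holomorphic_on half_plane"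
    using e1 by (auto simp: P_def o_def image_subset_iff)
  have P: "Re (P \<zeta>) > 0" if "Re \<zeta> > 0" for \<zeta> using r[OF e1[OF that]] by (simp add: P_def)
  obtain \<Phi> :: "real \<Rightarrow> complex \<Rightarrow> complex" where
    hol: "\<And>t. t \<ge> 0 \<Longrightarrow> \<Phi> t holomorphic_on half_plane" and
    mono: "\<And>t \<zeta>. t \<ge> 0 \<Longrightarrow> Re \<zeta> > 0 \<Longrightarrow> Re (\<Phi> t \<zeta>) \<ge> Re \<zeta>" and
    \<Phi>0: "\<And>\<zeta>. Re \<zeta> > 0 \<Longrightarrow> \<Phi> 0 \<zeta> = \<zeta>" and
    semi: "\<And>s t \<zeta>. s \<ge> 0 \<Longrightarrow> t \<ge> 0 \<Longrightarrow> Re \<zeta> > 0 \<Longrightarrow> \<Phi> s (\<Phi> t \<zeta>) = \<Phi> (s + t) \<zeta>" and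
    der: "\<And>t \<zeta>. t \<ge> 0 \<Longrightarrow> Re \<zeta> > 0 \<Longrightarrow>
       ((\<lambda>s. \<Phi> s \<zeta>) has_vector_derivative P (\<Phi> t \<zeta>)) (at t within {0..})" and
    "\<And>\<zeta>. Re \<zeta> > 0 \<Longrightarrow> filterlim (\<lambda>t. \<Phi> t \<zeta>) at_infinity at_top" and
    per: "\<forall>c. Re c = 0 \<longrightarrow> (\<forall>\<omega>. Re \<omega> > 0 \<longrightarrow> P (\<omega> + c) = P \<omega>) \<longrightarrow>
       (\<forall>t\<ge>0. \<forall>\<zeta>. Re \<zeta> > 0 \<longrightarrow> \<Phi> t (\<zeta> + c) = \<Phi> t \<zeta> + c)"
    by (rule half_plane_flow[OF holP P]) (assumption | rule that)+
  \<comment> \<open>The value at 0 is set by hand, since 0 has no logarithm; elsewhere the choice of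
    the logarithm turns out not to matter.\<close>
  define \<psi> where "\<psi> = (\<lambda>t u. if u = 0 then 0 else exp (- \<Phi> t (- Ln u)))"
  have exp_per: "exp (- (\<omega> + 2 * of_int k * of_real pi * \<i>)) = exp (- \<omega>)" for \<omega> and k :: int
    unfolding exp_eq by (auto intro!: exI[of _ "- k"] simp: algebra_simps)
  have \<psi>exp: "\<psi> t (exp (- \<zeta>)) = exp (- \<Phi> t \<zeta>)" if t: "t \<ge> 0" and \<zeta>: "Re \<zeta> > 0" for t \<zeta>
  proof -
    have "exp (Ln (exp (- \<zeta>))) = exp (- \<zeta>)" by simp
    then obtain k :: int where k: "Ln (exp (- \<zeta>)) = - \<zeta> + 2 * of_int k * of_real pi * \<i>"
      using exp_eq_period by blast
    then have "- Ln (exp (- \<zeta>)) = \<zeta> + 2 * of_int (- k) * of_real pi * \<i>" by simp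
    \<comment> \<open>Two logarithms of the same point differ by a period of \<open>P\<close>, and
      the flow commutes with the translation by it.\<close>
    moreover have "\<Phi> t (\<zeta> + 2 * of_int (- k) * of_real pi * \<i>) = \<Phi> t \<zeta> + 2 * of_int (- k) * of_real pi * \<i>"
      by (rule per[rule_format, OF _ _ t \<zeta>]) (simp, simp only: P_def exp_per)
    ultimately have "\<psi> t (exp (- \<zeta>)) = exp (- (\<Phi> t \<zeta> + 2 * of_int (- k) * of_real pi * \<i>))"
      by (simp only: \<psi>_def exp_not_eq_zero if_False)
    then show ?thesis by (simp only: exp_per)
  qed
  have rep: "\<exists>\<zeta>. Re \<zeta> > 0 \<and> u = exp (- \<zeta>)" if "cmod u < 1" "u \<noteq> 0" for u
    using that by (intro exI[of _ "- Ln u"]) auto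
  have le: "cmod (\<psi> t u) \<le> cmod u" if t: "t \<ge> 0" and u: "cmod u < 1" for t u
  proof (cases "u = 0")
    case False
    then obtain \<zeta> where "Re \<zeta> > 0" "u = exp (- \<zeta>)" using rep u by blast
    then show ?thesis using \<psi>exp[OF t] mono[OF t] by simp
  qed (simp add: \<psi>_def)
  have Phip: "Re (\<Phi> t \<zeta>) > 0" if "t \<ge> 0" "Re \<zeta> > 0" for t \<zeta> using mono[OF that] that by simp
  have hol0: "\<psi> t holomorphic_on ball 0 1 - {0}" if t: "t \<ge> 0" for t
  proof -
    have "\<exists>f'. (\<psi> t has_field_derivative f') (at u0)" if u0: "u0 \<in> ball 0 1 - {0}" for u0
    proof -
      \<comment> \<open>On \<open>U\<close> the quotient \<open>u / u0\<close> has positive real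
        part, so \<open>L\<close> below is a holomorphic branch of the negative logarithm near
        \<open>u0\<close>, even when \<open>u0\<close> lies on the cut of \<open>Ln\<close>.\<close>
      define U where "U = (ball 0 1 - {0}) \<inter> (\<lambda>u. u / u0) -` half_plane"
      have "continuous_on UNIV (\<lambda>u. u / u0)" using u0 by (intro continuous_intros) auto
      then have "open U" unfolding U_def
        by (intro open_Int open_vimage open_half_plane open_Diff) auto
      moreover have "u0 \<in> U" using u0 by (simp add: U_def)
      moreover define L where "L = (\<lambda>u. - (Ln (u / u0) + Ln u0))"
      have "L holomorphic_on U" unfolding L_def
        by (intro holomorphic_intros) (use u0 in \<open>auto simp: U_def complex_nonpos_Reals_iff\<close>)
      moreover have eL: "exp (- L u) = u" if "u \<noteq> 0" for u
        using that u0 by (simp add: L_def exp_add)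
      have ReL: "Re (L u) > 0" if "u \<in> U" for u
      proof -
        have "exp (- Re (L u)) = cmod u" using eL[of u] that norm_exp_eq_Re[of "- L u"] by (auto simp: U_def)
        moreover have "cmod u < 1" using that by (auto simp: U_def)
        ultimately show ?thesis by (metis exp_less_one_iff neg_less_0_iff_less)
      qed
      ultimately have "(\<lambda>u. exp (- \<Phi> t (L u))) holomorphic_on U"
        using holomorphic_on_compose_gen[OF _ hol[OF t], of L U]
        by (intro holomorphic_intros) (auto simp: o_def)
      moreover have "exp (- \<Phi> t (L u)) = \<psi> t u" if "u \<in> U" for u
        using \<psi>exp[OF t ReL[OF that]] eL[of u] that by (auto simp: U_def)
      ultimately have "\<psi> t holomorphic_on U"
        by (metis (no_types, lifting) holomorphic_cong)
      then show ?thesis using \<open>open U\<close> \<open>u0 \<in> U\<close> by (meson holomorphic_on_open)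
    qed
    then show ?thesis by (subst holomorphic_on_open) auto
  qed
  show thesis
  proof (rule that[of \<psi>])
    fix t :: real assume t: "t \<ge> 0"
    show "\<psi> t holomorphic_on ball 0 1"
    \<comment> \<open>The bound \<open>cmod (\<psi> t u) \<le> cmod u\<close> makes
      \<open>\<psi> t\<close> continuous at 0, so the puncture is removable.\<close>
    proof (rule no_isolated_singularity'[of "{0}"])
      fix z :: complex assume "z \<in> {0}"
      have ev: "\<forall>\<^sub>F u in at 0 within ball 0 1. cmod (\<psi> t u) \<le> cmod u"
        using le[OF t] by (auto simp: eventually_at_filter)
      have "((\<lambda>u. cmod u) \<longlongrightarrow> 0) (at 0 within ball (0::complex) 1)"
        by (rule tendsto_norm_zero, rule tendsto_ident_at)
      from Lim_null_comparison[OF ev this]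
      show "(\<psi> t \<longlongrightarrow> \<psi> t z) (at z within ball 0 1)" using \<open>z \<in> {0}\<close> by (simp add: \<psi>_def)
    qed (use hol0[OF t] in auto)
  next
    fix t :: real and u :: complex assume "t \<ge> 0" "cmod u < 1"
    then show "cmod (\<psi> t u) \<le> cmod u" by (rule le)
  next
    fix u :: complex assume u: "cmod u < 1"
    show "\<psi> 0 u = u"
    proof (cases "u = 0")
      case False
      then obtain \<zeta> where "Re \<zeta> > 0" "u = exp (- \<zeta>)" using rep u by blast
      then show ?thesis using \<psi>exp \<Phi>0 by simp
    qed (simp add: \<psi>_def)
  next
    fix s t :: real and u :: complex assume st: "s \<ge> 0" "t \<ge> 0" and u: "cmod u < 1"
    show "\<psi> s (\<psi> t u) = \<psi> (s + t) u"
    proof (cases "u = 0")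
      case False
      then obtain \<zeta> where "Re \<zeta> > 0" "u = exp (- \<zeta>)" using rep u by blast
      then show ?thesis using \<psi>exp semi Phip st by simp
    qed (simp add: \<psi>_def)
  next
    fix t :: real and u :: complex assume t: "t \<ge> 0" and u: "cmod u < 1"
    show "((\<lambda>s. \<psi> s u) has_vector_derivative - \<psi> t u * r (\<psi> t u)) (at t within {0..})"
    proof (cases "u = 0")
      case True
      then show ?thesis by (simp add: \<psi>_def)
    next
      case False
      then obtain \<zeta> where \<zeta>: "Re \<zeta> > 0" "u = exp (- \<zeta>)" using rep u by blast
      have "((\<lambda>w. exp (- w)) has_field_derivative - exp (- \<Phi> t \<zeta>)) (at (\<Phi> t \<zeta>))"
        by (auto intro!: derivative_eq_intros)
      from has_vector_derivative_chain_within[OF der[OF t \<zeta>(1)] this]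
      have d: "((\<lambda>s. exp (- \<Phi> s \<zeta>)) has_vector_derivative P (\<Phi> t \<zeta>) * - exp (- \<Phi> t \<zeta>)) (at t within {0..})" .
      have "((\<lambda>s. \<psi> s u) has_vector_derivative P (\<Phi> t \<zeta>) * - exp (- \<Phi> t \<zeta>)) (at t within {0..})"
        by (rule has_vector_derivative_transform[OF _ _ d]) (use t \<zeta> \<psi>exp in auto)
      then show ?thesis using \<psi>exp[OF t \<zeta>(1)] \<zeta>(2) by (simp add: P_def mult_ac)
    qed
  qed
qed

text \<open>Yields the nontriviality clause of \<open>dw_point\<close> for interior points; its
  contrapositive gives \<open>G \<tau> = 0\<close> at a common fixed point \<tau>.\<close>

lemma generates_not_trivial:
  assumes "generates G \<phi>" "holo_semigroup \<phi>" "cmod z < 1" "G z \<noteq> 0"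
  shows "\<exists>t\<ge>0. \<phi> t z \<noteq> z"
proof (rule ccontr)
  assume "\<not> ?thesis"
  then have c: "\<phi> t z = z" if "t \<ge> 0" for t using that by auto
  have "((\<lambda>s. \<phi> s z) has_vector_derivative G (\<phi> 0 z)) (at 0 within {0..})"
    using assms by (auto simp: generates_def)
  moreover have "((\<lambda>s. \<phi> s z) has_vector_derivative 0) (at 0 within {0..})"
    by (rule has_vector_derivative_transform[of _ _ _ "\<lambda>_. z"]) (use c in auto)
  ultimately have "G (\<phi> 0 z) = 0"
    by (rule vector_derivative_unique_within[rotated]) (simp add: at_within_Ici_at_right)
  then show False using c[of 0] assms by simp
qed

text \<open>Conjugation by the automorphism \<open>m\<close> moves \<tau> to 0, where
  \<open>origin_flow\<close> applies; the field becomes \<open>- u * r u\<close>, with the positive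
  constant \<open>k = 1 - (cmod \<tau>)\<^sup>2\<close> absorbed in \<open>r\<close>.\<close>

lemma interior_flow:
  assumes holp: "p holomorphic_on ball 0 1" and p: "\<And>z. cmod z < 1 \<Longrightarrow> Re (p z) > 0"
    and \<tau>: "cmod \<tau> < 1"
  obtains \<phi> where "holo_semigroup \<phi>" "dw_point \<phi> \<tau>"
    "generates (\<lambda>z. (\<tau> - z) * (1 - cnj \<tau> * z) * p z) \<phi>"
proof -
  define m where "m = (\<lambda>z. (z - \<tau>) / (1 - cnj \<tau> * z))"
  define M where "M = (\<lambda>u. (u + \<tau>) / (1 + cnj \<tau> * u))"
  have m1: "cmod (m z) < 1" if "cmod z < 1" for z unfolding m_def by (rule moebius_lt_1[OF \<tau> that])
  have M1: "cmod (M u) < 1" if "cmod u < 1" for u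
    using moebius_lt_1[of "-\<tau>" u] \<tau> that by (simp add: M_def)
  have nzm: "1 - cnj \<tau> * z \<noteq> 0" if "cmod z < 1" for z using disk_cnj_neq[of \<tau> z] \<tau> that by simp
  have nzM: "1 + cnj \<tau> * u \<noteq> 0" if "cmod u < 1" for u using disk_cnj_neq[of "-\<tau>" u] \<tau> that by simp
  define k where "k = 1 - (cmod \<tau>)\<^sup>2"
  have k0: "k > 0" using \<tau> by (simp add: k_def abs_square_less_1)
  have kk: "of_real k = 1 - \<tau> * cnj \<tau>" by (simp only: k_def complex_norm_square of_real_diff of_real_1)
  have kne: "1 - \<tau> * cnj \<tau> \<noteq> 0" using k0 kk by (metis less_irrefl of_real_eq_0_iff)
  have Mm: "M (m z) = z" if "cmod z < 1" for z
  proof -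
    have "m z + \<tau> = z * (1 - \<tau> * cnj \<tau>) / (1 - cnj \<tau> * z)" "1 + cnj \<tau> * m z = (1 - \<tau> * cnj \<tau>) / (1 - cnj \<tau> * z)"
      unfolding m_def using nzm[OF that] by (simp_all add: divide_simps) (simp_all add: algebra_simps)
    then show ?thesis unfolding M_def using kne nzm[OF that] by simp
  qed
  have M1': "1 - cnj \<tau> * M u = (1 - \<tau> * cnj \<tau>) / (1 + cnj \<tau> * u)" if "cmod u < 1" for u
    unfolding M_def using nzM[OF that] by (simp add: divide_simps) (simp add: algebra_simps)
  have M2': "M u - \<tau> = u * (1 - \<tau> * cnj \<tau>) / (1 + cnj \<tau> * u)" if "cmod u < 1" for u
    unfolding M_def using nzM[OF that] by (simp add: divide_simps) (simp add: algebra_simps)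
  have mM: "m (M u) = u" if "cmod u < 1" for u
    unfolding m_def M1'[OF that] M2'[OF that] using kne nzM[OF that] by simp
  have dM: "(M has_field_derivative (1 - \<tau> * cnj \<tau>) / (1 + cnj \<tau> * u)\<^sup>2) (at u)" if "cmod u < 1" for u
    unfolding M_def using nzM[OF that]
    by (auto intro!: derivative_eq_intros simp: power2_eq_square algebra_simps)
  have holm: "m holomorphic_on ball 0 1" unfolding m_def by (intro holomorphic_intros) (use nzm in auto)
  have holM: "M holomorphic_on ball 0 1" unfolding M_def by (intro holomorphic_intros) (use nzM in auto)
  define r where "r = (\<lambda>u. of_real k * p (M u))"
  have holr: "r holomorphic_on ball 0 1" unfolding r_def using holomorphic_on_compose_gen[OF holM holp] M1
    by (intro holomorphic_intros) (auto simp: o_def image_subset_iff)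
  have r: "Re (r u) > 0" if "cmod u < 1" for u using p[OF M1[OF that]] k0 by (simp add: r_def)
  obtain \<psi> :: "real \<Rightarrow> complex \<Rightarrow> complex" where
    hol: "\<And>t. t \<ge> 0 \<Longrightarrow> \<psi> t holomorphic_on ball 0 1" and
    le: "\<And>t u. t \<ge> 0 \<Longrightarrow> cmod u < 1 \<Longrightarrow> cmod (\<psi> t u) \<le> cmod u" and
    \<psi>0: "\<And>u. cmod u < 1 \<Longrightarrow> \<psi> 0 u = u" and
    semi: "\<And>s t u. s \<ge> 0 \<Longrightarrow> t \<ge> 0 \<Longrightarrow> cmod u < 1 \<Longrightarrow> \<psi> s (\<psi> t u) = \<psi> (s + t) u" and
    der: "\<And>t u. t \<ge> 0 \<Longrightarrow> cmod u < 1 \<Longrightarrow>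
       ((\<lambda>s. \<psi> s u) has_vector_derivative - \<psi> t u * r (\<psi> t u)) (at t within {0..})"
    by (rule origin_flow[OF holr r]) (assumption | rule that)+
  have \<psi>1: "cmod (\<psi> t u) < 1" if "t \<ge> 0" "cmod u < 1" for t u using le[OF that] that by simp
  define \<phi> where "\<phi> = (\<lambda>t z. M (\<psi> t (m z)))"
  have \<phi>1: "cmod (\<phi> t z) < 1" if "t \<ge> 0" "cmod z < 1" for t z
    unfolding \<phi>_def by (intro M1 \<psi>1 m1 that)
  have d\<phi>: "((\<lambda>s. \<phi> s z) has_vector_derivative (\<tau> - \<phi> t z) * (1 - cnj \<tau> * \<phi> t z) * p (\<phi> t z)) (at t within {0..})"
    if z: "cmod z < 1" and t: "t \<ge> 0" for z t
  proof -
    define u where "u = \<psi> t (m z)"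
    have u: "cmod u < 1" unfolding u_def by (intro \<psi>1 m1 z t)
    have e: "\<phi> t z = M u" by (simp add: \<phi>_def u_def)
    have "((\<lambda>s. \<phi> s z) has_vector_derivative (- u * r u) * ((1 - \<tau> * cnj \<tau>) / (1 + cnj \<tau> * u)\<^sup>2)) (at t within {0..})"
      using has_vector_derivative_chain_within[OF der[OF t m1[OF z]] dM[OF \<psi>1[OF t m1[OF z]]]]
      by (simp add: \<phi>_def u_def)
    moreover have "(- u * r u) * ((1 - \<tau> * cnj \<tau>) / (1 + cnj \<tau> * u)\<^sup>2) = (\<tau> - M u) * (1 - cnj \<tau> * M u) * p (M u)"
    proof -
      have "\<tau> - M u = - (u * (1 - \<tau> * cnj \<tau>) / (1 + cnj \<tau> * u))" using M2'[OF u] by (simp add: algebra_simps)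
      then show ?thesis unfolding M1'[OF u] r_def kk by (simp add: power2_eq_square)
    qed
    ultimately show ?thesis by (simp add: e)
  qed
  have hs: "holo_semigroup \<phi>"
    unfolding holo_semigroup_def
  proof (intro conjI allI ballI impI)
    fix t :: real assume t: "t \<ge> 0"
    have "(\<psi> t \<circ> m) holomorphic_on ball 0 1"
      by (rule holomorphic_on_compose_gen[OF holm hol[OF t]]) (use m1 in auto)
    from holomorphic_on_compose_gen[OF this holM] show "\<phi> t holomorphic_on ball 0 1"
      using \<psi>1[OF t] m1 by (auto simp: \<phi>_def o_def image_subset_iff)
    show "\<phi> t ` ball 0 1 \<subseteq> ball 0 1" using \<phi>1[OF t] by auto
  next
    fix z :: complex assume "z \<in> ball 0 1"
    then show "\<phi> 0 z = z" using \<psi>0 m1 Mm by (simp add: \<phi>_def)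
  next
    fix s t :: real and z :: complex assume "s \<ge> 0" "t \<ge> 0" "z \<in> ball 0 1"
    then show "\<phi> s (\<phi> t z) = \<phi> (s + t) z"
      using semi m1 mM \<psi>1 by (simp add: \<phi>_def)
  next
    fix z :: complex assume z: "z \<in> ball 0 1"
    then have "\<phi> 0 z = z" using \<psi>0 m1 Mm by (simp add: \<phi>_def)
    from semigroup_continuous_at_0[of \<phi>, OF this d\<phi>[of z 0]] z
    show "((\<lambda>t. \<phi> t z) \<longlongrightarrow> z) (at_right 0)" by simp
  qed
  have gen: "generates (\<lambda>z. (\<tau> - z) * (1 - cnj \<tau> * z) * p z) \<phi>"
    unfolding generates_def by (auto intro!: holomorphic_intros holp d\<phi>)
  have "\<exists>z. cmod z < 1 \<and> z \<noteq> \<tau>"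
    by (cases "\<tau> = 0") (auto intro: exI[of _ "1/2"] exI[of _ 0])
  then obtain z where z: "cmod z < 1" "z \<noteq> \<tau>" by blast
  have "\<exists>t\<ge>0. \<phi> t z \<noteq> z"
    by (rule generates_not_trivial[OF gen hs z(1)]) (use z p[OF z(1)] nzm[OF z(1)] in auto)
  then have "\<exists>t\<ge>0. \<exists>z\<in>ball 0 1. \<phi> t z \<noteq> z" using z(1) by (metis mem_ball_0)
  moreover have "\<forall>t\<ge>0. \<phi> t \<tau> = \<tau>"
    using le[of _ 0] by (simp add: \<phi>_def m_def M_def)
  ultimately have "dw_point \<phi> \<tau>" using \<tau> by (simp add: dw_point_def)
  then show thesis using that hs gen by blast
qed

text \<open>Strict positivity is used for the flow, which integrates \<open>1 / P\<close>; in the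
  class at hand a boundary fixed point forces it, by \<open>admissible_of_GenF\<close>.\<close>

theorem berkson_porta_sufficient:
  assumes "p holomorphic_on ball 0 1" and "\<And>z. cmod z < 1 \<Longrightarrow> Re (p z) > 0" and "cmod \<tau> \<le> 1"
  obtains \<phi> where "holo_semigroup \<phi>" "dw_point \<phi> \<tau>"
    "generates (\<lambda>z. (\<tau> - z) * (1 - cnj \<tau> * z) * p z) \<phi>"
  using assms boundary_flow[of p \<tau>] interior_flow[of p \<tau>] by (cases "cmod \<tau> = 1") force+

subsection \<open>Boundary fixed points from the generator\<close>

text \<open>In the coordinate \<open>u = 1 - cnj \<sigma> * w\<close> scaling by \<open>c\<close>
  preserves directions and \<open>v\<close> turns them only slightly. \<open>1 - cmod w\<close>
  falls short of \<open>Re u\<close> by at most \<open>(cmod u)\<^sup>2 / 2\<close>, and the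
  smallness hypothesis makes this term harmless. The opening \<open>4 * M\<close> is
  generous.\<close>

lemma stolz_perturb:
  assumes \<sigma>: "cmod \<sigma> = 1" and M: "M > 1" and z: "z \<in> stolz \<sigma> M" and c: "c > 0"
    and v: "cmod (v - 1) \<le> 1 / (4 * M)" and small: "c * cmod (\<sigma> - z) \<le> 1 / (4 * M)"
    and w: "w = \<sigma> + (z - \<sigma>) * of_real c * v" "cmod w < 1"
  shows "w \<in> stolz \<sigma> (4 * M)"
proof -
  define u0 where "u0 = 1 - cnj \<sigma> * z"
  define u where "u = 1 - cnj \<sigma> * w"
  define E where "E = c * cmod u0"
  have n0: "cmod u0 = cmod (\<sigma> - z)" unfolding u0_def by (rule norm_one_minus_cnj_circle[OF \<sigma>])
  have z1: "cmod z < 1" "cmod u0 < M * (1 - cmod z)" using z n0 by (auto simp: stolz_def)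
  have E0: "E > 0" unfolding E_def n0 using c circle_neq_disk[OF \<sigma> z1(1)] by simp
  have u: "u = u0 * of_real c * v"
    unfolding u_def u0_def w(1) using circle_cnj[OF \<sigma>] by (simp add: algebra_simps)
  have "Re (cnj \<sigma> * z) \<le> cmod z"
    using complex_Re_le_cmod[of "cnj \<sigma> * z"] \<sigma> by (simp add: norm_mult)
  then have "1 - cmod z \<le> Re u0" by (simp add: u0_def)
  then have "cmod u0 \<le> M * Re u0" using z1(2) M
    by (smt (verit, best) mult_left_mono)
  then have R0: "cmod u0 / M \<le> Re u0" using M by (simp add: divide_le_eq mult.commute)
  have "\<bar>Re (u0 * (v - 1))\<bar> \<le> cmod u0 * cmod (v - 1)"
    using abs_Re_le_cmod[of "u0 * (v - 1)"] by (simp add: norm_mult)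
  also have "\<dots> \<le> cmod u0 * (1 / (4 * M))" using v by (intro mult_left_mono) auto
  finally have "Re (u0 * (v - 1)) \<ge> - (cmod u0 / (4 * M))" by simp
  moreover have "Re u = c * (Re u0 + Re (u0 * (v - 1)))"
    unfolding u by (simp add: algebra_simps)
  moreover have "cmod u0 / M + - (cmod u0 / (4 * M)) = 3 * cmod u0 / (4 * M)" using M by (simp add: field_simps)
  ultimately have "Re u \<ge> c * (3 * cmod u0 / (4 * M))"
    using R0 c by (smt (verit, best) mult_left_mono)
  then have Ru: "Re u \<ge> 3 * E / (4 * M)" by (simp add: E_def mult_ac)
  have "cmod v \<le> 1 + cmod (v - 1)" using norm_triangle_ineq[of 1 "v - 1"] by simp
  moreover have "1 / (4 * M) \<le> 1 / 4" using M by (simp add: field_simps)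
  ultimately have "cmod v \<le> 5 / 4" using v by simp
  then have nu: "cmod u \<le> 5 / 4 * E"
    unfolding u E_def norm_mult using c mult_left_mono[of "cmod v" "5/4" "c * cmod u0"] by (simp add: mult_ac)
  have "cmod (cnj \<sigma> * w) = cmod w" using \<sigma> by (simp add: norm_mult)
  then have "cmod w = cmod (1 - u)" by (simp add: u_def)
  moreover have "(cmod (1 - u))\<^sup>2 = 1 - 2 * Re u + (cmod u)\<^sup>2"
    unfolding cmod_power2 by (simp add: power2_eq_square algebra_simps)
  ultimately have w2: "(cmod w)\<^sup>2 = 1 - 2 * Re u + (cmod u)\<^sup>2" by simp
  have "(1 - (cmod w)\<^sup>2) = (1 - cmod w) * (1 + cmod w)" by (simp add: power2_eq_square algebra_simps)
  also have "\<dots> \<le> (1 - cmod w) * 2" using w(2) by (intro mult_left_mono) auto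
  finally have 1: "1 - cmod w \<ge> Re u - (cmod u)\<^sup>2 / 2" unfolding w2 by simp
  have "(cmod u)\<^sup>2 \<le> (5 / 4 * E)\<^sup>2" using nu by (intro power_mono) auto
  also have "\<dots> = 25 / 16 * (E * E)" by (simp add: power2_eq_square)
  also have "E * E \<le> E * (1 / (4 * M))" using small E0 by (intro mult_left_mono) (auto simp: E_def n0)
  finally have "(cmod u)\<^sup>2 \<le> 25 / 16 * (E / (4 * M))" by simp
  then have "1 - cmod w \<ge> 3 * E / (4 * M) - 25 / 32 * (E / (4 * M))" using 1 Ru by simp
  \<comment> \<open>25/32 is half the square of the bound 5/4 for \<open>cmod v\<close>. The result
    71/32 exceeds 5/4, and 5/4 is the constant that bounds \<open>cmod u\<close> in terms of
    \<open>E\<close>.\<close>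
  moreover have "3 * E / (4 * M) - 25 / 32 * (E / (4 * M)) = 71 / 32 * (E / (4 * M))" by simp
  ultimately have "4 * M * (1 - cmod w) \<ge> 4 * M * (71 / 32 * (E / (4 * M)))"
    using M by (intro mult_left_mono) auto
  then have "4 * M * (1 - cmod w) \<ge> 71 / 32 * E" using M by simp
  moreover have "cmod (\<sigma> - w) = cmod u" unfolding u_def by (rule norm_one_minus_cnj_circle[OF \<sigma>, symmetric])
  ultimately show ?thesis using nu E0 w(2) by (auto simp: stolz_def)
qed

lemma quotient_rule_aux:
  fixes a c E g b :: complex
  assumes "a \<noteq> 0"
  shows "a / c * (b * E) + g / c * E = a / c * E * (g / a + b)"
  using assms by (cases "c = 0") (simp_all add: field_simps)

lemma norm_vector_derivative_bound:
  fixes f :: "real \<Rightarrow> complex"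
  assumes "0 \<le> b" "\<And>s. 0 \<le> s \<Longrightarrow> s \<le> b \<Longrightarrow> (f has_vector_derivative f' s) (at s within {0..})"
    and "\<And>s. 0 \<le> s \<Longrightarrow> s \<le> b \<Longrightarrow> cmod (f' s) \<le> B"
  shows "cmod (f b - f 0) \<le> B * b"
proof -
  have "norm (f b - f 0) \<le> B * norm (b - 0)"
  proof (rule differentiable_bound[where S = "{0..b}" and f' = "\<lambda>r x. x *\<^sub>R f' r"])
    fix r assume "r \<in> {0..b}"
    then have r: "0 \<le> r" "r \<le> b" by auto
    from assms(2)[OF r] show "(f has_derivative (\<lambda>x. x *\<^sub>R f' r)) (at r within {0..b})"
      unfolding has_vector_derivative_def by (rule has_derivative_subset) auto
    have "onorm (\<lambda>x::real. x *\<^sub>R f' r) = cmod (f' r)"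
      using onorm_scaleR_left[of "\<lambda>x::real. x" "f' r"] by (simp add: onorm_id bounded_linear_ident)
    then show "onorm (\<lambda>x. x *\<^sub>R f' r) \<le> B" using assms(3)[OF r] by simp
  qed (use assms in auto)
  then show ?thesis using assms(1) by simp
qed

text \<open>Near \<open>\<sigma>\<close> the generator is close to \<open>\<beta> (z - \<sigma>)\<close>, so the normalised displacement
  \<open>v\<close> stays close to 1; a first time at which \<open>\<bar>v - 1\<bar> = \<eta>\<close> is impossible, because
  up to that time the trajectory has not left a larger Stolz angle.\<close>
lemma boundary_quotient_estimate:
  assumes hs: "holo_semigroup \<phi>" and gen: "generates G \<phi>" and \<sigma>: "cmod \<sigma> = 1" and M: "M > 1"
    and t: "t \<ge> 0" and \<eta>: "0 < \<eta>" "\<eta> \<le> 1 / (4 * M)"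
    and z: "z \<in> stolz \<sigma> M" and small: "exp (\<bar>\<beta>\<bar> * t) * cmod (\<sigma> - z) \<le> 1 / (4 * M)"
      "2 * exp (\<bar>\<beta>\<bar> * t) * cmod (\<sigma> - z) < d"
    and G: "\<And>w. w \<in> stolz \<sigma> (4 * M) \<Longrightarrow> cmod (\<sigma> - w) < d \<Longrightarrow>
       cmod (G w / (w - \<sigma>) - of_real \<beta>) \<le> \<eta> / (2 * (t + 1))"
  shows "cmod ((\<phi> t z - \<sigma>) / (z - \<sigma>) * of_real (exp (- \<beta> * t)) - 1) < \<eta>"
proof (rule ccontr)
  define v where "v = (\<lambda>s. (\<phi> s z - \<sigma>) / (z - \<sigma>) * of_real (exp (- \<beta> * s)))"
  assume "\<not> ?thesis"
  then have vt: "cmod (v t - 1) \<ge> \<eta>" by (simp add: v_def)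
  have z1: "cmod z < 1" using z by (simp add: stolz_def)
  have zs: "z - \<sigma> \<noteq> 0" using z1 \<sigma> by auto
  have \<phi>1: "cmod (\<phi> s z) < 1" if "s \<ge> 0" for s
    using hs that z1 by (auto simp: holo_semigroup_def image_subset_iff)
  have \<phi>s: "\<phi> s z - \<sigma> \<noteq> 0" if "s \<ge> 0" for s using \<phi>1[OF that] \<sigma> by auto
  have v0: "v 0 = 1" using hs z1 zs by (simp add: v_def holo_semigroup_def)
  have d\<phi>: "((\<lambda>s. \<phi> s z) has_vector_derivative G (\<phi> s z)) (at s within {0..})" if "s \<ge> 0" for s
    using gen that z1 by (auto simp: generates_def)
  \<comment> \<open>The factor \<open>exp (- \<beta> * s)\<close> removes the leading part of the
    motion, so the coefficient of this linear equation is only the deviation of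
    \<open>G w / (w - \<sigma>)\<close> from its limit \<beta>.\<close>
  have dv: "(v has_vector_derivative v s * (G (\<phi> s z) / (\<phi> s z - \<sigma>) - of_real \<beta>)) (at s within {0..})"
    if s: "s \<ge> 0" for s
  proof -
    have e: "((\<lambda>s. of_real (exp (- \<beta> * s))) has_vector_derivative complex_of_real (- \<beta> * exp (- \<beta> * s))) (at s within {0..})"
      by (rule has_vector_derivative_of_real) (auto intro!: derivative_eq_intros simp: has_real_derivative_iff_has_vector_derivative[symmetric])
    have q: "((\<lambda>s. (\<phi> s z - \<sigma>) / (z - \<sigma>)) has_vector_derivative G (\<phi> s z) / (z - \<sigma>)) (at s within {0..})"
    proof -
      have "((\<lambda>w. (w - \<sigma>) / (z - \<sigma>)) has_field_derivative 1 / (z - \<sigma>)) (at (\<phi> s z))"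
        using zs by (auto intro!: derivative_eq_intros)
      from has_vector_derivative_chain_within[OF d\<phi>[OF s] this] show ?thesis by simp
    qed
    have "(\<phi> s z - \<sigma>) / (z - \<sigma>) * complex_of_real (- \<beta> * exp (- \<beta> * s)) + G (\<phi> s z) / (z - \<sigma>) * of_real (exp (- \<beta> * s)) =
        v s * (G (\<phi> s z) / (\<phi> s z - \<sigma>) - of_real \<beta>)"
      using quotient_rule_aux[OF \<phi>s[OF s], of "z - \<sigma>" "- of_real \<beta>" "of_real (exp (- \<beta> * s))" "G (\<phi> s z)"]
      unfolding v_def of_real_mult of_real_minus by simp
    with has_vector_derivative_mult[OF q e] show ?thesis
      unfolding v_def[symmetric] by (simp add: v_def[abs_def])
  qed
  have contv: "continuous_on {0..t} v"
    unfolding continuous_on_eq_continuous_within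
  proof
    fix s assume "s \<in> {0..t}"
    then have "continuous (at s within {0..}) v" using has_vector_derivative_continuous[OF dv] by auto
    then show "continuous (at s within {0..t}) v" by (rule continuous_within_subset) auto
  qed
  define r where "r = (\<lambda>s. cmod (v s - 1))"
  have contr: "continuous_on {0..t} r" unfolding r_def by (intro continuous_intros contv)
  define S where "S = {s \<in> {0..t}. \<eta> \<le> r s}"
  have "S = {0..t} \<inter> r -` {\<eta>..}" by (auto simp: S_def)
  then have "closed S" using continuous_closed_preimage[OF contr, of "{\<eta>..}"] by simp
  moreover have "t \<in> S" using vt t by (simp add: S_def r_def)
  moreover have bS: "bdd_below S" by (auto simp: S_def bdd_below_def)
  ultimately have InfS: "Inf S \<in> S" by (intro closed_contains_Inf) auto
  define b where "b = Inf S"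
  have b: "0 \<le> b" "b \<le> t" "r b \<ge> \<eta>" using InfS by (auto simp: S_def b_def)
  have lt: "r s < \<eta>" if "0 \<le> s" "s < b" for s
    using cInf_lower[OF _ bS, of s] that b by (force simp: S_def b_def)
  \<comment> \<open>Continuity makes the value exactly \<eta> at the first exit time
    \<open>b\<close>, so the bound by \<eta> holds on all of \<open>{0..b}\<close>, endpoint
    included.\<close>
  obtain x where x: "0 \<le> x" "x \<le> b" "r x = \<eta>"
    using IVT'[of r 0 \<eta> b] v0 \<eta> b continuous_on_subset[OF contr, of "{0..b}"] by (auto simp: r_def)
  then have "x = b" using lt[of x] by (cases "x < b") auto
  then have le: "r s \<le> \<eta>" if "0 \<le> s" "s \<le> b" for s
    using lt[of s] x that by (cases "s = b") auto
  have bnd: "cmod (v s * (G (\<phi> s z) / (\<phi> s z - \<sigma>) - of_real \<beta>)) \<le> 5 / 4 * (\<eta> / (2 * (t + 1)))"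
    if s: "0 \<le> s" "s \<le> b" for s
  proof -
    have v1: "cmod (v s - 1) \<le> \<eta>" using le[OF s] by (simp add: r_def)
    have eq: "\<phi> s z = \<sigma> + (z - \<sigma>) * of_real (exp (\<beta> * s)) * v s"
      using zs by (simp add: v_def exp_minus field_simps flip: of_real_mult)
    have "\<beta> * s \<le> \<bar>\<beta>\<bar> * t" using s b by (meson abs_ge_self abs_ge_zero mult_mono order_trans)
    then have e: "exp (\<beta> * s) \<le> exp (\<bar>\<beta>\<bar> * t)" by simp
    have "1 / (4 * M) \<le> 1 / 4" using M by (simp add: field_simps)
    then have v54: "cmod (v s) \<le> 5 / 4" using norm_triangle_ineq[of 1 "v s - 1"] v1 \<eta> by simp
    have es: "exp (\<beta> * s) * cmod (\<sigma> - z) \<le> exp (\<bar>\<beta>\<bar> * t) * cmod (\<sigma> - z)"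
      using e by (intro mult_right_mono) auto
    have st: "\<phi> s z \<in> stolz \<sigma> (4 * M)"
      by (rule stolz_perturb[OF \<sigma> M z _ _ _ eq \<phi>1[OF s(1)]]) (use v1 \<eta> es small in auto)
    have "cmod (\<sigma> - \<phi> s z) = cmod ((z - \<sigma>) * of_real (exp (\<beta> * s)) * v s)"
      unfolding eq by (simp add: norm_minus_commute)
    also have "\<dots> = exp (\<beta> * s) * cmod (\<sigma> - z) * cmod (v s)"
      by (simp add: norm_mult norm_minus_commute)
    also have "\<dots> \<le> (exp (\<bar>\<beta>\<bar> * t) * cmod (\<sigma> - z)) * 2"
      using es v54 by (intro mult_mono[OF es]) auto
    also have "\<dots> < d" using small(2) by (simp add: mult_ac)
    finally have "cmod (G (\<phi> s z) / (\<phi> s z - \<sigma>) - of_real \<beta>) \<le> \<eta> / (2 * (t + 1))" by (rule G[OF st])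
    with v54 show ?thesis unfolding norm_mult by (intro mult_mono) auto
  qed
  have "cmod (v b - v 0) \<le> 5 / 4 * (\<eta> / (2 * (t + 1))) * b"
    by (rule norm_vector_derivative_bound[OF b(1) dv bnd]) auto
  also have "\<dots> \<le> 5 / 4 * (\<eta> / (2 * (t + 1))) * t" using b t \<eta> by (intro mult_left_mono) auto
  \<comment> \<open>The bound \<open>\<eta> / (2 * (t + 1))\<close> in the hypothesis on
    \<open>G\<close> is chosen for this: 5/8 times \<open>t / (t + 1)\<close> is less than 1, and
    \<open>t + 1\<close> avoids a division by 0 at \<open>t = 0\<close>.\<close>
  also have "\<dots> < \<eta>" using t \<eta>(1) by (simp add: field_simps add_strict_increasing2)
  finally show False using b v0 by (simp add: r_def)
qed

theorem brfp_of_angular_limit: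
  assumes hs: "holo_semigroup \<phi>" and gen: "generates G \<phi>" and \<sigma>: "cmod \<sigma> = 1"
    and lim: "angular_limit (\<lambda>z. G z / (z - \<sigma>)) \<sigma> (of_real \<beta>)"
  shows "brfp_spectral \<phi> \<sigma> (- \<beta>)"
proof -
  have quot: "angular_limit (\<lambda>z. (\<phi> t z - \<sigma>) / (z - \<sigma>)) \<sigma> (of_real (exp (\<beta> * t)))" if t: "t \<ge> 0" for t
    unfolding angular_limit_stolz
  proof (intro allI impI tendstoI)
    fix M e :: real assume M: "M > 1" and e: "e > 0"
    \<comment> \<open>\<open>boundary_quotient_estimate\<close> measures the error relative to
      \<open>exp (\<beta> * t)\<close>, hence the rescaled \<open>e\<close>; the other bound is its
      hypothesis on \<eta>.\<close>
    define \<eta> where "\<eta> = min (1 / (4 * M)) (e / exp (\<beta> * t))"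
    have \<eta>: "0 < \<eta>" "\<eta> \<le> 1 / (4 * M)" using M e by (auto simp: \<eta>_def)
    have "\<eta> \<le> e / exp (\<beta> * t)" by (simp add: \<eta>_def)
    then have \<eta>e: "\<eta> * exp (\<beta> * t) \<le> e" by (simp add: le_divide_eq)
    have "((\<lambda>z. G z / (z - \<sigma>)) \<longlongrightarrow> of_real \<beta>) (at \<sigma> within stolz \<sigma> (4 * M))"
      using lim M by (simp add: angular_limit_stolz)
    moreover have "\<eta> / (2 * (t + 1)) > 0" using \<eta> t by simp
    ultimately have "\<forall>\<^sub>F z in at \<sigma> within stolz \<sigma> (4 * M). dist (G z / (z - \<sigma>)) (of_real \<beta>) < \<eta> / (2 * (t + 1))"
      by (rule tendstoD)
    then obtain d where d: "d > 0" and D: "\<And>w. w \<in> stolz \<sigma> (4 * M) \<Longrightarrow> w \<noteq> \<sigma> \<Longrightarrow> dist w \<sigma> < d \<Longrightarrow>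
        dist (G w / (w - \<sigma>)) (of_real \<beta>) < \<eta> / (2 * (t + 1))"
      unfolding eventually_at by blast
    let ?X = "exp (\<bar>\<beta>\<bar> * t)"
    define \<delta> where "\<delta> = min (1 / (4 * M) / ?X) (d / (2 * ?X))"
    have "\<delta> > 0" using M d by (simp add: \<delta>_def)
    moreover have "dist ((\<phi> t z - \<sigma>) / (z - \<sigma>)) (of_real (exp (\<beta> * t))) < e"
      if z: "z \<in> stolz \<sigma> M" "dist z \<sigma> < \<delta>" for z
    proof -
      let ?v = "(\<phi> t z - \<sigma>) / (z - \<sigma>) * of_real (exp (- \<beta> * t))"
      have dz: "cmod (\<sigma> - z) < \<delta>" using z(2) by (simp add: dist_norm norm_minus_commute)
      have "cmod (?v - 1) < \<eta>"
      proof (rule boundary_quotient_estimate[OF hs gen \<sigma> M t \<eta> z(1), where d = d])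
        have "cmod (\<sigma> - z) \<le> 1 / (4 * M) / ?X" using dz by (simp add: \<delta>_def)
        then have "cmod (\<sigma> - z) * ?X \<le> 1 / (4 * M)" unfolding pos_le_divide_eq[OF exp_gt_zero] .
        then show "?X * cmod (\<sigma> - z) \<le> 1 / (4 * M)" by (simp add: mult.commute)
        have "cmod (\<sigma> - z) < d / (2 * ?X)" using dz by (simp add: \<delta>_def)
        then show "2 * ?X * cmod (\<sigma> - z) < d" by (simp add: less_divide_eq mult_ac)
        fix w assume "w \<in> stolz \<sigma> (4 * M)" "cmod (\<sigma> - w) < d"
        moreover from this have "w \<noteq> \<sigma>" using \<sigma> by (auto simp: stolz_def)
        ultimately show "cmod (G w / (w - \<sigma>) - of_real \<beta>) \<le> \<eta> / (2 * (t + 1))"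
          using D[of w] by (simp add: dist_norm norm_minus_commute)
      qed
      then have lt: "cmod (?v - 1) * exp (\<beta> * t) < \<eta> * exp (\<beta> * t)" by (intro mult_strict_right_mono) auto
      have ee: "complex_of_real (exp (- \<beta> * t)) * of_real (exp (\<beta> * t)) = 1"
        by (simp flip: of_real_mult exp_add)
      have "(?v - 1) * of_real (exp (\<beta> * t)) = (\<phi> t z - \<sigma>) / (z - \<sigma>) - of_real (exp (\<beta> * t))"
        unfolding left_diff_distrib mult.assoc ee by simp
      then have "dist ((\<phi> t z - \<sigma>) / (z - \<sigma>)) (of_real (exp (\<beta> * t))) = cmod ((?v - 1) * of_real (exp (\<beta> * t)))"
        by (simp only: dist_norm)
      also have "\<dots> = cmod (?v - 1) * exp (\<beta> * t)" by (simp only: norm_mult norm_of_real abs_exp_cancel)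
      also note lt
      also note \<eta>e
      finally show ?thesis .
    qed
    ultimately show "\<forall>\<^sub>F z in at \<sigma> within stolz \<sigma> M. dist ((\<phi> t z - \<sigma>) / (z - \<sigma>)) (of_real (exp (\<beta> * t))) < e"
      unfolding eventually_at by blast
  qed
  have "angular_limit (\<phi> t) \<sigma> \<sigma>" if t: "t \<ge> 0" for t
  proof -
    have "angular_limit (\<lambda>z. (\<phi> t z - \<sigma>) / (z - \<sigma>) * (z - \<sigma>)) \<sigma> (of_real (exp (\<beta> * t)) * (\<sigma> - \<sigma>))"
      by (intro angular_limit_mult quot[OF t] angular_limit_of_tendsto tendsto_intros)
    then have "angular_limit (\<lambda>z. (\<phi> t z - \<sigma>) / (z - \<sigma>) * (z - \<sigma>) + \<sigma>) \<sigma> (0 + \<sigma>)"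
      by (intro angular_limit_add) (auto intro: angular_limit_of_tendsto)
    moreover have "(\<phi> t z - \<sigma>) / (z - \<sigma>) * (z - \<sigma>) + \<sigma> = \<phi> t z" if "cmod z < 1" for z
      using that \<sigma> by auto
    ultimately show ?thesis
      using angular_limit_cong[of "\<lambda>z. (\<phi> t z - \<sigma>) / (z - \<sigma>) * (z - \<sigma>) + \<sigma>" "\<phi> t" \<sigma> \<sigma>] by simp
  qed
  then show ?thesis using quot \<sigma> by (simp add: brfp_spectral_def)
qed

subsection \<open>Berkson--Porta: necessity\<close>

lemma divide_cross_le: "0 < b \<Longrightarrow> 0 < d \<Longrightarrow> a * d \<le> c * b \<Longrightarrow> a / b \<le> c / (d::real)"
  by (simp add: field_simps)

lemma angular_limit_transform:
  "angular_limit f \<sigma> L \<Longrightarrow> (\<And>z. cmod z < 1 \<Longrightarrow> f z = g z) \<Longrightarrow> angular_limit g \<sigma> L"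
  using angular_limit_cong by blast

lemma right_derivative_nonneg:
  fixes f :: "real \<Rightarrow> real"
  assumes d: "(f has_real_derivative D) (at 0 within {0..})" and f: "\<And>t. t > 0 \<Longrightarrow> f 0 \<le> f t"
  shows "D \<ge> 0"
proof -
  have "((\<lambda>t. (f t - f 0) / (t - 0)) \<longlongrightarrow> D) (at 0 within {0..})"
    using d by (simp add: has_field_derivative_iff)
  moreover have "\<forall>\<^sub>F t in at 0 within {0..}. 0 \<le> (f t - f 0) / (t - 0)"
    using f by (auto simp: eventually_at_filter)
  moreover have "at 0 within {0::real..} \<noteq> bot" by (simp add: at_within_Ici_at_right)
  ultimately show ?thesis by (intro tendsto_lowerbound)
qed

lemma semigroup_derivative_at_0:
  assumes hs: "holo_semigroup \<phi>" and gen: "generates G \<phi>" and z: "cmod z < 1"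
    and F: "(F has_field_derivative F') (at z)"
  shows "((\<lambda>t. Re (F (\<phi> t z))) has_real_derivative Re (F' * G z)) (at 0 within {0..})"
proof -
  have \<phi>0: "\<phi> 0 z = z" using hs z by (simp add: holo_semigroup_def)
  have d: "((\<lambda>s. \<phi> s z) has_vector_derivative G z) (at 0 within {0..})"
    using gen z \<phi>0 by (force simp: generates_def)
  from has_vector_derivative_chain_within[OF d, of F F'] F \<phi>0
  have "((\<lambda>t. F (\<phi> t z)) has_vector_derivative G z * F') (at 0 within {0..})" by simp
  from bounded_linear.has_vector_derivative[OF bounded_linear_Re this]
  show ?thesis by (simp add: has_real_derivative_iff_has_vector_derivative mult.commute)
qed

lemma semigroup_maps_disk: "holo_semigroup \<phi> \<Longrightarrow> t \<ge> 0 \<Longrightarrow> cmod z < 1 \<Longrightarrow> cmod (\<phi> t z) < 1"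
  by (auto simp: holo_semigroup_def image_subset_iff)

lemma DERIV_herglotz:
  assumes "\<sigma> \<noteq> z"
  shows "(herglotz \<sigma> has_field_derivative 2 * \<sigma> / (\<sigma> - z)\<^sup>2) (at z)"
  unfolding herglotz_def[abs_def] using assms
  by (auto intro!: derivative_eq_intros simp: power2_eq_square divide_simps)

text \<open>Wolff's lemma: Schwarz--Pick is applied along an orbit \<open>w j\<close> tending to \<open>\<tau>\<close>; the
  distances \<open>1 - \<bar>w j\<bar>\<^sup>2\<close> tend to 0, so they are not eventually strictly increasing.\<close>
lemma wolff_lemma:
  assumes hs: "holo_semigroup \<phi>" and \<tau>: "cmod \<tau> = 1" and lim: "\<And>z. cmod z < 1 \<Longrightarrow> ((\<lambda>t. \<phi> t z) \<longlongrightarrow> \<tau>) at_top"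
    and t: "t > 0" and z: "cmod z < 1"
  shows "poisson \<tau> z \<le> poisson \<tau> (\<phi> t z)"
proof -
  define w where "w = (\<lambda>j::nat. \<phi> (real j * t) 0)"
  have w1: "cmod (w j) < 1" for j unfolding w_def using t by (intro semigroup_maps_disk[OF hs]) auto
  have wSuc: "\<phi> t (w j) = w (Suc j)" for j
    unfolding w_def using hs t by (simp add: holo_semigroup_def algebra_simps)
  have "filterlim (\<lambda>j. real j * t) at_top sequentially"
    using t by (intro filterlim_at_top_mult_tendsto_pos[OF tendsto_const _ filterlim_real_sequentially]) auto
  from filterlim_compose[OF lim[of 0] this] have wlim: "w \<longlonglongrightarrow> \<tau>" by (simp add: w_def)
  define e where "e = (\<lambda>j. 1 - (cmod (w j))\<^sup>2)"
  have e0: "e j > 0" for j using w1[of j] by (simp add: e_def abs_square_less_1)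
  have "e \<longlonglongrightarrow> 1 - (cmod \<tau>)\<^sup>2" unfolding e_def by (intro tendsto_intros wlim)
  then have elim: "e \<longlonglongrightarrow> 0" using \<tau> by simp
  have inf: "\<exists>\<^sub>F j in sequentially. e (Suc j) \<le> e j"
  proof (rule ccontr)
    assume "\<not> ?thesis"
    then obtain N where N: "\<And>j. j \<ge> N \<Longrightarrow> e j < e (Suc j)"
      by (auto simp: not_frequently not_le eventually_sequentially)
    have "e N \<le> e j" if "j \<ge> N" for j
      using that by (induction rule: dec_induct) (use N in \<open>auto intro: order_trans less_imp_le\<close>)
    then have "e N \<le> 0" by (intro tendsto_lowerbound[OF elim]) (auto simp: eventually_sequentially)
    then show False using e0[of N] by simp
  qed
  have \<phi>z: "cmod (\<phi> t z) < 1" using t by (intro semigroup_maps_disk[OF hs]) (auto simp: z)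
  let ?L = "\<lambda>j. (1 - (cmod z)\<^sup>2) * (cmod (1 - cnj (w (Suc j)) * \<phi> t z))\<^sup>2"
  let ?R = "\<lambda>j. (1 - (cmod (\<phi> t z))\<^sup>2) * (cmod (1 - cnj (w j) * z))\<^sup>2"
  have le: "?L j \<le> ?R j" if ej: "e (Suc j) \<le> e j" for j
  proof -
    have "(1 - (cmod z)\<^sup>2) * e j * (cmod (1 - cnj (\<phi> t (w j)) * \<phi> t z))\<^sup>2
       \<le> (1 - (cmod (\<phi> t z))\<^sup>2) * (1 - (cmod (\<phi> t (w j)))\<^sup>2) * (cmod (1 - cnj (w j) * z))\<^sup>2"
      unfolding e_def
      by (rule schwarz_pick_disk[OF _ _ z w1]) (use hs t in \<open>auto simp: holo_semigroup_def\<close>)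
    then have "?L j * e j \<le> ?R j * e (Suc j)" unfolding wSuc e_def by (simp add: mult_ac)
    also have "\<dots> \<le> ?R j * e j" using ej \<phi>z by (intro mult_left_mono) (auto simp: abs_square_le_1)
    finally show ?thesis using e0[of j] by simp
  qed
  have wS: "(\<lambda>j. w (Suc j)) \<longlonglongrightarrow> \<tau>" using wlim by (rule LIMSEQ_Suc)
  have L: "?L \<longlonglongrightarrow> (1 - (cmod z)\<^sup>2) * (cmod (1 - cnj \<tau> * \<phi> t z))\<^sup>2" by (intro tendsto_intros wS)
  have R: "?R \<longlonglongrightarrow> (1 - (cmod (\<phi> t z))\<^sup>2) * (cmod (1 - cnj \<tau> * z))\<^sup>2" by (intro tendsto_intros wlim)
  have "(1 - (cmod z)\<^sup>2) * (cmod (1 - cnj \<tau> * \<phi> t z))\<^sup>2 \<le> (1 - (cmod (\<phi> t z))\<^sup>2) * (cmod (1 - cnj \<tau> * z))\<^sup>2"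
  \<comment> \<open>The inequality is known for infinitely many \<open>j\<close> only, which
    suffices because both sides converge.\<close>
  proof (rule ccontr)
    assume "\<not> ?thesis"
    then have "\<forall>\<^sub>F j in sequentially. ?R j - ?L j < 0"
      by (intro order_tendstoD(2)[OF tendsto_diff[OF R L]]) simp
    then have "\<forall>\<^sub>F j in sequentially. \<not> e (Suc j) \<le> e j" by eventually_elim (use le in force)
    then show False using inf by (simp add: frequently_def)
  qed
  then show ?thesis
    using circle_neq_disk[OF \<tau> z] circle_neq_disk[OF \<tau> \<phi>z]
    unfolding poisson_def norm_one_minus_cnj_circle[OF \<tau>]
    by (simp add: divide_simps)
qed

text \<open>In both cases a quantity that is monotone along trajectories is differentiated at
  \<open>t = 0\<close>: the Poisson kernel for a boundary point \<tau>, and the pseudo-hyperbolic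
  distance from an interior point \<tau>.\<close>

theorem berkson_porta_necessary:
  assumes hs: "holo_semigroup \<phi>" and gen: "generates G \<phi>" and dw: "dw_point \<phi> \<tau>"
  obtains p where "p holomorphic_on ball 0 1" "\<And>z. cmod z < 1 \<Longrightarrow> Re (p z) \<ge> 0"
    "\<And>z. cmod z < 1 \<Longrightarrow> G z = (\<tau> - z) * (1 - cnj \<tau> * z) * p z"
proof (cases "cmod \<tau> < 1")
  case False
  then have \<tau>: "cmod \<tau> = 1" and lim: "\<And>z. cmod z < 1 \<Longrightarrow> ((\<lambda>t. \<phi> t z) \<longlongrightarrow> \<tau>) at_top"
    using dw by (auto simp: dw_point_def)
  have holG: "G holomorphic_on ball 0 1" using gen by (simp add: generates_def)
  define p where "p = (\<lambda>z. \<tau> * G z / (\<tau> - z)\<^sup>2)"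
  have "p holomorphic_on ball 0 1"
    unfolding p_def by (intro holomorphic_intros holG) (use \<tau> in auto)
  moreover have "Re (p z) \<ge> 0" if z: "cmod z < 1" for z
  proof -
    have "Re (2 * \<tau> / (\<tau> - z)\<^sup>2 * G z) \<ge> 0"
    proof (rule right_derivative_nonneg)
      show "((\<lambda>t. Re (herglotz \<tau> (\<phi> t z))) has_real_derivative Re (2 * \<tau> / (\<tau> - z)\<^sup>2 * G z)) (at 0 within {0..})"
        by (rule semigroup_derivative_at_0[OF hs gen z DERIV_herglotz]) (use \<tau> z in auto)
      fix t :: real assume t: "t > 0"
      have "\<phi> 0 z = z" using hs z by (simp add: holo_semigroup_def)
      then show "Re (herglotz \<tau> (\<phi> 0 z)) \<le> Re (herglotz \<tau> (\<phi> t z))"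
        using wolff_lemma[OF hs \<tau> lim t z] semigroup_maps_disk[OF hs _ z, of t] t z
        by (simp add: Re_herglotz[OF \<tau>])
    qed
    moreover have "2 * \<tau> / (\<tau> - z)\<^sup>2 * G z = 2 * p z" by (simp add: p_def)
    ultimately show ?thesis by simp
  qed
  moreover have "G z = (\<tau> - z) * (1 - cnj \<tau> * z) * p z" if z: "cmod z < 1" for z
  proof -
    have "(\<tau> - z) * (1 - cnj \<tau> * z) * p z = (\<tau> * cnj \<tau>) * ((\<tau> - z)\<^sup>2 / (\<tau> - z)\<^sup>2) * G z"
      unfolding one_minus_cnj_circle[OF \<tau>] p_def by (simp add: power2_eq_square)
    then show ?thesis using circle_cnj[OF \<tau>] circle_neq_disk[OF \<tau> z] by simp
  qed
  ultimately show thesis by (rule that)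
next
  case True
  note \<tau> = True
  then have fix\<tau>: "\<And>t. t \<ge> 0 \<Longrightarrow> \<phi> t \<tau> = \<tau>" using dw by (auto simp: dw_point_def)
  have holG: "G holomorphic_on ball 0 1" using gen by (simp add: generates_def)
  have G\<tau>: "G \<tau> = 0" using generates_not_trivial[OF gen hs \<tau>] fix\<tau> by auto
  define g where "g = (\<lambda>z. if z = \<tau> then deriv G \<tau> else (G z - G \<tau>) / (z - \<tau>))"
  have holg: "g holomorphic_on ball 0 1" unfolding g_def by (rule pole_lemma_open[OF holG]) simp
  have Gg: "G z = (z - \<tau>) * g z" for z using G\<tau> by (simp add: g_def)
  have nz: "1 - cnj \<tau> * z \<noteq> 0" if "cmod z < 1" for z using disk_cnj_neq[of \<tau> z] \<tau> that by simp
  define p where "p = (\<lambda>z. - g z / (1 - cnj \<tau> * z))"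
  have holp: "p holomorphic_on ball 0 1"
    unfolding p_def by (intro holomorphic_intros holg) (use nz in auto)
  define k where "k = 1 - (cmod \<tau>)\<^sup>2"
  have k0: "k > 0" using \<tau> by (simp add: k_def abs_square_less_1)
  have kk: "of_real k = 1 - \<tau> * cnj \<tau>" by (simp only: k_def complex_norm_square of_real_diff of_real_1)
  have p1: "Re (p z) \<ge> 0" if z: "cmod z < 1" "z \<noteq> \<tau>" for z
  proof -
    define m where "m = (\<lambda>z. (z - \<tau>) / (1 - cnj \<tau> * z))"
    have m0: "m z \<noteq> 0" using z nz by (simp add: m_def)
    have dm: "(m has_field_derivative of_real k / (1 - cnj \<tau> * z)\<^sup>2) (at z)"
      unfolding m_def kk using nz[OF z(1)]
      by (auto intro!: derivative_eq_intros simp: power2_eq_square algebra_simps)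
    \<comment> \<open>In place of \<open>(cmod (m (\<phi> t z)))\<^sup>2\<close> the real part of
      \<open>cnj (m z) * m (\<phi> t z)\<close> is differentiated. It is at most
      \<open>(cmod (m z))\<^sup>2\<close>, with equality at \<open>t = 0\<close>, and it depends on
      \<open>\<phi> t z\<close> through a holomorphic function.\<close>
    have dF: "((\<lambda>w. - cnj (m z) * m w) has_field_derivative - cnj (m z) * (of_real k / (1 - cnj \<tau> * z)\<^sup>2)) (at z)"
      by (rule DERIV_cmult[OF dm])
    have "Re (- cnj (m z) * (of_real k / (1 - cnj \<tau> * z)\<^sup>2) * G z) \<ge> 0"
    proof (rule right_derivative_nonneg[OF semigroup_derivative_at_0[OF hs gen z(1) dF]])
      fix t :: real assume t: "t > 0"
      have \<phi>z: "cmod (\<phi> t z) < 1" using semigroup_maps_disk[OF hs _ z(1)] t by simp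
      have \<phi>0: "\<phi> 0 z = z" using hs z by (simp add: holo_semigroup_def)
      have "(1 - (cmod z)\<^sup>2) * (1 - (cmod \<tau>)\<^sup>2) * (cmod (1 - cnj (\<phi> t \<tau>) * \<phi> t z))\<^sup>2
         \<le> (1 - (cmod (\<phi> t z))\<^sup>2) * (1 - (cmod (\<phi> t \<tau>))\<^sup>2) * (cmod (1 - cnj \<tau> * z))\<^sup>2"
        by (rule schwarz_pick_disk[OF _ _ z(1) \<tau>]) (use hs t in \<open>auto simp: holo_semigroup_def\<close>)
      then have le: "(k * (1 - (cmod z)\<^sup>2)) * (cmod (1 - cnj \<tau> * \<phi> t z))\<^sup>2 \<le> (k * (1 - (cmod (\<phi> t z))\<^sup>2)) * (cmod (1 - cnj \<tau> * z))\<^sup>2"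
        using fix\<tau>[of t] t by (simp add: k_def mult_ac)
      have mm: "(cmod (m w))\<^sup>2 = 1 - k * (1 - (cmod w)\<^sup>2) / (cmod (1 - cnj \<tau> * w))\<^sup>2" if "cmod w < 1" for w
        using moebius_norm_identity[of \<tau> w] nz[OF that] unfolding m_def norm_divide power_divide k_def
        by (simp add: divide_simps)
      have "(cmod (m (\<phi> t z)))\<^sup>2 \<le> (cmod (m z))\<^sup>2"
        unfolding mm[OF \<phi>z] mm[OF z(1)] using nz[OF \<phi>z] nz[OF z(1)]
        by (intro diff_left_mono divide_cross_le le) auto
      then have "cmod (m (\<phi> t z)) \<le> cmod (m z)" by (rule power2_le_imp_le) simp
      then have "cmod (cnj (m z) * m (\<phi> t z)) \<le> cmod (m z) * cmod (m z)"
        unfolding norm_mult complex_mod_cnj by (intro mult_left_mono) auto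
      then have "Re (cnj (m z) * m (\<phi> t z)) \<le> (cmod (m z))\<^sup>2"
        using complex_Re_le_cmod[of "cnj (m z) * m (\<phi> t z)"] by (simp add: power2_eq_square)
      also have "\<dots> = Re (cnj (m z) * m z)" unfolding cmod_power2 by (simp add: power2_eq_square)
      finally show "Re (- cnj (m z) * m (\<phi> 0 z)) \<le> Re (- cnj (m z) * m (\<phi> t z))" by (simp add: \<phi>0)
    qed
    moreover have "- cnj (m z) * (of_real k / (1 - cnj \<tau> * z)\<^sup>2) * G z = of_real (k * (cmod (m z))\<^sup>2) * p z"
    proof -
      have "of_real (k * (cmod (m z))\<^sup>2) = of_real k * (m z * cnj (m z))" by (simp only: of_real_mult complex_norm_square)
      then have "of_real (k * (cmod (m z))\<^sup>2) * p z = cnj (m z) * of_real k * (m z * p z)" by (simp only: mult_ac)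
      moreover have "m z * p z = - (G z / (1 - cnj \<tau> * z)\<^sup>2)"
        unfolding m_def p_def Gg by (simp add: power2_eq_square)
      ultimately show ?thesis by simp
    qed
    ultimately have "Re (of_real (k * (cmod (m z))\<^sup>2) * p z) \<ge> 0" by (simp only:)
    then have "k * (cmod (m z))\<^sup>2 * Re (p z) \<ge> 0"
      by (simp only: times_complex.sel Re_complex_of_real Im_complex_of_real mult_zero_left diff_zero)
    moreover have "k * (cmod (m z))\<^sup>2 > 0" using k0 m0 by simp
    ultimately show ?thesis by (simp add: zero_le_mult_iff)
  qed
  have "Re (p z) \<ge> 0" if z: "cmod z < 1" for z
  \<comment> \<open>The argument above says nothing at \<tau>, where \<open>m\<close> vanishes;
    continuity of \<open>p\<close> covers this point.\<close>
  proof (cases "z = \<tau>")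
    case True
    have "isCont p \<tau>" using holomorphic_on_imp_continuous_on[OF holp] \<tau> continuous_on_interior[of "ball 0 1" p \<tau>] by simp
    then have "((\<lambda>z. Re (p z)) \<longlongrightarrow> Re (p \<tau>)) (at \<tau>)" unfolding isCont_def by (intro tendsto_intros)
    moreover have "\<forall>\<^sub>F z in at \<tau>. z \<in> ball 0 1 - {\<tau>}" by (rule eventually_at_in_open) (use \<tau> in auto)
    then have "\<forall>\<^sub>F z in at \<tau>. 0 \<le> Re (p z)" by eventually_elim (use p1 in auto)
    ultimately show ?thesis unfolding True by (intro tendsto_lowerbound) auto
  qed (use p1 z in auto)
  moreover have "G z = (\<tau> - z) * (1 - cnj \<tau> * z) * p z" if z: "cmod z < 1" for z
  proof -
    have e: "(1 - cnj \<tau> * z) * p z = - g z" unfolding p_def using nz[OF z] by simp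
    show ?thesis unfolding Gg mult.assoc e by (simp add: algebra_simps)
  qed
  ultimately show thesis using that holp by blast
qed

text \<open>The right side of Pick's inequality vanishes, so
  \<open>q z = - cnj (q w) = q w\<close>.\<close>

lemma Re_zero_imp_constant:
  assumes "q holomorphic_on ball 0 1" and "\<And>z. cmod z < 1 \<Longrightarrow> Re (q z) \<ge> 0"
    and w: "cmod w < 1" "Re (q w) = 0" and z: "cmod z < 1"
  shows "q z = q w"
proof -
  have "(1 - (cmod z)\<^sup>2) * (1 - (cmod w)\<^sup>2) * (cmod (q z + cnj (q w)))\<^sup>2 \<le> 0"
    using pick_half_plane[OF assms(1,2) z w(1)] w(2) by simp
  moreover have "(1 - (cmod z)\<^sup>2) * (1 - (cmod w)\<^sup>2) > 0"
    using z w by (simp add: abs_square_less_1)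
  ultimately have "(cmod (q z + cnj (q w)))\<^sup>2 \<le> 0" by (meson not_le mult_pos_pos)
  then have "q z + cnj (q w) = 0" by simp
  then show ?thesis using w(2) by (simp add: complex_eq_iff)
qed

text \<open>Differentiating Julia's inequality for \<open>\<phi>\<^sub>t\<close> at \<open>t = 0\<close> shows that
  \<open>2 \<sigma> G(z) / (\<sigma> - z)\<^sup>2 - \<lambda> (\<sigma> + z) / (\<sigma> - z)\<close> has nonnegative real part; its mass at \<open>\<sigma>\<close>
  provides the angular limit of \<open>G(z) / (z - \<sigma>)\<close>.\<close>
theorem angular_limit_of_brfp:
  assumes hs: "holo_semigroup \<phi>" and gen: "generates G \<phi>" and br: "brfp_spectral \<phi> \<sigma> lam"
  shows "angular_limit (\<lambda>z. G z / (z - \<sigma>)) \<sigma> (of_real (- lam))"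
proof -
  have \<sigma>: "cmod \<sigma> = 1" using br by (simp add: brfp_spectral_def)
  have ne: "\<sigma> \<noteq> z" if "cmod z < 1" for z using that \<sigma> by auto
  have holG: "G holomorphic_on ball 0 1" using gen by (simp add: generates_def)
  \<comment> \<open>Julia's inequality: \<open>herglotz \<sigma> (\<phi> t z)\<close> has mass
    \<open>exp (lam * t)\<close> at \<sigma>, the reciprocal of the angular derivative.\<close>
  have julia: "exp (lam * t) * poisson \<sigma> z \<le> poisson \<sigma> (\<phi> t z)" if t: "t \<ge> 0" and z: "cmod z < 1" for t z
  proof -
    define q where "q = (\<lambda>z. herglotz \<sigma> (\<phi> t z))"
    have "\<phi> t holomorphic_on ball 0 1" "\<phi> t ` ball 0 1 \<subseteq> ball 0 1" using hs t by (auto simp: holo_semigroup_def)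
    from holomorphic_on_compose_gen[OF this(1) holomorphic_herglotz[OF \<sigma>] this(2)]
    have holq: "q holomorphic_on ball 0 1" by (simp add: q_def o_def)
    have Req: "Re (q z) = poisson \<sigma> (\<phi> t z)" if "cmod z < 1" for z
      using semigroup_maps_disk[OF hs t that] by (simp add: q_def Re_herglotz \<sigma>)
    have Req0: "Re (q z) \<ge> 0" if "cmod z < 1" for z
      using Req[OF that] poisson_pos[OF \<sigma> semigroup_maps_disk[OF hs t that]] by simp
    obtain m where "m \<ge> 0" and m: "angular_limit (\<lambda>z. (1 - cnj \<sigma> * z) * q z) \<sigma> (of_real (2 * m))"
      "\<And>z. cmod z < 1 \<Longrightarrow> m * poisson \<sigma> z \<le> Re (q z)"
      by (rule julia_caratheodory[OF holq Req0 \<sigma>]) (assumption | rule that)+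
    have l1: "angular_limit (\<phi> t) \<sigma> \<sigma>" and l2: "angular_limit (\<lambda>z. (\<phi> t z - \<sigma>) / (z - \<sigma>)) \<sigma> (of_real (exp (- lam * t)))"
      using br t by (auto simp: brfp_spectral_def)
    have i1: "angular_limit (\<lambda>z. inverse ((\<phi> t z - \<sigma>) / (z - \<sigma>)) * (cnj \<sigma> * (\<sigma> + \<phi> t z))) \<sigma>
        (inverse (of_real (exp (- lam * t))) * (cnj \<sigma> * (\<sigma> + \<sigma>)))"
      by (intro angular_limit_mult angular_limit_inverse l2 angular_limit_add l1 angular_limit_of_tendsto tendsto_const) simp
    have i2: "inverse ((\<phi> t z - \<sigma>) / (z - \<sigma>)) * (cnj \<sigma> * (\<sigma> + \<phi> t z)) = (1 - cnj \<sigma> * z) * q z" if "cmod z < 1" for z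
    proof -
      have "inverse ((\<phi> t z - \<sigma>) / (z - \<sigma>)) = (\<sigma> - z) / (\<sigma> - \<phi> t z)"
        using minus_divide_divide[of "z - \<sigma>" "\<phi> t z - \<sigma>"] by (simp add: inverse_eq_divide)
      then show ?thesis unfolding q_def herglotz_def one_minus_cnj_circle[OF \<sigma>] by (simp add: mult_ac)
    qed
    have i3: "inverse (of_real (exp (- lam * t))) * (cnj \<sigma> * (\<sigma> + \<sigma>)) = complex_of_real (2 * exp (lam * t))"
      using circle_cnj[OF \<sigma>] by (simp add: exp_minus algebra_simps)
    have "angular_limit (\<lambda>z. (1 - cnj \<sigma> * z) * q z) \<sigma> (of_real (2 * exp (lam * t)))"
      by (rule angular_limit_transform[OF i1[unfolded i3] i2])
    from angular_limit_unique[OF \<sigma> this m(1)] have "m = exp (lam * t)" by (simp only: of_real_eq_iff)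
    then show ?thesis using m(2)[OF z] Req[OF z] by simp
  qed
  define Q where "Q = (\<lambda>z. 2 * \<sigma> / (\<sigma> - z)\<^sup>2 * G z - of_real lam * herglotz \<sigma> z)"
  have holQ: "Q holomorphic_on ball 0 1"
    unfolding Q_def by (intro holomorphic_intros holG holomorphic_herglotz \<sigma>) (use ne in auto)
  have ReQ: "Re (Q z) \<ge> 0" if z: "cmod z < 1" for z
  proof -
    have d1: "((\<lambda>t. Re (herglotz \<sigma> (\<phi> t z))) has_real_derivative Re (2 * \<sigma> / (\<sigma> - z)\<^sup>2 * G z)) (at 0 within {0..})"
      by (rule semigroup_derivative_at_0[OF hs gen z DERIV_herglotz[OF ne[OF z]]])
    have d2: "((\<lambda>t. exp (lam * t) * poisson \<sigma> z) has_real_derivative lam * poisson \<sigma> z) (at 0 within {0..})"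
      by (auto intro!: derivative_eq_intros)
    have \<phi>0: "\<phi> 0 z = z" using hs z by (simp add: holo_semigroup_def)
    have "Re (2 * \<sigma> / (\<sigma> - z)\<^sup>2 * G z) - lam * poisson \<sigma> z \<ge> 0"
      by (rule right_derivative_nonneg[OF DERIV_diff[OF d1 d2]])
         (use julia[OF _ z] \<phi>0 z semigroup_maps_disk[OF hs _ z] in \<open>simp add: Re_herglotz[OF \<sigma>]\<close>)
    then show ?thesis using z by (simp add: Q_def Re_herglotz[OF \<sigma>])
  qed
  obtain m where "m \<ge> 0" and m: "angular_limit (\<lambda>z. (1 - cnj \<sigma> * z) * Q z) \<sigma> (of_real (2 * m))"
    and "\<And>z. cmod z < 1 \<Longrightarrow> m * poisson \<sigma> z \<le> Re (Q z)"
    by (rule julia_caratheodory[OF holQ ReQ \<sigma>]) (assumption | rule that)+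
  \<comment> \<open>\<open>m\<close> is not yet known to vanish. The converse theorem applied to
    this \<beta> gives the angular derivative \<open>exp \<beta>\<close> at time 1, and comparison
    with \<open>exp (- lam)\<close> yields \<open>\<beta> = - lam\<close>.\<close>
  define \<beta> where "\<beta> = - (m + lam)"
  have j1: "angular_limit (\<lambda>z. of_real (- 1 / 2) * ((1 - cnj \<sigma> * z) * Q z + of_real lam * ((1 - cnj \<sigma> * z) * herglotz \<sigma> z))) \<sigma>
      (of_real (- 1 / 2) * (of_real (2 * m) + of_real lam * 2))"
    by (intro angular_limit_mult angular_limit_add m angular_limit_of_tendsto tendsto_const tendsto_herglotz_pole \<sigma>)
  have j2: "of_real (- 1 / 2) * (of_real (2 * m) + of_real lam * 2) = complex_of_real \<beta>" by (simp add: \<beta>_def field_simps)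
  have j3: "of_real (- 1 / 2) * ((1 - cnj \<sigma> * z) * Q z + of_real lam * ((1 - cnj \<sigma> * z) * herglotz \<sigma> z)) = G z / (z - \<sigma>)"
    if z: "cmod z < 1" for z
  proof -
    have "(1 - cnj \<sigma> * z) * Q z + of_real lam * ((1 - cnj \<sigma> * z) * herglotz \<sigma> z) = (1 - cnj \<sigma> * z) * (2 * \<sigma> / (\<sigma> - z)\<^sup>2 * G z)"
      by (simp add: Q_def algebra_simps)
    also have "\<dots> = 2 * (\<sigma> * cnj \<sigma>) * ((\<sigma> - z) / (\<sigma> - z)\<^sup>2) * G z"
      unfolding one_minus_cnj_circle[OF \<sigma>] by simp
    also have "\<dots> = 2 * (G z / (\<sigma> - z))" using circle_cnj[OF \<sigma>] ne[OF z] by (simp add: power2_eq_square)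
    finally show ?thesis using minus_divide_right[of "G z" "\<sigma> - z"] by simp
  qed
  have lim: "angular_limit (\<lambda>z. G z / (z - \<sigma>)) \<sigma> (of_real \<beta>)"
    by (rule angular_limit_transform[OF j1[unfolded j2] j3])
  have "brfp_spectral \<phi> \<sigma> (- \<beta>)" by (rule brfp_of_angular_limit[OF hs gen \<sigma> lim])
  then have "complex_of_real (exp (\<beta> * 1)) = of_real (exp (- lam * 1))"
    using br angular_limit_unique[OF \<sigma>, of "\<lambda>z. (\<phi> 1 z - \<sigma>) / (z - \<sigma>)"]
    unfolding brfp_spectral_def by (metis minus_minus zero_le_one)
  then have "\<beta> = - lam" by (simp only: of_real_eq_iff exp_inj_iff mult_1_right)
  then show ?thesis using lim by simp
qed

subsection \<open>The formula gives extreme points\<close>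

lemma angular_limit_transform_eventually:
  assumes "angular_limit f \<sigma> L" and "\<forall>\<^sub>F z in at \<sigma>. cmod z < 1 \<longrightarrow> f z = g z"
  shows "angular_limit g \<sigma> L"
  unfolding angular_limit_stolz
proof (intro allI impI)
  fix M :: real assume "M > 1"
  then have "(f \<longlongrightarrow> L) (at \<sigma> within stolz \<sigma> M)" using assms(1) by (simp add: angular_limit_stolz)
  moreover have "\<forall>\<^sub>F z in at \<sigma> within stolz \<sigma> M. f z = g z"
    using assms(2) by (auto simp: eventually_at_filter stolz_def elim: eventually_mono)
  ultimately show "(g \<longlongrightarrow> L) (at \<sigma> within stolz \<sigma> M)" by (rule Lim_transform_eventually)
qed

lemma tendsto_herglotz_other:
  assumes "cmod \<sigma> = 1" "\<sigma>' \<noteq> \<sigma>"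
  shows "((\<lambda>z. (1 - cnj \<sigma> * z) * herglotz \<sigma>' z) \<longlongrightarrow> 0) (at \<sigma>)"
proof -
  have "((\<lambda>z. (1 - cnj \<sigma> * z) * herglotz \<sigma>' z) \<longlongrightarrow> (1 - cnj \<sigma> * \<sigma>) * ((\<sigma>' + \<sigma>) / (\<sigma>' - \<sigma>))) (at \<sigma>)"
    unfolding herglotz_def by (intro tendsto_intros) (use assms in auto)
  then show ?thesis using circle_cnj[OF assms(1)] by (simp add: mult.commute)
qed

lemma tendsto_herglotz_sum_pole:
  fixes \<sigma> :: "nat \<Rightarrow> complex" and n :: nat
  assumes "\<forall>k<n. cmod (\<sigma> k) = 1" "inj_on \<sigma> {..<n}" "j < n"
  shows "((\<lambda>z. (1 - cnj (\<sigma> j) * z) * (b + (\<Sum>k<n. c k * herglotz (\<sigma> k) z))) \<longlongrightarrow> 2 * c j) (at (\<sigma> j))"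
proof -
  have s: "cmod (\<sigma> j) = 1" using assms by simp
  have "((\<lambda>z. (1 - cnj (\<sigma> j) * z) * b + (\<Sum>k<n. c k * ((1 - cnj (\<sigma> j) * z) * herglotz (\<sigma> k) z)))
      \<longlongrightarrow> (1 - cnj (\<sigma> j) * \<sigma> j) * b + (\<Sum>k<n. c k * (if k = j then 2 else 0))) (at (\<sigma> j))"
  proof (intro tendsto_add tendsto_sum tendsto_mult[OF tendsto_const])
    show "((\<lambda>z. (1 - cnj (\<sigma> j) * z) * b) \<longlongrightarrow> (1 - cnj (\<sigma> j) * \<sigma> j) * b) (at (\<sigma> j))"
      by (intro tendsto_intros)
    fix k assume k: "k \<in> {..<n}"
    show "((\<lambda>z. (1 - cnj (\<sigma> j) * z) * herglotz (\<sigma> k) z) \<longlongrightarrow> (if k = j then 2 else 0)) (at (\<sigma> j))"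
    proof (cases "k = j")
      case True then show ?thesis using tendsto_herglotz_pole[OF s] by simp
    next
      case False
      then have "\<sigma> k \<noteq> \<sigma> j" using assms k by (auto dest: inj_onD)
      with False show ?thesis using tendsto_herglotz_other[OF s] by simp
    qed
  qed
  moreover have "1 - cnj (\<sigma> j) * \<sigma> j = 0" using circle_cnj[OF s] by (simp add: mult.commute)
  moreover
  have "(\<Sum>k<n. c k * (if k = j then 2 else 0)) = (\<Sum>k<n. if k = j then 2 * c j else 0)"
    by (intro sum.cong) auto
  then have "(\<Sum>k<n. c k * (if k = j then 2 else 0)) = 2 * c j" using assms(3) by simp
  ultimately show ?thesis by (simp add: algebra_simps sum_distrib_left)
qed

text \<open>Induction on the points: kernels at other points contribute nothing to the mass at
  \<open>\<sigma> n\<close>, so Julia's inequality for the remainder \<open>r\<close> adds the next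
  term.\<close>

lemma julia_sum:
  fixes \<sigma> :: "nat \<Rightarrow> complex" and n :: nat
  assumes holq: "q holomorphic_on ball 0 1" and q: "\<And>z. cmod z < 1 \<Longrightarrow> Re (q z) \<ge> 0"
  shows "\<forall>k<n. cmod (\<sigma> k) = 1 \<Longrightarrow> inj_on \<sigma> {..<n} \<Longrightarrow>
    \<forall>k<n. angular_limit (\<lambda>z. (1 - cnj (\<sigma> k) * z) * q z) (\<sigma> k) (of_real (2 * m k)) \<Longrightarrow>
    cmod z < 1 \<Longrightarrow> (\<Sum>k<n. m k * poisson (\<sigma> k) z) \<le> Re (q z)"
proof (induction n arbitrary: z)
  case 0
  then show ?case using q by simp
next
  case (Suc n)
  have \<sigma>: "cmod (\<sigma> k) = 1" if "k < Suc n" for k using Suc.prems that by simp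
  have inj: "inj_on \<sigma> {..<n}" using Suc.prems(2) by (rule inj_on_subset) auto
  define r where "r = (\<lambda>z. q z - (\<Sum>k<n. of_real (m k) * herglotz (\<sigma> k) z))"
  have holr: "r holomorphic_on ball 0 1"
    unfolding r_def by (intro holomorphic_intros holq holomorphic_herglotz \<sigma>) auto
  have Rer: "Re (r z) = Re (q z) - (\<Sum>k<n. m k * poisson (\<sigma> k) z)" if "cmod z < 1" for z
    using that \<sigma> by (simp add: r_def Re_herglotz Re_sum)
  have r0: "Re (r z) \<ge> 0" if z: "cmod z < 1" for z
    unfolding Rer[OF z] using Suc.IH[OF _ inj _ z] Suc.prems by simp
  have lim: "angular_limit (\<lambda>z. (1 - cnj (\<sigma> n) * z) * q z + (\<Sum>k<n. - of_real (m k) * ((1 - cnj (\<sigma> n) * z) * herglotz (\<sigma> k) z))) (\<sigma> n)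
      (of_real (2 * m n) + (\<Sum>k<n. - of_real (m k) * 0))"
  proof (rule angular_limit_add, use Suc.prems in simp, intro angular_limit_of_tendsto tendsto_sum tendsto_mult[OF tendsto_const])
    fix k assume "k \<in> {..<n}"
    then have "\<sigma> k \<noteq> \<sigma> n" using Suc.prems(2) by (auto dest: inj_onD)
    then show "((\<lambda>z. (1 - cnj (\<sigma> n) * z) * herglotz (\<sigma> k) z) \<longlongrightarrow> 0) (at (\<sigma> n))"
      by (rule tendsto_herglotz_other[OF \<sigma>[OF lessI]])
  qed
  have lim': "angular_limit (\<lambda>z. (1 - cnj (\<sigma> n) * z) * r z) (\<sigma> n) (of_real (2 * m n) + (\<Sum>k<n. - of_real (m k) * 0))"
    by (rule angular_limit_transform[OF lim]) (simp add: r_def right_diff_distrib sum_distrib_left sum_negf mult.left_commute)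
  obtain m' where "m' \<ge> 0" and m': "angular_limit (\<lambda>z. (1 - cnj (\<sigma> n) * z) * r z) (\<sigma> n) (of_real (2 * m'))"
    "\<And>z. cmod z < 1 \<Longrightarrow> m' * poisson (\<sigma> n) z \<le> Re (r z)"
    by (rule julia_caratheodory[OF holr r0 \<sigma>[OF lessI]]) (assumption | rule that)+
  have "m' = m n"
    using angular_limit_unique[OF \<sigma>[OF lessI] m'(1) lim'] by (simp flip: of_real_mult)
  then show ?case using m'(2)[OF Suc.prems(4)] Rer[OF Suc.prems(4)] by simp
qed

text \<open>For \<open>n > 0\<close> this describes the nonzero members of the class through
  \<open>p\<close>; \<open>a k * (cmod (\<tau> - \<sigma> k))\<^sup>2\<close> is the modulus of the
  spectral value. As \<open>p\<close> and \<open>a\<close> enter linearly, convex combinations and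
  perturbations are handled without touching semigroups.\<close>

definition admissible :: "complex \<Rightarrow> (nat \<Rightarrow> complex) \<Rightarrow> nat \<Rightarrow> (complex \<Rightarrow> complex) \<Rightarrow> (nat \<Rightarrow> real) \<Rightarrow> bool" where
  "admissible \<tau> \<sigma> n p a \<longleftrightarrow> p holomorphic_on ball 0 1 \<and> (\<forall>z. cmod z < 1 \<longrightarrow> Re (p z) > 0) \<and>
     (\<forall>k<n. a k > 0 \<and> angular_limit (\<lambda>z. p z / (1 - cnj (\<sigma> k) * z)) (\<sigma> k) (of_real (a k))) \<and>
     (\<Sum>k<n. a k * (cmod (\<tau> - \<sigma> k))\<^sup>2) \<le> 1"

text \<open>The left side is the value at \<sigma> of the factor that turns
  \<open>p z / (1 - cnj \<sigma> * z)\<close> into \<open>G z / (z - \<sigma>)\<close>.\<close>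

lemma tau_sigma_identity:
  assumes "cmod \<sigma> = 1"
  shows "(\<tau> - \<sigma>) * (1 - cnj \<tau> * \<sigma>) * (- cnj \<sigma>) = of_real ((cmod (\<tau> - \<sigma>))\<^sup>2)"
proof -
  have "(1 - cnj \<tau> * \<sigma>) * (- cnj \<sigma>) = cnj (\<tau> - \<sigma>)"
    using circle_cnj[OF assms] by (simp add: algebra_simps)
  then show ?thesis unfolding complex_norm_square by (simp only: mult.assoc)
qed

lemma GenF_of_admissible:
  assumes \<sigma>: "\<forall>k<n. cmod (\<sigma> k) = 1" and \<tau>: "cmod \<tau> \<le> 1" and ad: "admissible \<tau> \<sigma> n p a"
    and G: "\<And>z. cmod z < 1 \<Longrightarrow> G z = (\<tau> - z) * (1 - cnj \<tau> * z) * p z"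
  shows "G \<in> GenF \<tau> \<sigma> n"
proof -
  have holp: "p holomorphic_on ball 0 1" and p: "\<And>z. cmod z < 1 \<Longrightarrow> Re (p z) > 0"
    using ad by (auto simp: admissible_def)
  obtain \<phi> where hs: "holo_semigroup \<phi>" and dw: "dw_point \<phi> \<tau>"
    and gen0: "generates (\<lambda>z. (\<tau> - z) * (1 - cnj \<tau> * z) * p z) \<phi>"
    by (rule berkson_porta_sufficient[OF holp p \<tau>])
  have "(\<lambda>z. (\<tau> - z) * (1 - cnj \<tau> * z) * p z) holomorphic_on ball 0 1" by (intro holomorphic_intros holp)
  then have holG: "G holomorphic_on ball 0 1"
    by (rule holomorphic_transform) (simp add: G)
  have gen: "generates G \<phi>"
    using gen0 semigroup_maps_disk[OF hs] holG by (simp add: generates_def G)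
  define lam where "lam = (\<lambda>k. - (a k * (cmod (\<tau> - \<sigma> k))\<^sup>2))"
  have br: "brfp_spectral \<phi> (\<sigma> k) (lam k)" if k: "k < n" for k
  proof -
    have s: "cmod (\<sigma> k) = 1" using \<sigma> k by simp
    have l1: "angular_limit (\<lambda>z. (\<tau> - z) * (1 - cnj \<tau> * z) * (- cnj (\<sigma> k)) * (p z / (1 - cnj (\<sigma> k) * z))) (\<sigma> k)
        ((\<tau> - \<sigma> k) * (1 - cnj \<tau> * \<sigma> k) * (- cnj (\<sigma> k)) * of_real (a k))"
      by (rule angular_limit_mult, rule angular_limit_of_tendsto, intro tendsto_intros)
         (use ad k in \<open>auto simp: admissible_def\<close>)
    have l2: "(\<tau> - \<sigma> k) * (1 - cnj \<tau> * \<sigma> k) * (- cnj (\<sigma> k)) * of_real (a k) = of_real (a k * (cmod (\<tau> - \<sigma> k))\<^sup>2)"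
      unfolding tau_sigma_identity[OF s] by simp
    have l3: "(\<tau> - z) * (1 - cnj \<tau> * z) * (- cnj (\<sigma> k)) * (p z / (1 - cnj (\<sigma> k) * z)) = G z / (z - \<sigma> k)"
      if z: "cmod z < 1" for z
    proof -
      have "\<sigma> k - z \<noteq> 0" "cnj (\<sigma> k) \<noteq> 0" using circle_neq_disk[OF s z] s by auto
      then have "- cnj (\<sigma> k) * (p z / (cnj (\<sigma> k) * (\<sigma> k - z))) = p z / (z - \<sigma> k)"
        by (simp add: divide_simps) (simp add: algebra_simps)
      then have "(\<tau> - z) * (1 - cnj \<tau> * z) * (- cnj (\<sigma> k) * (p z / (cnj (\<sigma> k) * (\<sigma> k - z)))) =
          (\<tau> - z) * (1 - cnj \<tau> * z) * (p z / (z - \<sigma> k))" by (simp only:)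
      then show ?thesis unfolding G[OF z] one_minus_cnj_circle[OF s]
        by (simp only: mult.assoc times_divide_eq_right[symmetric])
    qed
    have "angular_limit (\<lambda>z. G z / (z - \<sigma> k)) (\<sigma> k) (of_real (a k * (cmod (\<tau> - \<sigma> k))\<^sup>2))"
      by (rule angular_limit_transform[OF l1[unfolded l2] l3])
    from brfp_of_angular_limit[OF hs gen s this] show ?thesis by (simp add: lam_def)
  qed
  have "(\<Sum>k<n. \<bar>lam k\<bar>) = (\<Sum>k<n. a k * (cmod (\<tau> - \<sigma> k))\<^sup>2)"
    using ad by (intro sum.cong) (auto simp: lam_def admissible_def abs_mult less_imp_le)
  then have "(\<Sum>k<n. \<bar>lam k\<bar>) \<le> 1" using ad by (simp add: admissible_def)
  then show ?thesis unfolding GenF_def using holG hs gen dw br by blast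
qed

text \<open>Positivity of \<open>a k\<close> comes from Julia-Caratheodory for \<open>1 / p\<close>:
  the limit \<open>2 * m\<close> found there satisfies \<open>a k * (2 * m) = 1\<close>. The
  assumption \<open>n > 0\<close> excludes an imaginary constant \<open>p\<close>.\<close>

lemma admissible_of_GenF:
  assumes \<sigma>: "\<forall>k<n. cmod (\<sigma> k) = 1" and \<tau>: "cmod \<tau> \<le> 1" and \<tau>\<sigma>: "\<tau> \<notin> \<sigma> ` {..<n}" and n: "n > 0"
    and G: "G \<in> GenF \<tau> \<sigma> n" and G0: "\<not> (\<forall>z\<in>ball 0 1. G z = 0)"
  obtains p a where "admissible \<tau> \<sigma> n p a" "\<And>z. cmod z < 1 \<Longrightarrow> G z = (\<tau> - z) * (1 - cnj \<tau> * z) * p z"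
proof -
  from G G0 obtain \<phi> lam where hs: "holo_semigroup \<phi>" and gen: "generates G \<phi>" and dw: "dw_point \<phi> \<tau>"
    and br: "\<And>k. k < n \<Longrightarrow> brfp_spectral \<phi> (\<sigma> k) (lam k)" and lam: "(\<Sum>k<n. \<bar>lam k\<bar>) \<le> 1"
    unfolding GenF_def by blast
  obtain p where holp: "p holomorphic_on ball 0 1" and p0: "\<And>z. cmod z < 1 \<Longrightarrow> Re (p z) \<ge> 0"
    and Gp: "\<And>z. cmod z < 1 \<Longrightarrow> G z = (\<tau> - z) * (1 - cnj \<tau> * z) * p z"
    by (rule berkson_porta_necessary[OF hs gen dw]) (assumption | rule that)+
  obtain z1 where z1: "cmod z1 < 1" "p z1 \<noteq> 0" using G0 Gp by auto
  have pnz: "p z \<noteq> 0" if "cmod z < 1" for z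
    using Re_zero_imp_constant[OF holp p0 that _ z1(1)] z1(2) by auto
  define a where "a = (\<lambda>k. - lam k / (cmod (\<tau> - \<sigma> k))\<^sup>2)"
  have ts: "\<tau> - \<sigma> k \<noteq> 0" if "k < n" for k using \<tau>\<sigma> that by auto
  have lim: "angular_limit (\<lambda>z. p z / (1 - cnj (\<sigma> k) * z)) (\<sigma> k) (of_real (a k))" if k: "k < n" for k
  proof -
    have s: "cmod (\<sigma> k) = 1" using \<sigma> k by simp
    let ?d = "\<lambda>z. (\<tau> - z) * (1 - cnj \<tau> * z) * (- cnj (\<sigma> k))"
    have "cmod (\<tau> - \<sigma> k) \<noteq> 0" using ts[OF k] by simp
    then have d0: "?d (\<sigma> k) \<noteq> 0" unfolding tau_sigma_identity[OF s] by simp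
    have dl: "(?d \<longlongrightarrow> ?d (\<sigma> k)) (at (\<sigma> k))" by (intro tendsto_intros)
    have l1: "angular_limit (\<lambda>z. G z / (z - \<sigma> k) * inverse (?d z)) (\<sigma> k) (of_real (- lam k) * inverse (?d (\<sigma> k)))"
      by (intro angular_limit_mult angular_limit_of_brfp[OF hs gen br[OF k]] angular_limit_inverse[OF angular_limit_of_tendsto[OF dl] d0])
    have l2: "of_real (- lam k) * inverse (?d (\<sigma> k)) = of_real (a k)"
      unfolding tau_sigma_identity[OF s] a_def by (simp add: divide_inverse)
    have "\<forall>\<^sub>F z in at (\<sigma> k). ?d z \<noteq> 0" by (rule tendsto_imp_eventually_ne[OF dl d0])
    then have "\<forall>\<^sub>F z in at (\<sigma> k). cmod z < 1 \<longrightarrow> G z / (z - \<sigma> k) * inverse (?d z) = p z / (1 - cnj (\<sigma> k) * z)"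
    proof eventually_elim
      case (elim z)
      show ?case
      proof
        assume z: "cmod z < 1"
        have zs: "\<sigma> k - z \<noteq> 0" "z - \<sigma> k \<noteq> 0" using circle_neq_disk[OF s z] by auto
        have "G z / (z - \<sigma> k) * inverse (?d z) = p z / ((z - \<sigma> k) * (- cnj (\<sigma> k)))"
          unfolding Gp[OF z] using elim zs by (simp add: divide_simps)
        also have "(z - \<sigma> k) * (- cnj (\<sigma> k)) = 1 - cnj (\<sigma> k) * z"
          unfolding one_minus_cnj_circle[OF s] by (simp add: algebra_simps)
        finally show "G z / (z - \<sigma> k) * inverse (?d z) = p z / (1 - cnj (\<sigma> k) * z)" .
      qed
    qed
    then show ?thesis by (rule angular_limit_transform_eventually[OF l1[unfolded l2]])
  qed
  have apos: "a k > 0" if k: "k < n" for k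
  proof -
    have s: "cmod (\<sigma> k) = 1" using \<sigma> k by simp
    define q where "q = (\<lambda>z. inverse (p z))"
    have holq: "q holomorphic_on ball 0 1" unfolding q_def by (intro holomorphic_intros holp) (use pnz in auto)
    have q0: "Re (q z) \<ge> 0" if "cmod z < 1" for z using p0[OF that] by (simp add: q_def)
    obtain m where m: "m \<ge> 0" "angular_limit (\<lambda>z. (1 - cnj (\<sigma> k) * z) * q z) (\<sigma> k) (of_real (2 * m))"
      "\<And>z. cmod z < 1 \<Longrightarrow> m * poisson (\<sigma> k) z \<le> Re (q z)"
      by (rule julia_caratheodory[OF holq q0 s]) (assumption | rule that)+
    have "angular_limit (\<lambda>z. p z / (1 - cnj (\<sigma> k) * z) * ((1 - cnj (\<sigma> k) * z) * q z)) (\<sigma> k) (of_real (a k) * of_real (2 * m))"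
      by (intro angular_limit_mult lim k m)
    then have "angular_limit (\<lambda>z. 1) (\<sigma> k) (of_real (a k) * of_real (2 * m))"
      by (rule angular_limit_transform) (use pnz disk_cnj_neq[of "\<sigma> k"] s in \<open>simp add: q_def\<close>)
    from angular_limit_unique[OF s this angular_limit_of_tendsto[OF tendsto_const]]
    have "a k * (2 * m) = 1" by (simp only: of_real_mult[symmetric] of_real_eq_1_iff)
    then show ?thesis using m(1) by (smt (verit) mult_nonneg_nonneg mult_nonpos_nonneg zero_less_mult_iff)
  qed
  have "Re (p z) > 0" if z: "cmod z < 1" for z
  proof (rule ccontr)
    assume "\<not> Re (p z) > 0"
    then have "Re (p z) = 0" using p0[OF z] by simp
    \<comment> \<open>A real part that vanishes at one point makes \<open>p\<close> constant, and
      the finite limit of \<open>p z / (1 - cnj (\<sigma> 0) * z)\<close> at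
      \<open>\<sigma> 0\<close> makes the constant 0.\<close>
    then have const: "p w = p z" if "cmod w < 1" for w using Re_zero_imp_constant[OF holp p0 z _ that] by simp
    have s: "cmod (\<sigma> 0) = 1" using \<sigma> n by simp
    have "((\<lambda>z. 1 - cnj (\<sigma> 0) * z) \<longlongrightarrow> 1 - cnj (\<sigma> 0) * \<sigma> 0) (at (\<sigma> 0))" by (intro tendsto_intros)
    then have "angular_limit (\<lambda>z. p z / (1 - cnj (\<sigma> 0) * z) * (1 - cnj (\<sigma> 0) * z)) (\<sigma> 0) (of_real (a 0) * (1 - cnj (\<sigma> 0) * \<sigma> 0))"
      by (intro angular_limit_mult lim n angular_limit_of_tendsto)
    then have "angular_limit (\<lambda>_. p z) (\<sigma> 0) (of_real (a 0) * (1 - cnj (\<sigma> 0) * \<sigma> 0))"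
      by (rule angular_limit_transform) (use const disk_cnj_neq[of "\<sigma> 0"] s in simp)
    from angular_limit_unique[OF s this angular_limit_of_tendsto[OF tendsto_const]]
    have "p z = 0" using circle_cnj[OF s] by (simp add: mult.commute)
    then show False using pnz[OF z] by simp
  qed
  moreover have "(\<Sum>k<n. a k * (cmod (\<tau> - \<sigma> k))\<^sup>2) \<le> 1"
  proof -
    have "(\<Sum>k<n. a k * (cmod (\<tau> - \<sigma> k))\<^sup>2) = (\<Sum>k<n. - lam k)"
      using ts by (intro sum.cong) (auto simp: a_def)
    also have "\<dots> \<le> (\<Sum>k<n. \<bar>lam k\<bar>)" by (intro sum_mono) auto
    finally show ?thesis using lam by simp
  qed
  ultimately have "admissible \<tau> \<sigma> n p a" using holp lim apos by (simp add: admissible_def)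
  then show thesis using Gp by (rule that)
qed

text \<open>The last summand is the defect in the convexity of \<open>(x, a) \<mapsto> \<bar>x\<bar>\<^sup>2 / a\<close>.\<close>
lemma perspective_identity:
  fixes x y :: complex and a b t :: real
  assumes "a > 0" "b > 0" "0 < t" "t < 1"
  shows "t * ((cmod x)\<^sup>2 / a) + (1 - t) * ((cmod y)\<^sup>2 / b) =
    (cmod (of_real t * x + of_real (1 - t) * y))\<^sup>2 / (t * a + (1 - t) * b) +
    t * (1 - t) * (cmod (of_real b * x - of_real a * y))\<^sup>2 / (a * b * (t * a + (1 - t) * b))"
proof -
  define c where "c = t * a + (1 - t) * b"
  have c: "c > 0" unfolding c_def using assms by (intro add_pos_pos mult_pos_pos) auto
  have "(t * b * (cmod x)\<^sup>2 + (1 - t) * a * (cmod y)\<^sup>2) * c =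
     (cmod (of_real t * x + of_real (1 - t) * y))\<^sup>2 * (a * b) + t * (1 - t) * (cmod (of_real b * x - of_real a * y))\<^sup>2"
    unfolding c_def cmod_power2 by (simp add: power2_eq_square algebra_simps)
  then have "(t * b * (cmod x)\<^sup>2 + (1 - t) * a * (cmod y)\<^sup>2) / (a * b) =
    ((cmod (of_real t * x + of_real (1 - t) * y))\<^sup>2 * (a * b) + t * (1 - t) * (cmod (of_real b * x - of_real a * y))\<^sup>2) / (a * b * c)"
    using assms c by (simp add: divide_simps)
  then show ?thesis unfolding c_def[symmetric] using assms c by (simp add: add_divide_distrib mult_ac)
qed

text \<open>\<open>julia_sum\<close> for \<open>1 / p\<close>, whose mass at
  \<open>\<sigma> k\<close> is \<open>1 / (2 * a k)\<close>, multiplied by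
  \<open>(cmod (p z))\<^sup>2\<close>.\<close>

lemma admissible_julia:
  assumes ad: "admissible \<tau> \<sigma> n p a" and \<sigma>: "\<forall>k<n. cmod (\<sigma> k) = 1" and inj: "inj_on \<sigma> {..<n}" and z: "cmod z < 1"
  shows "(\<Sum>k<n. poisson (\<sigma> k) z / 2 * ((cmod (p z))\<^sup>2 / a k)) \<le> Re (p z)"
proof -
  have holp: "p holomorphic_on ball 0 1" and p: "\<And>z. cmod z < 1 \<Longrightarrow> Re (p z) > 0"
    and a: "\<And>k. k < n \<Longrightarrow> a k > 0" 
    and lim: "\<And>k. k < n \<Longrightarrow> angular_limit (\<lambda>z. p z / (1 - cnj (\<sigma> k) * z)) (\<sigma> k) (of_real (a k))"
    using ad by (auto simp: admissible_def)
  have pnz: "p z \<noteq> 0" if "cmod z < 1" for z using p[OF that] by auto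
  define q where "q = (\<lambda>z. inverse (p z))"
  have holq: "q holomorphic_on ball 0 1" unfolding q_def by (intro holomorphic_intros holp) (use pnz in auto)
  have q0: "Re (q z) \<ge> 0" if "cmod z < 1" for z using p[OF that] by (simp add: q_def)
  have "angular_limit (\<lambda>z. (1 - cnj (\<sigma> k) * z) * q z) (\<sigma> k) (of_real (2 * (1 / (2 * a k))))" if k: "k < n" for k
  proof -
    have "angular_limit (\<lambda>z. inverse (p z / (1 - cnj (\<sigma> k) * z))) (\<sigma> k) (inverse (of_real (a k)))"
      using a[OF k] by (intro angular_limit_inverse lim k) auto
    then have "angular_limit (\<lambda>z. (1 - cnj (\<sigma> k) * z) * q z) (\<sigma> k) (inverse (of_real (a k)))"
      by (rule angular_limit_transform) (simp add: q_def divide_inverse mult.commute)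
    moreover have "complex_of_real (2 * (1 / (2 * a k))) = inverse (of_real (a k))"
      by (simp add: inverse_eq_divide)
    ultimately show ?thesis by (simp only:)
  qed
  then have "(\<Sum>k<n. 1 / (2 * a k) * poisson (\<sigma> k) z) \<le> Re (q z)"
    by (intro julia_sum[OF holq q0 \<sigma> inj _ z]) auto
  then have "(\<Sum>k<n. 1 / (2 * a k) * poisson (\<sigma> k) z) * (cmod (p z))\<^sup>2 \<le> Re (q z) * (cmod (p z))\<^sup>2"
    by (rule mult_right_mono) simp
  also have "Re (q z) * (cmod (p z))\<^sup>2 = Re (p z)"
    using pnz[OF z] by (simp add: q_def Re_divide[of 1, simplified] inverse_eq_divide cmod_power2[symmetric])
  also have "(\<Sum>k<n. 1 / (2 * a k) * poisson (\<sigma> k) z) * (cmod (p z))\<^sup>2 = (\<Sum>k<n. poisson (\<sigma> k) z / 2 * ((cmod (p z))\<^sup>2 / a k))"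
    unfolding sum_distrib_right by (intro sum.cong) auto
  finally show ?thesis .
qed

lemma admissible_convex_equality:
  assumes \<sigma>: "\<forall>k<n. cmod (\<sigma> k) = 1" and inj: "inj_on \<sigma> {..<n}" and n: "n > 0"
    and ad: "admissible \<tau> \<sigma> n p a" and sum: "(\<Sum>k<n. a k * (cmod (\<tau> - \<sigma> k))\<^sup>2) = 1"
    and ad1: "admissible \<tau> \<sigma> n p1 a1" and ad2: "admissible \<tau> \<sigma> n p2 a2"
    and t: "0 < t" "t < 1" and p: "\<And>z. cmod z < 1 \<Longrightarrow> p z = of_real t * p1 z + of_real (1 - t) * p2 z"
    and eq: "\<And>z. cmod z < 1 \<Longrightarrow> Re (p z) = (\<Sum>k<n. poisson (\<sigma> k) z / 2 * ((cmod (p z))\<^sup>2 / a k))"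
    and z: "cmod z < 1"
  shows "p1 z = p2 z"
proof -
  have apos: "a1 k > 0" "a2 k > 0" if "k < n" for k using ad1 ad2 that by (auto simp: admissible_def)
  have a: "a k = t * a1 k + (1 - t) * a2 k" if k: "k < n" for k
  proof -
    have s: "cmod (\<sigma> k) = 1" using \<sigma> k by simp
    have "angular_limit (\<lambda>z. of_real t * (p1 z / (1 - cnj (\<sigma> k) * z)) + of_real (1 - t) * (p2 z / (1 - cnj (\<sigma> k) * z))) (\<sigma> k)
       (of_real t * of_real (a1 k) + of_real (1 - t) * of_real (a2 k))"
      using ad1 ad2 k
      by (intro angular_limit_add angular_limit_mult angular_limit_of_tendsto[OF tendsto_const]) (auto simp: admissible_def)
    then have "angular_limit (\<lambda>z. p z / (1 - cnj (\<sigma> k) * z)) (\<sigma> k) (of_real t * of_real (a1 k) + of_real (1 - t) * of_real (a2 k))"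
      by (rule angular_limit_transform) (simp add: p add_divide_distrib)
    moreover have "angular_limit (\<lambda>z. p z / (1 - cnj (\<sigma> k) * z)) (\<sigma> k) (of_real (a k))"
      using ad k by (simp add: admissible_def)
    ultimately have "of_real t * of_real (a1 k) + of_real (1 - t) * of_real (a2 k) = complex_of_real (a k)"
      by (rule angular_limit_unique[OF s])
    then show ?thesis by (metis of_real_add of_real_eq_iff of_real_mult)
  qed
  have ratio: "of_real (a2 k) * p1 z = of_real (a1 k) * p2 z" if k: "k < n" for k
  proof -
    \<comment> \<open>The convexity defect of each summand. These nonnegative numbers add up to at
      most 0, because Julia's inequality is an equality for \<open>p\<close> and holds for
      \<open>p1\<close> and \<open>p2\<close>.\<close>
    define e where "e = (\<lambda>k. poisson (\<sigma> k) z / 2 * (t * (1 - t) * (cmod (of_real (a2 k) * p1 z - of_real (a1 k) * p2 z))\<^sup>2 / (a1 k * a2 k * a k)))"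
    have e0: "e k \<ge> 0" if k: "k < n" for k
      unfolding e_def using poisson_pos[of "\<sigma> k" z] \<sigma> z apos[OF k] t ad k
      by (auto intro!: mult_nonneg_nonneg divide_nonneg_nonneg simp: admissible_def less_imp_le)
    have id: "poisson (\<sigma> k) z / 2 * ((cmod (p z))\<^sup>2 / a k) + e k =
       t * (poisson (\<sigma> k) z / 2 * ((cmod (p1 z))\<^sup>2 / a1 k)) + (1 - t) * (poisson (\<sigma> k) z / 2 * ((cmod (p2 z))\<^sup>2 / a2 k))" if k: "k < n" for k
      using arg_cong[OF perspective_identity[OF apos[OF k] t, of "p1 z" "p2 z"], of "\<lambda>x. poisson (\<sigma> k) z / 2 * x"]
      unfolding p[OF z] a[OF k] e_def by (simp add: distrib_left mult.left_commute)
    have "Re (p z) + (\<Sum>k<n. e k) = (\<Sum>k<n. poisson (\<sigma> k) z / 2 * ((cmod (p z))\<^sup>2 / a k) + e k)"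
      unfolding eq[OF z] sum.distrib ..
    also have "\<dots> = t * (\<Sum>k<n. poisson (\<sigma> k) z / 2 * ((cmod (p1 z))\<^sup>2 / a1 k)) + (1 - t) * (\<Sum>k<n. poisson (\<sigma> k) z / 2 * ((cmod (p2 z))\<^sup>2 / a2 k))"
      using id by (simp add: sum.distrib sum_distrib_left)
    also have "\<dots> \<le> t * Re (p1 z) + (1 - t) * Re (p2 z)"
      using t by (intro add_mono mult_left_mono admissible_julia[OF ad1 \<sigma> inj z] admissible_julia[OF ad2 \<sigma> inj z]) auto
    also have "\<dots> = Re (p z)" unfolding p[OF z] by simp
    finally have "(\<Sum>k<n. e k) \<le> 0" by simp
    then have "e k = 0" using e0 k sum_nonneg_eq_0_iff[of "{..<n}" e] sum_nonneg[of "{..<n}" e] by (auto simp: order_antisym)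
    moreover have "poisson (\<sigma> k) z > 0" using poisson_pos[of "\<sigma> k" z] \<sigma> z k by simp
    moreover have "a k > 0" using ad k by (simp add: admissible_def)
    ultimately show ?thesis using apos[OF k] t by (simp add: e_def)
  qed
  have p1p: "Re (p1 z) > 0" "Re (p2 z) > 0" using ad1 ad2 z by (auto simp: admissible_def)
  \<comment> \<open>\<open>c\<close> may depend on \<open>z\<close> but not on \<open>k\<close>, so
    it can be taken out of the weighted sum; both sums turn out to be 1.\<close>
  define c where "c = Re (p1 z) / Re (p2 z)"
  have ca: "a1 k = c * a2 k" if k: "k < n" for k
  proof -
    have "Re (of_real (a2 k) * p1 z) = Re (of_real (a1 k) * p2 z)" using ratio[OF k] by simp
    then have "a2 k * Re (p1 z) = a1 k * Re (p2 z)" by simp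
    then show ?thesis using p1p by (simp add: c_def field_simps)
  qed
  define S where "S = (\<lambda>a::nat \<Rightarrow> real. \<Sum>k<n. a k * (cmod (\<tau> - \<sigma> k))\<^sup>2)"
  have S1: "S a1 \<le> 1" "S a2 \<le> 1" using ad1 ad2 by (auto simp: S_def admissible_def)
  have "S a = t * S a1 + (1 - t) * S a2"
    unfolding S_def sum_distrib_left sum.distrib[symmetric] by (intro sum.cong) (auto simp: a algebra_simps)
  then have "t * (1 - S a1) + (1 - t) * (1 - S a2) = 0" using sum by (simp add: S_def algebra_simps)
  moreover have "t * (1 - S a1) \<ge> 0" "(1 - t) * (1 - S a2) \<ge> 0" using S1 t by auto
  ultimately have "t * (1 - S a1) = 0" "(1 - t) * (1 - S a2) = 0" by linarith+
  then have "S a1 = 1" "S a2 = 1" using t by auto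
  moreover have "S a1 = c * S a2"
    unfolding S_def sum_distrib_left by (intro sum.cong) (auto simp: ca)
  ultimately have "c = 1" by simp
  then have "a1 0 = a2 0" using ca[OF n] by simp
  then show ?thesis using ratio[OF n] apos[OF n] by simp
qed

text \<open>Julia's inequality is an equality here because the real part of \<open>1 / p\<close> is
  exactly the Poisson sum.\<close>

lemma admissible_herglotz_sum:
  assumes \<sigma>: "\<forall>k<n. cmod (\<sigma> k) = 1" and inj: "inj_on \<sigma> {..<n}" and n: "n > 0"
    and a: "\<And>k. k < n \<Longrightarrow> a k > 0" and sum: "(\<Sum>k<n. a k * (cmod (\<tau> - \<sigma> k))\<^sup>2) \<le> 1"
    and p: "\<And>z. p z = inverse (\<i> * of_real b + (\<Sum>k<n. of_real (1 / (2 * a k)) * herglotz (\<sigma> k) z))"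
  shows "admissible \<tau> \<sigma> n p a"
    and "\<And>z. cmod z < 1 \<Longrightarrow> Re (p z) = (\<Sum>k<n. poisson (\<sigma> k) z / 2 * ((cmod (p z))\<^sup>2 / a k))"
proof -
  define q where "q = (\<lambda>z. \<i> * of_real b + (\<Sum>k<n. of_real (1 / (2 * a k)) * herglotz (\<sigma> k) z))"
  have pq: "p z = inverse (q z)" for z by (simp add: p q_def)
  have holq: "q holomorphic_on ball 0 1" unfolding q_def
    by (intro holomorphic_intros holomorphic_herglotz) (use \<sigma> in auto)
  have Req: "Re (q z) = (\<Sum>k<n. poisson (\<sigma> k) z / (2 * a k))" if z: "cmod z < 1" for z
    using z \<sigma> by (simp add: q_def Re_sum Re_herglotz)
  have q0: "Re (q z) > 0" if z: "cmod z < 1" for z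
    unfolding Req[OF z] by (intro sum_pos divide_pos_pos poisson_pos z) (use n \<sigma> a in auto)
  have qnz: "q z \<noteq> 0" if "cmod z < 1" for z using q0[OF that] by auto
  have "p holomorphic_on ball 0 1"
    unfolding pq[abs_def] by (intro holomorphic_intros holq) (use qnz in auto)
  moreover have "Re (p z) > 0" if "cmod z < 1" for z
    using q0[OF that] unfolding pq by (auto intro!: divide_pos_pos simp: sum_power2_gt_zero_iff)
  moreover have "angular_limit (\<lambda>z. p z / (1 - cnj (\<sigma> k) * z)) (\<sigma> k) (of_real (a k))" if k: "k < n" for k
  proof -
    have "((\<lambda>z. (1 - cnj (\<sigma> k) * z) * q z) \<longlongrightarrow> 2 * of_real (1 / (2 * a k))) (at (\<sigma> k))"
      unfolding q_def by (rule tendsto_herglotz_sum_pole[OF \<sigma> inj k])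
    from angular_limit_inverse[OF angular_limit_of_tendsto[OF this]] a[OF k]
    have "angular_limit (\<lambda>z. inverse ((1 - cnj (\<sigma> k) * z) * q z)) (\<sigma> k) (of_real (a k))" by simp
    then show ?thesis by (rule angular_limit_transform) (simp add: pq divide_inverse mult.commute)
  qed
  ultimately show "admissible \<tau> \<sigma> n p a" using a sum by (simp add: admissible_def)
  show "Re (p z) = (\<Sum>k<n. poisson (\<sigma> k) z / 2 * ((cmod (p z))\<^sup>2 / a k))" if z: "cmod z < 1" for z
  proof -
    have "Re (p z) = Re (q z) * (cmod (p z))\<^sup>2"
      using qnz[OF z] unfolding pq by (simp add: norm_inverse power_inverse cmod_power2 divide_inverse)
    also have "\<dots> = (\<Sum>k<n. poisson (\<sigma> k) z / 2 * ((cmod (p z))\<^sup>2 / a k))"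
      unfolding Req[OF z] sum_distrib_right by (intro sum.cong) auto
    finally show ?thesis .
  qed
qed

theorem extreme_point_of_formula:
  assumes \<sigma>: "\<forall>k<n. cmod (\<sigma> k) = 1" and inj: "inj_on \<sigma> {..<n}" and \<tau>: "cmod \<tau> \<le> 1"
    and \<tau>\<sigma>: "\<tau> \<notin> \<sigma> ` {..<n}"
    and lam: "\<forall>k<n. lam k < 0" and sum: "(\<Sum>k<n. \<bar>lam k\<bar>) = 1"
    and G: "\<forall>z\<in>ball 0 1. G z = (\<tau> - z) * (1 - cnj \<tau> * z) / (\<i> * of_real b + p0 \<tau> \<sigma> lam n z)"
  shows "extreme_point_Hol (GenF \<tau> \<sigma> n) G"
proof -
  have n: "n > 0" using sum by (cases n) auto
  have ts: "cmod (\<tau> - \<sigma> k) > 0" if "k < n" for k using \<tau>\<sigma> that by auto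
  define a where "a = (\<lambda>k. \<bar>lam k\<bar> / (cmod (\<tau> - \<sigma> k))\<^sup>2)"
  have a0: "a k > 0" if "k < n" for k unfolding a_def using lam[rule_format, OF that] ts[OF that] by (intro divide_pos_pos) auto
  have suma: "(\<Sum>k<n. a k * (cmod (\<tau> - \<sigma> k))\<^sup>2) = 1"
    unfolding sum[symmetric] by (intro sum.cong) (use ts in \<open>auto simp: a_def\<close>)
  define p where "p = (\<lambda>z. inverse (\<i> * of_real b + (\<Sum>k<n. of_real (1 / (2 * a k)) * herglotz (\<sigma> k) z)))"
  have p0: "p0 \<tau> \<sigma> lam n z = (\<Sum>k<n. of_real (1 / (2 * a k)) * herglotz (\<sigma> k) z)" for z
    unfolding p0_def herglotz_def a_def by (intro sum.cong) auto
  have ad: "admissible \<tau> \<sigma> n p a" and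
    eq: "\<And>z. cmod z < 1 \<Longrightarrow> Re (p z) = (\<Sum>k<n. poisson (\<sigma> k) z / 2 * ((cmod (p z))\<^sup>2 / a k))"
    using admissible_herglotz_sum[OF \<sigma> inj n a0, where \<tau> = \<tau> and p = p and b = b] suma by (auto simp: p_def)
  have Gp: "G z = (\<tau> - z) * (1 - cnj \<tau> * z) * p z" if "cmod z < 1" for z
  proof -
    have "G z = (\<tau> - z) * (1 - cnj \<tau> * z) / (\<i> * of_real b + p0 \<tau> \<sigma> lam n z)" using G that by simp
    then show ?thesis unfolding p_def p0 by (simp only: divide_inverse)
  qed
  have GF: "G \<in> GenF \<tau> \<sigma> n" by (rule GenF_of_admissible[OF \<sigma> \<tau> ad Gp])
  have nz: "(\<tau> - z) * (1 - cnj \<tau> * z) \<noteq> 0" if "cmod z < 1" "z \<noteq> \<tau>" for z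
    using that disk_cnj_neq[OF \<tau> that(1)] by simp
  have pnz: "p z \<noteq> 0" if "cmod z < 1" for z using ad that by (auto simp: admissible_def)
  show ?thesis unfolding extreme_point_Hol_def
  proof (intro conjI GF ballI allI impI)
    fix G1 G2 :: "complex \<Rightarrow> complex" and t :: real and z :: complex
    assume G1: "G1 \<in> GenF \<tau> \<sigma> n" and G2: "G2 \<in> GenF \<tau> \<sigma> n"
      and t: "0 < t \<and> t < 1 \<and> (\<forall>z\<in>ball 0 1. G z = of_real t * G1 z + of_real (1 - t) * G2 z)"
      and z: "z \<in> ball 0 1"
    \<comment> \<open>The zero function belongs to the class and is represented by
      \<open>p = 0\<close>, which is not admissible; hence the disjunction.\<close>
    have ex: "\<exists>p a. p holomorphic_on ball 0 1 \<and> (\<forall>z. cmod z < 1 \<longrightarrow> H z = (\<tau> - z) * (1 - cnj \<tau> * z) * p z) \<and>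
        (admissible \<tau> \<sigma> n p a \<or> (\<forall>z. cmod z < 1 \<longrightarrow> p z = 0))" if H: "H \<in> GenF \<tau> \<sigma> n" for H
    proof (cases "\<forall>z\<in>ball 0 1. H z = 0")
      case True
      then show ?thesis by (intro exI[of _ "\<lambda>_. 0"] exI[of _ "\<lambda>_. 0"]) auto
    next
      case False
      obtain p a where "admissible \<tau> \<sigma> n p a" "\<And>z. cmod z < 1 \<Longrightarrow> H z = (\<tau> - z) * (1 - cnj \<tau> * z) * p z"
        by (rule admissible_of_GenF[OF \<sigma> \<tau> \<tau>\<sigma> n H False]) (assumption | rule that)+
      then show ?thesis by (intro exI[of _ p] exI[of _ a]) (auto simp: admissible_def)
    qed
    obtain p1 a1 where 1: "p1 holomorphic_on ball 0 1" "\<forall>z. cmod z < 1 \<longrightarrow> G1 z = (\<tau> - z) * (1 - cnj \<tau> * z) * p1 z"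
      "admissible \<tau> \<sigma> n p1 a1 \<or> (\<forall>z. cmod z < 1 \<longrightarrow> p1 z = 0)" using ex[OF G1] by blast
    obtain p2 a2 where 2: "p2 holomorphic_on ball 0 1" "\<forall>z. cmod z < 1 \<longrightarrow> G2 z = (\<tau> - z) * (1 - cnj \<tau> * z) * p2 z"
      "admissible \<tau> \<sigma> n p2 a2 \<or> (\<forall>z. cmod z < 1 \<longrightarrow> p2 z = 0)" using ex[OF G2] by blast
    have holp: "p holomorphic_on ball 0 1" using ad by (simp add: admissible_def)
    have pp': "p z = of_real t * p1 z + of_real (1 - t) * p2 z" if "cmod z < 1" "z \<noteq> \<tau>" for z
    proof -
      have "G z = of_real t * G1 z + of_real (1 - t) * G2 z" using t that by simp
      then have "((\<tau> - z) * (1 - cnj \<tau> * z)) * p z = ((\<tau> - z) * (1 - cnj \<tau> * z)) * (of_real t * p1 z + of_real (1 - t) * p2 z)"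
        using Gp[OF that(1)] 1(2) 2(2) that(1) by (simp only: distrib_left mult_ac)
      then show ?thesis using nz[OF that] by (simp only: mult_cancel_left) simp
    qed
    \<comment> \<open>At \<tau> the factor in front of \<open>p\<close> vanishes, so the identity is
      extended to this point by continuity.\<close>
    have pp: "p z = of_real t * p1 z + of_real (1 - t) * p2 z" if z: "cmod z < 1" for z
    proof (cases "z = \<tau>")
      case True
      have i: "isCont f z" if "f holomorphic_on ball 0 1" for f :: "complex \<Rightarrow> complex"
        using holomorphic_on_imp_continuous_on[OF that] z continuous_on_interior[of "ball 0 1" f z] by simp
      have l1: "(p \<longlongrightarrow> p z) (at z)" using i[OF holp] by (simp add: isCont_def)
      have l2: "((\<lambda>z. of_real t * p1 z + of_real (1 - t) * p2 z) \<longlongrightarrow> of_real t * p1 z + of_real (1 - t) * p2 z) (at z)"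
        using i[OF 1(1)] i[OF 2(1)] unfolding isCont_def by (intro tendsto_intros)
      have "\<forall>\<^sub>F w in at z. w \<in> ball 0 1 - {z}" by (rule eventually_at_in_open) (use z in auto)
      then have "\<forall>\<^sub>F w in at z. p w = of_real t * p1 w + of_real (1 - t) * p2 w"
        by eventually_elim (use pp' True in auto)
      from Lim_transform_eventually[OF l1 this] l2 show ?thesis by (rule tendsto_unique[rotated]) simp
    qed (use pp' z in auto)
    \<comment> \<open>Neither summand is zero: otherwise \<open>a = s * b1\<close> with
      \<open>s < 1\<close>, and the total weight of \<open>b1\<close>, being at most 1, would give
      \<open>a\<close> a total weight below 1.\<close>
    have contr: False
      if zero: "\<forall>z. cmod z < 1 \<longrightarrow> r2 z = 0" and r: "\<And>z. cmod z < 1 \<Longrightarrow> p z = of_real s * r1 z + of_real (1 - s) * r2 z"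
        and s: "0 < s" "s < 1" and adr: "admissible \<tau> \<sigma> n r1 b1 \<or> (\<forall>z. cmod z < 1 \<longrightarrow> r1 z = 0)" for r1 r2 b1 s
    proof -
      have r1: "p z = of_real s * r1 z" if "cmod z < 1" for z using r[OF that] zero that by simp
      then have "r1 0 \<noteq> 0" using pnz[of 0] by auto
      then have adr: "admissible \<tau> \<sigma> n r1 b1" using adr by auto
      have "a k = s * b1 k" if k: "k < n" for k
      proof -
        have sk: "cmod (\<sigma> k) = 1" using \<sigma> k by simp
        have "angular_limit (\<lambda>z. of_real s * (r1 z / (1 - cnj (\<sigma> k) * z))) (\<sigma> k) (of_real s * of_real (b1 k))"
          using adr k by (intro angular_limit_mult angular_limit_of_tendsto[OF tendsto_const]) (auto simp: admissible_def)
        then have "angular_limit (\<lambda>z. p z / (1 - cnj (\<sigma> k) * z)) (\<sigma> k) (of_real s * of_real (b1 k))"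
          by (rule angular_limit_transform) (simp add: r1)
        moreover have "angular_limit (\<lambda>z. p z / (1 - cnj (\<sigma> k) * z)) (\<sigma> k) (of_real (a k))"
          using ad k by (simp add: admissible_def)
        ultimately show ?thesis using angular_limit_unique[OF sk] by (metis of_real_eq_iff of_real_mult)
      qed
      then have "1 = s * (\<Sum>k<n. b1 k * (cmod (\<tau> - \<sigma> k))\<^sup>2)"
        unfolding suma[symmetric] sum_distrib_left by (intro sum.cong) auto
      moreover have "(\<Sum>k<n. b1 k * (cmod (\<tau> - \<sigma> k))\<^sup>2) \<le> 1" using adr by (simp add: admissible_def)
      ultimately show False using s by (smt (verit) mult_left_le)
    qed
    have ad1: "admissible \<tau> \<sigma> n p1 a1"
      using 1(3) contr[of p1 "1 - t" p2 a2] pp t 2(3) by (auto simp: add.commute)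
    have ad2: "admissible \<tau> \<sigma> n p2 a2"
      using 2(3) contr[of p2 t p1 a1] pp t 1(3) by auto
    have "p1 z = p2 z"
      by (rule admissible_convex_equality[OF \<sigma> inj n ad suma ad1 ad2 _ _ pp eq]) (use t z in auto)
    then show "G1 z = G2 z" using 1(2) 2(2) z by simp
  qed
qed

subsection \<open>A maximum principle for rational multipliers\<close>

text \<open>Gaussian elimination: an equation with a nonzero coefficient at \<open>l\<close>
  expresses the unknown \<open>l\<close> through the others, and \<open>c'\<close> is the reduced
  system.\<close>

lemma homogeneous_system_nontrivial:
  fixes c :: "'i \<Rightarrow> 'j \<Rightarrow> real"
  assumes "finite I" "finite J" "card I < card J"
  shows "\<exists>x. (\<exists>j\<in>J. x j \<noteq> 0) \<and> (\<forall>i\<in>I. (\<Sum>j\<in>J. c i j * x j) = 0)"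
  using assms
proof (induction I arbitrary: J c rule: finite_induct)
  case empty
  then obtain j where "j \<in> J" by fastforce
  then show ?case by (intro exI[of _ "\<lambda>_. 1"]) auto
next
  case (insert i I)
  show ?case
  proof (cases "\<forall>j\<in>J. c i j = 0")
    case True
    have "card I < card J" using insert by simp
    from insert.IH[OF insert.prems(1) this, of c] True show ?thesis by auto
  next
    case False
    then obtain l where l: "l \<in> J" "c i l \<noteq> 0" by blast
    define J' where "J' = J - {l}"
    have J: "finite J'" "J = insert l J'" "l \<notin> J'" "card I < card J'"
      using insert l by (auto simp: J'_def card_Diff_singleton)
    define c' where "c' = (\<lambda>k j. c k j - c k l * (c i j / c i l))"
    obtain x where x: "\<exists>j\<in>J'. x j \<noteq> 0" "\<And>k. k \<in> I \<Longrightarrow> (\<Sum>j\<in>J'. c' k j * x j) = 0"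
      using insert.IH[OF J(1,4), of c'] by blast
    define s where "s = (\<Sum>j\<in>J'. c i j * x j)"
    define y where "y = x(l := - (s / c i l))"
    have yl: "y l = - (s / c i l)" by (simp add: y_def)
    have sumy: "(\<Sum>j\<in>J. c k j * y j) = (\<Sum>j\<in>J'. c k j * x j) - c k l * (s / c i l)" for k
    proof -
      have "(\<Sum>j\<in>J. c k j * y j) = c k l * y l + (\<Sum>j\<in>J'. c k j * y j)"
        unfolding J(2) using J(1,3) by simp
      also have "(\<Sum>j\<in>J'. c k j * y j) = (\<Sum>j\<in>J'. c k j * x j)"
        using J(3) by (intro sum.cong) (auto simp: y_def)
      finally show ?thesis by (simp add: yl)
    qed
    have "(\<Sum>j\<in>J. c k j * y j) = 0" if k: "k \<in> insert i I" for k
    proof (cases "k = i")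
      case True
      then show ?thesis unfolding sumy using l by (simp add: s_def)
    next
      case False
      have "(\<Sum>j\<in>J'. c k j * x j) - c k l * (s / c i l) = (\<Sum>j\<in>J'. c' k j * x j)"
        unfolding c'_def s_def left_diff_distrib sum_subtractf sum_divide_distrib sum_distrib_left
        by (simp add: mult_ac)
      then show ?thesis unfolding sumy using x(2) False k by simp
    qed
    moreover have "\<exists>j\<in>J. y j \<noteq> 0" using x(1) J by (auto simp: y_def)
    ultimately show ?thesis by blast
  qed
qed

text \<open>Zeros are divided out one at a time. The factors have the form \<open>w k - z\<close> to
  agree with \<open>E\<close>, which is \<open>2 ^ n\<close> times their product when
  \<open>w k = \<sigma> k / 2\<close>.\<close>

lemma holomorphic_factor_zeros:
  fixes w :: "nat \<Rightarrow> complex"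
  assumes S: "open S"
  shows "f holomorphic_on S \<Longrightarrow> inj_on w {..<n} \<Longrightarrow> w ` {..<n} \<subseteq> S \<Longrightarrow> \<forall>k<n. f (w k) = 0 \<Longrightarrow>
    \<exists>g. g holomorphic_on S \<and> (\<forall>z\<in>S. f z = (\<Prod>k<n. w k - z) * g z)"
proof (induction n arbitrary: f)
  case 0
  then show ?case by auto
next
  case (Suc n)
  define h where "h = (\<lambda>z. if z = w n then deriv f (w n) else (f z - f (w n)) / (z - w n))"
  have holh: "h holomorphic_on S" unfolding h_def by (rule pole_lemma_open[OF Suc.prems(1) S])
  have fh: "f z = (z - w n) * h z" for z using Suc.prems(4) by (simp add: h_def)
  have "h (w k) = 0" if "k < n" for k
  proof -
    have "w k \<noteq> w n" using Suc.prems(2) that by (auto dest: inj_onD)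
    moreover have "f (w k) = 0" using Suc.prems(4) that by simp
    ultimately show ?thesis using fh[of "w k"] by simp
  qed
  moreover have "inj_on w {..<n}" using Suc.prems(2) by (rule inj_on_subset) auto
  ultimately obtain g where g: "g holomorphic_on S" "\<And>z. z \<in> S \<Longrightarrow> h z = (\<Prod>k<n. w k - z) * g z"
    using Suc.IH[OF holh] Suc.prems(3) by (auto simp: lessThan_Suc)
  have "(\<lambda>z. - g z) holomorphic_on S" by (intro holomorphic_intros g)
  moreover have "f z = (\<Prod>k<Suc n. w k - z) * - g z" if "z \<in> S" for z
    unfolding fh g(2)[OF that] by (simp add: algebra_simps)
  ultimately show ?case by blast
qed

lemma exists_lagrange_basis:
  fixes w :: "nat \<Rightarrow> complex"
  assumes "inj_on w {..<n}"
  obtains l :: "nat \<Rightarrow> complex \<Rightarrow> complex" where "\<And>k. l k holomorphic_on UNIV"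
    "\<And>j k. j < n \<Longrightarrow> k < n \<Longrightarrow> l k (w j) = (if j = k then 1 else 0)"
proof -
  define l where "l = (\<lambda>k z. \<Prod>j\<in>{..<n} - {k}. (z - w j) / (w k - w j))"
  have "l k holomorphic_on UNIV" for k unfolding l_def divide_inverse
    by (intro holomorphic_on_prod holomorphic_on_mult holomorphic_on_diff holomorphic_on_ident holomorphic_on_const)
  moreover have "l k (w j) = (if j = k then 1 else 0)" if "j < n" "k < n" for j k
  proof (cases "j = k")
    case True
    have "w k \<noteq> w i" if "i \<in> {..<n} - {k}" for i using assms that \<open>k < n\<close> by (auto dest: inj_onD)
    then show ?thesis using True by (simp add: l_def)
  next
    case False
    then have "(\<Prod>i\<in>{..<n} - {k}. (w j - w i) / (w k - w i)) = 0"
      using that by (intro prod_zero) auto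
    then show ?thesis using False by (simp add: l_def)
  qed
  ultimately show thesis using that by blast
qed

text \<open>The dilates \<open>p(r z)\<close> are harmless at the boundary, but they destroy the cancellation of the
  poles of \<open>A p + B\<close> over \<open>E\<close>; it is restored by subtracting the Lagrange interpolant at the zeros
  of \<open>E\<close>, which tends to 0 as \<open>r \<rightarrow> 1\<close>.\<close>
lemma Re_nonneg_of_boundary:
  fixes \<sigma> :: "nat \<Rightarrow> complex"
  defines "E \<equiv> \<lambda>n z. \<Prod>k<n. \<sigma> k - 2 * z"
  assumes \<sigma>: "\<forall>k<n. cmod (\<sigma> k) = 1" and inj: "inj_on \<sigma> {..<n}"
    and holp: "p holomorphic_on ball 0 1" and p: "\<And>z. cmod z < 1 \<Longrightarrow> Re (p z) \<ge> 0"
    and holA: "A holomorphic_on ball 0 2" and holB: "B holomorphic_on ball 0 2"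
    and A: "\<And>z. cmod z = 1 \<Longrightarrow> A z / E n z \<in> \<real> \<and> Re (A z / E n z) \<ge> 0"
    and B: "\<And>z. cmod z = 1 \<Longrightarrow> Re (B z / E n z) = 0"
    and holf: "f holomorphic_on ball 0 1" and f: "\<And>z. cmod z < 1 \<Longrightarrow> E n z * f z = A z * p z + B z"
    and z: "cmod z < 1"
  shows "Re (f z) \<ge> 0"
proof -
  define w where "w = (\<lambda>k. \<sigma> k / 2)"
  have injw: "inj_on w {..<n}" using inj by (auto simp: w_def inj_on_def)
  have w1: "cmod (w k) < 1" if "k < n" for k using \<sigma> that by (simp add: w_def norm_divide)
  have E: "E n z = 2 ^ n * (\<Prod>k<n. w k - z)" for z
  proof -
    have "E n z = (\<Prod>k<n. 2 * (w k - z))" unfolding E_def w_def by (intro prod.cong) auto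
    then show ?thesis by (simp only: prod.distrib prod_constant card_lessThan)
  qed
  have Ew: "E n (w k) = 0" if "k < n" for k unfolding E using that by (auto intro!: prod_zero)
  \<comment> \<open>With this lower bound the interpolation term divided by \<open>E\<close> is
    still bounded by \<open>\<delta> r\<close> on the circle.\<close>
  have E1: "cmod (E n z) \<ge> 1" if "cmod z = 1" for z
  proof -
    have "1 \<le> cmod (\<sigma> k - 2 * z)" if "k < n" for k
      using norm_triangle_ineq2[of "2 * z" "\<sigma> k"] \<sigma> that \<open>cmod z = 1\<close> by (simp add: norm_mult norm_minus_commute)
    then show ?thesis unfolding E_def prod_norm[symmetric] by (intro prod_ge_1) auto
  qed
  obtain l :: "nat \<Rightarrow> complex \<Rightarrow> complex" where l: "\<And>k. l k holomorphic_on UNIV"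
    "\<And>j k. j < n \<Longrightarrow> k < n \<Longrightarrow> l k (w j) = (if j = k then 1 else 0)"
    using exists_lagrange_basis[OF injw] by blast
  have "\<exists>C. \<forall>z. cmod z = 1 \<longrightarrow> cmod (l k z) \<le> C" for k
  proof -
    have "compact (l k ` sphere 0 1)"
      by (intro compact_continuous_image compact_sphere holomorphic_on_imp_continuous_on)
         (use l(1)[of k] in \<open>auto intro: holomorphic_on_subset\<close>)
    then have "bounded (l k ` sphere 0 1)" by (rule compact_imp_bounded)
    then obtain c where "\<forall>x\<in>sphere 0 1. cmod (l k x) \<le> c" by (auto simp: bounded_iff)
    then show ?thesis by (intro exI[of _ c]) auto
  qed
  then obtain C where C: "\<And>k z. cmod z = 1 \<Longrightarrow> cmod (l k z) \<le> C k" by metis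
  \<comment> \<open>The value of the dilated numerator at the node \<open>w k\<close>. For
    \<open>r = 1\<close> it is 0 because \<open>E\<close> vanishes there; for \<open>r < 1\<close>
    it need not be.\<close>
  define e where "e = (\<lambda>(r::real) k. A (w k) * p (of_real r * w k) + B (w k))"
  define \<delta> where "\<delta> = (\<lambda>r. \<Sum>k<n. cmod (e r k) * C k)"
  define F where "F = (\<lambda>(r::real) z. A z * p (of_real r * z) + B z - (\<Sum>k<n. e r k * l k z))"
  have bound: "Re (F r z / E n z) \<ge> - \<delta> r" if r: "0 < r" "r < 1" and z: "cmod z < 1" and Ez: "E n z \<noteq> 0" for r z
  proof -
    \<comment> \<open>\<open>A\<close> and \<open>B\<close> are holomorphic up to radius 2 and the
      dilate of \<open>p\<close> up to radius \<open>1 / r\<close>; the minimum exceeds 1, so the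
      closed unit disk is covered.\<close>
    define \<rho> where "\<rho> = min 2 (1 / r)"
    have \<rho>: "\<rho> > 1" "\<rho> \<le> 2" using r by (auto simp: \<rho>_def)
    have r\<rho>: "cmod (of_real r * z) < 1" if "cmod z < \<rho>" for z
      using that r by (simp add: \<rho>_def norm_mult less_divide_eq mult.commute)
    have "(\<lambda>z. p (of_real r * z)) holomorphic_on ball 0 \<rho>"
      using holomorphic_on_compose_gen[of "\<lambda>z. of_real r * z" "ball 0 \<rho>" p "ball 0 1"] holp r\<rho>
      by (auto simp: o_def image_subset_iff intro!: holomorphic_intros)
    then have holF: "F r holomorphic_on ball 0 \<rho>"
      unfolding F_def using \<rho>
      by (intro holomorphic_intros holomorphic_on_subset[OF holA] holomorphic_on_subset[OF holB] holomorphic_on_subset[OF l(1)]) auto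
    have "F r (w k) = 0" if k: "k < n" for k
    proof -
      have "(\<Sum>j<n. e r j * l j (w k)) = (\<Sum>j<n. if j = k then e r k else 0)"
        using l(2) k by (intro sum.cong) auto
      then show ?thesis using k by (simp add: F_def e_def)
    qed
    then obtain g where g: "g holomorphic_on ball 0 \<rho>" "\<And>z. z \<in> ball 0 \<rho> \<Longrightarrow> F r z = (\<Prod>k<n. w k - z) * g z"
      using holomorphic_factor_zeros[OF open_ball holF injw] w1 \<rho> by fastforce
    have gF: "g z / 2 ^ n = F r z / E n z" if "cmod z < \<rho>" "E n z \<noteq> 0" for z
      using g(2)[of z] that unfolding E by (auto simp: field_simps)
    have "Re (- (g z / 2 ^ n)) \<le> \<delta> r"
    proof (rule maximum_real_frontier[where S = "ball 0 1" and f = "\<lambda>z. - (g z / 2 ^ n)"])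
      have hg: "(\<lambda>z. - (g z / 2 ^ n)) holomorphic_on ball 0 \<rho>"
        by (intro holomorphic_intros g) auto
      then show "(\<lambda>z. - (g z / 2 ^ n)) holomorphic_on interior (ball 0 1)"
        by (rule holomorphic_on_subset) (use \<rho> in auto)
      have "(\<lambda>z. - (g z / 2 ^ n)) holomorphic_on closure (ball 0 1)"
        by (rule holomorphic_on_subset[OF hg]) (use \<rho> in auto)
      then show "continuous_on (closure (ball 0 1)) (\<lambda>z. - (g z / 2 ^ n))"
        by (rule holomorphic_on_imp_continuous_on)
      fix \<zeta> :: complex assume "\<zeta> \<in> frontier (ball 0 1)"
      then have \<zeta>: "cmod \<zeta> = 1" by simp
      have Enz: "E n \<zeta> \<noteq> 0" using E1[OF \<zeta>] by auto
      have "cmod (of_real r * \<zeta>) < 1" using r \<zeta> by (simp add: norm_mult)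
      then have p\<zeta>: "Re (p (of_real r * \<zeta>)) \<ge> 0" by (rule p)
      have "Re (A \<zeta> / E n \<zeta> * p (of_real r * \<zeta>)) = Re (A \<zeta> / E n \<zeta>) * Re (p (of_real r * \<zeta>))"
      proof -
        have "Im (A \<zeta> / E n \<zeta>) = 0" using A[OF \<zeta>] complex_is_Real_iff by blast
        then show ?thesis by (simp only: times_complex.sel mult_zero_left diff_zero)
      qed
      then have 1: "Re (A \<zeta> / E n \<zeta> * p (of_real r * \<zeta>)) \<ge> 0" using A[OF \<zeta>] p\<zeta> by simp
      have "cmod ((\<Sum>k<n. e r k * l k \<zeta>) / E n \<zeta>) \<le> cmod (\<Sum>k<n. e r k * l k \<zeta>)"
        using E1[OF \<zeta>] frac_le[of "cmod (\<Sum>k<n. e r k * l k \<zeta>)" "cmod (\<Sum>k<n. e r k * l k \<zeta>)" 1 "cmod (E n \<zeta>)"]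
        by (simp add: norm_divide)
      also have "\<dots> \<le> \<delta> r"
        unfolding \<delta>_def by (intro sum_norm_le) (use C[OF \<zeta>] in \<open>auto simp: norm_mult intro!: mult_left_mono\<close>)
      finally have 2: "Re ((\<Sum>k<n. e r k * l k \<zeta>) / E n \<zeta>) \<le> \<delta> r"
        using complex_Re_le_cmod order_trans by blast
      have "F r \<zeta> / E n \<zeta> = A \<zeta> / E n \<zeta> * p (of_real r * \<zeta>) + B \<zeta> / E n \<zeta> - (\<Sum>k<n. e r k * l k \<zeta>) / E n \<zeta>"
        by (simp add: F_def diff_divide_distrib add_divide_distrib)
      then have "Re (F r \<zeta> / E n \<zeta>) \<ge> - \<delta> r" using 1 2 B[OF \<zeta>] by simp
      then show "Re (- (g \<zeta> / 2 ^ n)) \<le> \<delta> r" using gF[of \<zeta>] \<zeta> \<rho> Enz by simp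
    qed (use z in auto)
    moreover have "g z / 2 ^ n = F r z / E n z" using gF[of z] z \<rho> Ez by simp
    ultimately show ?thesis by simp
  qed
  have plim: "((\<lambda>r. p (of_real r * z)) \<longlongrightarrow> p z) (at_left (1::real))" if z: "cmod z < 1" for z
  proof -
    have "isCont p z"
      using holomorphic_on_imp_continuous_on[OF holp] z continuous_on_interior[of "ball 0 1" p z] by simp
    moreover have "((\<lambda>r. of_real r * z) \<longlongrightarrow> of_real 1 * z) (at_left (1::real))" by (intro tendsto_intros)
    ultimately show ?thesis using isCont_tendsto_compose[of z p] by simp
  qed
  have elim: "((\<lambda>r. e r k) \<longlongrightarrow> 0) (at_left 1)" if k: "k < n" for k
  proof -
    have "((\<lambda>r. e r k) \<longlongrightarrow> A (w k) * p (w k) + B (w k)) (at_left 1)"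
      unfolding e_def by (intro tendsto_intros plim w1 k)
    moreover have "A (w k) * p (w k) + B (w k) = 0" using f[OF w1[OF k]] Ew[OF k] by simp
    ultimately show ?thesis by simp
  qed
  have \<delta>lim: "(\<delta> \<longlongrightarrow> 0) (at_left 1)"
  proof -
    have "(\<delta> \<longlongrightarrow> (\<Sum>k<n. cmod 0 * C k)) (at_left 1)"
      unfolding \<delta>_def by (intro tendsto_intros elim) auto
    then show ?thesis by simp
  qed
  have off: "Re (f z) \<ge> 0" if z: "cmod z < 1" and Ez: "E n z \<noteq> 0" for z
  proof -
    have "((\<lambda>r. Re (F r z / E n z)) \<longlongrightarrow> Re ((A z * p z + B z - (\<Sum>k<n. 0 * l k z)) / E n z)) (at_left 1)"
      unfolding F_def by (intro tendsto_intros plim z elim Ez) auto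
    moreover have "(A z * p z + B z - (\<Sum>k<n. 0 * l k z)) / E n z = f z"
      using f[OF z, symmetric] Ez by simp
    ultimately have L: "((\<lambda>r. Re (F r z / E n z)) \<longlongrightarrow> Re (f z)) (at_left 1)" by simp
    have "((\<lambda>r. - \<delta> r) \<longlongrightarrow> - 0) (at_left 1)" by (intro tendsto_minus \<delta>lim)
    moreover have "\<forall>\<^sub>F r in at_left 1. - \<delta> r \<le> Re (F r z / E n z)"
      by (rule eventually_at_leftI[of 0]) (use bound z Ez in auto)
    ultimately have "- 0 \<le> Re (f z)" using L by (intro tendsto_le[of "at_left (1::real)"]) auto
    then show ?thesis by simp
  qed
  show ?thesis
  \<comment> \<open>The quotient by \<open>E\<close> gives no information at the zeros of
    \<open>E\<close>; they are finite in number, so continuity of \<open>f\<close> suffices.\<close>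
  proof (cases "E n z = 0")
    case True
    have "isCont f z"
      using holomorphic_on_imp_continuous_on[OF holf] z continuous_on_interior[of "ball 0 1" f z] by simp
    then have "((\<lambda>z. Re (f z)) \<longlongrightarrow> Re (f z)) (at z)" unfolding isCont_def by (intro tendsto_intros)
    moreover have "\<forall>\<^sub>F u in at z. u \<in> ball 0 1 - w ` {..<n}"
    proof -
      have "open (ball 0 1 - (w ` {..<n} - {z}))" by (intro open_Diff finite_imp_closed) auto
      from eventually_at_in_open[OF this, of z] z
      have "\<forall>\<^sub>F u in at z. u \<in> ball 0 1 - (w ` {..<n} - {z}) - {z}" by simp
      then show ?thesis by eventually_elim auto
    qed
    then have "\<forall>\<^sub>F u in at z. 0 \<le> Re (f u)"
    proof eventually_elim
      case (elim u)
      then have "E n u \<noteq> 0" unfolding E by auto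
      then show ?case using off elim by simp
    qed
    ultimately show ?thesis by (intro tendsto_lowerbound) auto
  qed (use off z in auto)
qed

text \<open>\<open>Re_nonneg_of_boundary\<close> for \<open>M * p + f\<close> and
  \<open>M * p - f\<close>, whose multipliers \<open>M \<plusminus> A / E\<close> are nonnegative on
  the circle.\<close>

lemma Re_bound_of_boundary:
  fixes \<sigma> :: "nat \<Rightarrow> complex"
  defines "E \<equiv> \<lambda>n z. \<Prod>k<n. \<sigma> k - 2 * z"
  assumes \<sigma>: "\<forall>k<n. cmod (\<sigma> k) = 1" and inj: "inj_on \<sigma> {..<n}"
    and holp: "p holomorphic_on ball 0 1" and p: "\<And>z. cmod z < 1 \<Longrightarrow> Re (p z) \<ge> 0"
    and holA: "A holomorphic_on ball 0 2" and holB: "B holomorphic_on ball 0 2"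
    and A: "\<And>z. cmod z = 1 \<Longrightarrow> A z / E n z \<in> \<real> \<and> \<bar>Re (A z / E n z)\<bar> \<le> M"
    and B: "\<And>z. cmod z = 1 \<Longrightarrow> Re (B z / E n z) = 0"
    and holf: "f holomorphic_on ball 0 1" and f: "\<And>z. cmod z < 1 \<Longrightarrow> E n z * f z = A z * p z + B z"
    and z: "cmod z < 1"
  shows "\<bar>Re (f z)\<bar> \<le> M * Re (p z)"
proof -
  have holE: "E n holomorphic_on ball 0 2" unfolding E_def by (intro holomorphic_intros)
  have E0: "E n z \<noteq> 0" if "cmod z = 1" for z
    using that \<sigma> unfolding E_def by (auto simp: norm_mult dest!: arg_cong[of _ _ cmod])
  have "Re (of_real M * p z + s * f z) \<ge> 0" if s: "s = 1 \<or> s = - 1" for s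
  proof (rule Re_nonneg_of_boundary[OF \<sigma> inj holp p, where f = "\<lambda>z. of_real M * p z + s * f z"
        and A = "\<lambda>z. of_real M * E n z + s * A z" and B = "\<lambda>z. s * B z"])
    show "(\<lambda>z. of_real M * E n z + s * A z) holomorphic_on ball 0 2" by (intro holomorphic_intros holE holA)
    show "(\<lambda>z. s * B z) holomorphic_on ball 0 2" by (intro holomorphic_intros holB)
    show "(\<lambda>z. of_real M * p z + s * f z) holomorphic_on ball 0 1" by (intro holomorphic_intros holp holf)
    fix z :: complex
    show "(of_real M * E n z + s * A z) / (\<Prod>k<n. \<sigma> k - 2 * z) \<in> \<real> \<and> 0 \<le> Re ((of_real M * E n z + s * A z) / (\<Prod>k<n. \<sigma> k - 2 * z))"
      if "cmod z = 1"
    proof -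
      have "(of_real M * E n z + s * A z) / (\<Prod>k<n. \<sigma> k - 2 * z) = of_real M + s * (A z / E n z)"
        using E0[OF that] by (simp add: E_def add_divide_distrib)
      then show ?thesis using A[OF that] s by (auto simp: abs_le_iff)
    qed
    show "Re (s * B z / (\<Prod>k<n. \<sigma> k - 2 * z)) = 0" if "cmod z = 1"
      using B[OF that] s by (auto simp: E_def)
    show "(\<Prod>k<n. \<sigma> k - 2 * z) * (of_real M * p z + s * f z) = (of_real M * E n z + s * A z) * p z + s * B z" if "cmod z < 1"
    proof -
      have "E n z * (of_real M * p z + s * f z) = of_real M * E n z * p z + s * (E n z * f z)" by (simp add: algebra_simps)
      then show ?thesis unfolding f[OF that] by (simp add: E_def algebra_simps)
    qed
  qed (use z in auto)
  from this[of 1] this[of "-1"] show ?thesis by (simp add: abs_le_iff)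
qed

subsection \<open>Extreme points are given by the formula\<close>

text \<open>On the circle \<open>\<i> * herglotz (\<sigma> k)\<close> is real, hence so is this
  combination off the poles. The coefficient of the constant has the last index \<open>n\<close>;
  the others can be recovered from the poles.\<close>

definition comb :: "(nat \<Rightarrow> complex) \<Rightarrow> nat \<Rightarrow> (nat \<Rightarrow> real) \<Rightarrow> complex \<Rightarrow> complex" where
  "comb \<sigma> n x z = of_real (x n) + (\<Sum>k<n. (\<i> * of_real (x k)) * herglotz (\<sigma> k) z)"

text \<open>For \<open>\<bar>z\<bar> = \<bar>s\<bar> = 1\<close> we have \<open>omega s z / (s - 2 z) = \<bar>s - z\<bar>\<^sup>2 / \<bar>s - 2 z\<bar>\<^sup>2\<close>, and
  \<open>kappa s = \<i> herglotz s omega s\<close>. The factors \<open>s - 2 z\<close> are kept apart since they vanish in the disk.\<close>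
definition omega :: "complex \<Rightarrow> complex \<Rightarrow> complex" where
  "omega s z = (s - z)\<^sup>2 / (2 * s - z)"

definition kappa :: "complex \<Rightarrow> complex \<Rightarrow> complex" where
  "kappa s z = \<i> * (s + z) * (s - z) / (2 * s - z)"

text \<open>\<open>comb \<sigma> n x\<close> times all the \<open>omega (\<sigma> j)\<close>, with
  the poles on the circle cancelled, so that it is holomorphic across the circle. Divided by the
  product of the \<open>\<sigma> k - 2 * z\<close> it is the bounded real weight.\<close>

definition trig :: "(nat \<Rightarrow> complex) \<Rightarrow> nat \<Rightarrow> (nat \<Rightarrow> real) \<Rightarrow> complex \<Rightarrow> complex" where
  "trig \<sigma> n x z = of_real (x n) * (\<Prod>j<n. omega (\<sigma> j) z) +
     (\<Sum>k<n. of_real (x k) * (kappa (\<sigma> k) z * (\<Prod>j\<in>{..<n} - {k}. omega (\<sigma> j) z)))"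

lemma two_circle_neq: "cmod s = 1 \<Longrightarrow> cmod z < 2 \<Longrightarrow> 2 * s - z \<noteq> 0"
  by (auto simp: norm_mult)

lemma two_circle_neq': "cmod s = 1 \<Longrightarrow> cmod z = 1 \<Longrightarrow> s - 2 * z \<noteq> 0"
  by (auto simp: norm_mult)

lemma holomorphic_omega: "cmod s = 1 \<Longrightarrow> omega s holomorphic_on ball 0 2"
  unfolding omega_def[abs_def] by (intro holomorphic_intros) (use two_circle_neq in auto)

lemma holomorphic_kappa: "cmod s = 1 \<Longrightarrow> kappa s holomorphic_on ball 0 2"
  unfolding kappa_def[abs_def] by (intro holomorphic_intros) (use two_circle_neq in auto)

lemma holomorphic_trig: "\<forall>k<n. cmod (\<sigma> k) = 1 \<Longrightarrow> trig \<sigma> n x holomorphic_on ball 0 2"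
  unfolding trig_def[abs_def] by (intro holomorphic_intros holomorphic_omega holomorphic_kappa) auto

lemma circle_cnj_inverse: "cmod z = 1 \<Longrightarrow> cnj z = 1 / z"
  using circle_cnj[of z] by (cases "z = 0") (simp_all add: eq_divide_eq mult.commute)

text \<open>On the circle conjugation acts as inversion, which makes reality a rational identity;
  the same reason works for \<open>kappa_real\<close>.\<close>

lemma omega_real:
  assumes "cmod s = 1" "cmod z = 1"
  shows "omega s z / (s - 2 * z) \<in> \<real>"
proof -
  have nz: "s \<noteq> 0" "z \<noteq> 0" "2 * s - z \<noteq> 0" "s - 2 * z \<noteq> 0" "2 * z - s \<noteq> 0" "z - 2 * s \<noteq> 0"
    using assms two_circle_neq[of s z] two_circle_neq'[of s z] by auto
  have "cnj (omega s z / (s - 2 * z)) = (1 / s - 1 / z)\<^sup>2 / ((2 / s - 1 / z) * (1 / s - 2 / z))"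
    by (simp add: omega_def circle_cnj_inverse[OF assms(1)] circle_cnj_inverse[OF assms(2)])
  also have "\<dots> = ((z - s) / (s * z))\<^sup>2 / (((2 * z - s) / (s * z)) * ((z - 2 * s) / (s * z)))"
    using nz by (simp add: diff_frac_eq mult.commute)
  also have "\<dots> = (z - s)\<^sup>2 / ((2 * z - s) * (z - 2 * s))"
    using nz by (simp add: power2_eq_square)
  also have "\<dots> = (s - z)\<^sup>2 / ((2 * s - z) * (s - 2 * z))"
    using minus_mult_minus[of "2 * z - s" "z - 2 * s"] power2_commute[of z s] by (simp add: mult.commute)
  also have "\<dots> = omega s z / (s - 2 * z)" by (simp add: omega_def)
  finally show ?thesis by (simp add: Reals_cnj_iff)
qed

lemma frac_cancel_aux:
  fixes m c d e a b :: complex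
  shows "m \<noteq> 0 \<Longrightarrow> c \<noteq> 0 \<Longrightarrow> d \<noteq> 0 \<Longrightarrow> - (e * (a / m) * (b / m)) / ((c / m) * (d / m)) = (e * a * - b) / (c * d)"
  by (simp add: field_simps)

lemma kappa_real:
  assumes "cmod s = 1" "cmod z = 1"
  shows "kappa s z / (s - 2 * z) \<in> \<real>"
proof -
  have nz: "s \<noteq> 0" "z \<noteq> 0" "2 * s - z \<noteq> 0" "s - 2 * z \<noteq> 0" "2 * z - s \<noteq> 0" "z - 2 * s \<noteq> 0"
    using assms two_circle_neq[of s z] two_circle_neq'[of s z] by auto
  have "cnj (kappa s z / (s - 2 * z)) = - (\<i> * (1 / s + 1 / z) * (1 / s - 1 / z)) / ((2 / s - 1 / z) * (1 / s - 2 / z))"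
    by (simp add: kappa_def circle_cnj_inverse[OF assms(1)] circle_cnj_inverse[OF assms(2)])
  also have "\<dots> = - (\<i> * ((s + z) / (s * z)) * ((z - s) / (s * z))) / (((2 * z - s) / (s * z)) * ((z - 2 * s) / (s * z)))"
    using nz by (simp add: diff_frac_eq add_frac_eq mult.commute add.commute)
  also have "\<dots> = (\<i> * (s + z) * (s - z)) / ((2 * z - s) * (z - 2 * s))"
    using frac_cancel_aux[of "s * z" "2 * z - s" "z - 2 * s" \<i> "s + z" "z - s"] nz by simp
  also have "\<dots> = (\<i> * (s + z) * (s - z)) / ((2 * s - z) * (s - 2 * z))"
    using minus_mult_minus[of "2 * z - s" "z - 2 * s"] by (simp add: mult.commute)
  also have "\<dots> = kappa s z / (s - 2 * z)" by (simp add: kappa_def)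
  finally show ?thesis by (simp add: Reals_cnj_iff)
qed

lemma prod_lessThan_remove: "k < n \<Longrightarrow> (\<Prod>j<n. f j) = f k * (\<Prod>j\<in>{..<n::nat} - {k}. f j :: complex)"
  by (intro prod.remove) auto

lemma trig_real:
  assumes \<sigma>: "\<forall>k<n. cmod (\<sigma> k) = 1" and z: "cmod z = 1"
  shows "trig \<sigma> n x z / (\<Prod>k<n. \<sigma> k - 2 * z) \<in> \<real>"
proof -
  let ?E = "\<Prod>k<n. \<sigma> k - 2 * z"
  have e1: "trig \<sigma> n x z / ?E = of_real (x n) * ((\<Prod>j<n. omega (\<sigma> j) z) / ?E) +
     (\<Sum>k<n. of_real (x k) * ((kappa (\<sigma> k) z * (\<Prod>j\<in>{..<n} - {k}. omega (\<sigma> j) z)) / ?E))"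
    by (simp add: trig_def add_divide_distrib sum_divide_distrib)
  have e2: "(\<Prod>j<n. omega (\<sigma> j) z) / ?E \<in> \<real>"
    unfolding prod_dividef[symmetric] by (intro prod_in_Reals omega_real z) (use \<sigma> in auto)
  have e3: "(kappa (\<sigma> k) z * (\<Prod>j\<in>{..<n} - {k}. omega (\<sigma> j) z)) / ?E \<in> \<real>" if k: "k < n" for k
  proof -
    have "(kappa (\<sigma> k) z * (\<Prod>j\<in>{..<n} - {k}. omega (\<sigma> j) z)) / ?E =
        kappa (\<sigma> k) z / (\<sigma> k - 2 * z) * (\<Prod>j\<in>{..<n} - {k}. omega (\<sigma> j) z / (\<sigma> j - 2 * z))"
      unfolding prod_lessThan_remove[OF k, of "\<lambda>j. \<sigma> j - 2 * z"] prod_dividef by simp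
    also have "\<dots> \<in> \<real>"
      by (intro Reals_mult kappa_real prod_in_Reals omega_real z) (use \<sigma> k in auto)
    finally show ?thesis .
  qed
  show ?thesis unfolding e1 by (intro Reals_add Reals_mult sum_in_Reals e2 Reals_of_real e3) auto
qed

lemma trig_eq_comb:
  assumes \<sigma>: "\<forall>k<n. cmod (\<sigma> k) = 1" and z: "cmod z < 1"
  shows "trig \<sigma> n x z = (\<Prod>j<n. omega (\<sigma> j) z) * comb \<sigma> n x z"
proof -
  have "kappa (\<sigma> k) z * (\<Prod>j\<in>{..<n} - {k}. omega (\<sigma> j) z) = (\<Prod>j<n. omega (\<sigma> j) z) * (\<i> * herglotz (\<sigma> k) z)" if k: "k < n" for k
  proof -
    have "\<sigma> k - z \<noteq> 0" using circle_neq_disk \<sigma> k z by blast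
    then have "kappa (\<sigma> k) z = omega (\<sigma> k) z * (\<i> * herglotz (\<sigma> k) z)"
      by (simp add: kappa_def omega_def herglotz_def power2_eq_square)
    then show ?thesis unfolding prod_lessThan_remove[OF k, of "\<lambda>j. omega (\<sigma> j) z"] by simp
  qed
  then have "(\<Sum>k<n. of_real (x k) * (kappa (\<sigma> k) z * (\<Prod>j\<in>{..<n} - {k}. omega (\<sigma> j) z))) =
     (\<Sum>k<n. of_real (x k) * ((\<Prod>j<n. omega (\<sigma> j) z) * (\<i> * herglotz (\<sigma> k) z)))"
    by (intro sum.cong) auto
  then show ?thesis unfolding trig_def comb_def by (simp add: distrib_left sum_distrib_left mult_ac)
qed

lemma tendsto_comb_pole:
  assumes "\<forall>k<n. cmod (\<sigma> k) = 1" "inj_on \<sigma> {..<n}" "k < n"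
  shows "((\<lambda>z. (1 - cnj (\<sigma> k) * z) * comb \<sigma> n x z) \<longlongrightarrow> 2 * (\<i> * of_real (x k))) (at (\<sigma> k))"
  unfolding comb_def by (rule tendsto_herglotz_sum_pole[OF assms])

text \<open>An unknown \<open>(b, j)\<close> stands for \<open>x j\<close> or \<open>y j\<close>, 2
  n + 2 in all. An equation \<open>Some (re, k)\<close> is the real or imaginary part of equation
  \<open>k\<close>, and \<open>None\<close> is the single real one, 2 n + 1 in all. The last
  equation omits \<open>y n\<close>, since the constant term of \<open>comb\<close> has no
  pole.\<close>

lemma complex_system_nontrivial:
  fixes u v :: "nat \<Rightarrow> nat \<Rightarrow> complex" and q :: "nat \<Rightarrow> real"
  obtains x y :: "nat \<Rightarrow> real" where "\<exists>j\<le>n. x j \<noteq> 0 \<or> y j \<noteq> 0"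
    "\<And>k. k < n \<Longrightarrow> (\<Sum>j\<le>n. of_real (x j) * u k j) + (\<Sum>j\<le>n. of_real (y j) * v k j) = 0"
    "(\<Sum>j<n. q j * y j) = 0"
proof -
  define I :: "(bool \<times> nat) option set" where "I = insert None (Some ` (UNIV \<times> {..<n}))"
  define J :: "(bool \<times> nat) set" where "J = UNIV \<times> {..n}"
  define e where "e = (\<lambda>k (b, j). if b then u k j else v k j)"
  define c where "c = (\<lambda>i l. case i of None \<Rightarrow> (case l of (b, j) \<Rightarrow> if b \<or> j = n then 0 else q j)
      | Some (re, k) \<Rightarrow> (if re then Re (e k l) else Im (e k l)))"
  have fin: "finite I" "finite J" by (auto simp: I_def J_def)
  have "card I = Suc (2 * n)"
    unfolding I_def by (subst card_insert_disjoint) (auto simp: card_image card_cartesian_product)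
  moreover have "card J = 2 * Suc n" by (simp add: J_def card_cartesian_product)
  ultimately have "card I < card J" by simp
  from homogeneous_system_nontrivial[OF fin this, of c]
  obtain s where s: "\<exists>l\<in>J. s l \<noteq> 0" and eq: "\<And>i. i \<in> I \<Longrightarrow> (\<Sum>l\<in>J. c i l * s l) = 0" by blast
  define x where "x = (\<lambda>j. s (True, j))"
  define y where "y = (\<lambda>j. s (False, j))"
  have sumJ: "(\<Sum>l\<in>J. g l) = (\<Sum>j\<le>n. g (True, j)) + (\<Sum>j\<le>n. g (False, j))" for g :: "bool \<times> nat \<Rightarrow> real"
  proof -
    have "J = Pair True ` {..n} \<union> Pair False ` {..n}"
      unfolding J_def by (auto simp: image_iff)
    then show ?thesis by (simp add: sum.union_disjoint sum.reindex inj_on_def image_iff disjoint_iff)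
  qed
  have 1: "\<exists>j\<le>n. x j \<noteq> 0 \<or> y j \<noteq> 0"
    using s unfolding J_def x_def y_def by (metis (full_types) SigmaE atMost_iff)
  have 2: "(\<Sum>j\<le>n. of_real (x j) * u k j) + (\<Sum>j\<le>n. of_real (y j) * v k j) = 0" if k: "k < n" for k
  proof (rule complex_eqI)
    have "Some (True, k) \<in> I" "Some (False, k) \<in> I" using k by (auto simp: I_def)
    note eq[OF this(1)] eq[OF this(2)]
    then show "Re ((\<Sum>j\<le>n. of_real (x j) * u k j) + (\<Sum>j\<le>n. of_real (y j) * v k j)) = Re 0"
      "Im ((\<Sum>j\<le>n. of_real (x j) * u k j) + (\<Sum>j\<le>n. of_real (y j) * v k j)) = Im 0"
      unfolding sumJ by (simp_all add: c_def e_def x_def y_def mult.commute)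
  qed
  have "None \<in> I" by (simp add: I_def)
  from eq[OF this] have "(\<Sum>j\<le>n. (if j = n then 0 else q j) * y j) = 0"
    unfolding sumJ by (simp add: c_def y_def)
  then have 3: "(\<Sum>j<n. q j * y j) = 0" by (simp add: lessThan_Suc_atMost[symmetric])
  show thesis by (rule that[OF 1 2 3])
qed

section \<open>Perturbation of admissible functions\<close>

lemma admissible_limit_0:
  assumes "admissible \<tau> \<sigma> n p a" "\<forall>k<n. cmod (\<sigma> k) = 1" "k < n"
  shows "angular_limit p (\<sigma> k) 0"
proof -
  have s: "cmod (\<sigma> k) = 1" using assms by simp
  have "((\<lambda>z. 1 - cnj (\<sigma> k) * z) \<longlongrightarrow> 1 - cnj (\<sigma> k) * \<sigma> k) (at (\<sigma> k))" by (intro tendsto_intros)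
  then have "angular_limit (\<lambda>z. p z / (1 - cnj (\<sigma> k) * z) * (1 - cnj (\<sigma> k) * z)) (\<sigma> k) (of_real (a k) * (1 - cnj (\<sigma> k) * \<sigma> k))"
    using assms by (intro angular_limit_mult[OF _ angular_limit_of_tendsto]) (auto simp: admissible_def)
  moreover have "of_real (a k) * (1 - cnj (\<sigma> k) * \<sigma> k) = 0" using circle_cnj[OF s] by (simp add: mult.commute)
  ultimately have "angular_limit (\<lambda>z. p z / (1 - cnj (\<sigma> k) * z) * (1 - cnj (\<sigma> k) * z)) (\<sigma> k) 0" by (simp only:)
  then show ?thesis by (rule angular_limit_transform) (use disk_cnj_neq[of "\<sigma> k"] s in simp)
qed

text \<open>If \<open>\<nu>\<close> is the Herglotz measure of \<open>p\<close>, then \<open>f\<close> is the Herglotz transform of \<open>u \<nu>\<close> for the bounded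
  weight \<open>u = trig x / E\<close>. There are \<open>2 n + 2\<close> real parameters \<open>x\<close>, \<open>y\<close>; the \<open>2 n + 1\<close> real equations
  remove the poles at \<open>\<sigma>\<^sub>k / 2\<close> and keep \<open>\<Sum>\<^sub>k \<bar>\<lambda>\<^sub>k\<bar>\<close> fixed.\<close>
lemma exists_perturbation:
  assumes \<sigma>: "\<forall>k<n. cmod (\<sigma> k) = 1" and inj: "inj_on \<sigma> {..<n}" and ad: "admissible \<tau> \<sigma> n p a"
  obtains x y f d M where "\<exists>j\<le>n. x j \<noteq> 0 \<or> y j \<noteq> 0" "f holomorphic_on ball 0 1"
    "\<And>z. cmod z < 1 \<Longrightarrow> \<bar>Re (f z)\<bar> \<le> M * Re (p z)"
    "\<And>k. k < n \<Longrightarrow> angular_limit (\<lambda>z. f z / (1 - cnj (\<sigma> k) * z)) (\<sigma> k) (of_real (d k))"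
    "(\<Sum>k<n. d k * (cmod (\<tau> - \<sigma> k))\<^sup>2) = 0"
    "\<And>z. cmod z < 1 \<Longrightarrow> f z = 0 \<Longrightarrow> comb \<sigma> n x z * p z + \<i> * comb \<sigma> n y z = 0"
proof -
  have holp: "p holomorphic_on ball 0 1" and p: "\<And>z. cmod z < 1 \<Longrightarrow> Re (p z) > 0"
    using ad by (auto simp: admissible_def)
  define w where "w = (\<lambda>k. \<sigma> k / 2)"
  have w1: "cmod (w k) < 1" if "k < n" for k using \<sigma> that by (simp add: w_def norm_divide)
  have injw: "inj_on w {..<n}" using inj by (auto simp: w_def inj_on_def)
  \<comment> \<open>The factors of the weight that belong to the other points. The value at
    \<open>\<sigma> k\<close> is real, so the change \<open>d k\<close> of \<open>a k\<close> is
    real without a further equation.\<close>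
  define \<Theta> where "\<Theta> = (\<lambda>k z. \<Prod>j\<in>{..<n} - {k}. omega (\<sigma> j) z / (\<sigma> j - 2 * z))"
  have \<Theta>real: "\<Theta> k (\<sigma> k) = of_real (Re (\<Theta> k (\<sigma> k)))" if "k < n" for k
  proof -
    have "\<Theta> k (\<sigma> k) \<in> \<real>" unfolding \<Theta>_def by (intro prod_in_Reals omega_real) (use \<sigma> that in auto)
    then show ?thesis by simp
  qed
  \<comment> \<open>Chosen such that
    \<open>q k * y k = d k * (cmod (\<tau> - \<sigma> k))\<^sup>2\<close> for the \<open>d\<close>
    computed below.\<close>
  define q where "q = (\<lambda>k. 2 * Re (\<Theta> k (\<sigma> k)) * (cmod (\<tau> - \<sigma> k))\<^sup>2)"
  define bas where "bas = (\<lambda>j z. if j = n then 1 else \<i> * herglotz (\<sigma> j) z)"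
  have comb_bas: "comb \<sigma> n x z = (\<Sum>j\<le>n. of_real (x j) * bas j z)" for x z
    unfolding comb_def lessThan_Suc_atMost[symmetric] by (simp add: bas_def mult_ac add.commute)
  obtain x y :: "nat \<Rightarrow> real" where xy: "\<exists>j\<le>n. x j \<noteq> 0 \<or> y j \<noteq> 0"
    and sys: "\<And>k. k < n \<Longrightarrow> (\<Sum>j\<le>n. of_real (x j) * (bas j (w k) * p (w k))) + (\<Sum>j\<le>n. of_real (y j) * (\<i> * bas j (w k))) = 0"
    and sumq: "(\<Sum>j<n. q j * y j) = 0"
    using complex_system_nontrivial[of n "\<lambda>k j. bas j (w k) * p (w k)" "\<lambda>k j. \<i> * bas j (w k)" q] by blast
  define A where "A = trig \<sigma> n x"
  define B where "B = (\<lambda>z. \<i> * trig \<sigma> n y z)"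
  define E where "E = (\<lambda>z. \<Prod>k<n. \<sigma> k - 2 * z)"
  define W where "W = (\<lambda>z. \<Prod>j<n. omega (\<sigma> j) z)"
  \<comment> \<open>The numerator without \<open>W\<close>. A zero of \<open>h\<close> at
    \<open>w k\<close>, which is a linear condition on \<open>x\<close> and \<open>y\<close>,
    cancels the pole of \<open>W * h / E\<close> there.\<close>
  define h where "h = (\<lambda>z. comb \<sigma> n x z * p z + \<i> * comb \<sigma> n y z)"
  have holA: "A holomorphic_on ball 0 2" unfolding A_def by (rule holomorphic_trig[OF \<sigma>])
  have holB: "B holomorphic_on ball 0 2" unfolding B_def by (intro holomorphic_intros holomorphic_trig \<sigma>)
  have AB: "A z * p z + B z = W z * h z" if "cmod z < 1" for z
    unfolding A_def B_def W_def h_def trig_eq_comb[OF \<sigma> that] by (simp add: algebra_simps)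
  have W0: "W z \<noteq> 0" if z: "cmod z < 1" for z
    unfolding W_def omega_def using \<sigma> z circle_neq_disk two_circle_neq[of _ z] by (auto simp: prod_zero_iff)
  have hAB: "(\<lambda>z. A z * p z + B z) holomorphic_on ball 0 1"
    by (intro holomorphic_intros holp holomorphic_on_subset[OF holA] holomorphic_on_subset[OF holB]) auto
  have AB0: "A (w k) * p (w k) + B (w k) = 0" if k: "k < n" for k
  proof -
    have "h (w k) = 0" using sys[OF k] by (simp add: h_def comb_bas sum_distrib_right sum_distrib_left mult_ac)
    then show ?thesis using AB[OF w1[OF k]] by simp
  qed
  have "w ` {..<n} \<subseteq> ball 0 1" using w1 by auto
  then obtain g where g: "g holomorphic_on ball 0 1" "\<And>z. z \<in> ball 0 1 \<Longrightarrow> A z * p z + B z = (\<Prod>k<n. w k - z) * g z"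
    using holomorphic_factor_zeros[OF open_ball hAB injw] AB0 by blast
  define f where "f = (\<lambda>z. g z / 2 ^ n)"
  have holf: "f holomorphic_on ball 0 1" unfolding f_def by (intro holomorphic_intros g) auto
  have Ef: "E z * f z = A z * p z + B z" if "cmod z < 1" for z
  proof -
    have "E z = (\<Prod>k<n. 2 * (w k - z))" unfolding E_def w_def by (intro prod.cong) auto
    then have "E z = 2 ^ n * (\<Prod>k<n. w k - z)" by (simp only: prod.distrib prod_constant card_lessThan)
    then show ?thesis using g(2)[of z] that by (simp add: f_def)
  qed
  have E0: "E z \<noteq> 0" if "cmod z = 1" for z
    unfolding E_def using two_circle_neq'[OF _ that] \<sigma> by (auto simp: prod_zero_iff)
  obtain M where M: "\<And>z. cmod z = 1 \<Longrightarrow> cmod (A z / E z) \<le> M"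
  proof -
    have "continuous_on (sphere 0 1) (\<lambda>z. A z / E z)"
      unfolding E_def using E0
      by (intro continuous_intros holomorphic_on_imp_continuous_on holomorphic_on_subset[OF holA]) (auto simp: E_def)
    then have "compact ((\<lambda>z. A z / E z) ` sphere 0 1)" by (rule compact_continuous_image) (rule compact_sphere)
    then have "bounded ((\<lambda>z. A z / E z) ` sphere 0 1)" by (rule compact_imp_bounded)
    then obtain c where "\<forall>x\<in>sphere 0 1. cmod (A x / E x) \<le> c" by (auto simp: bounded_iff)
    then show thesis by (intro that[of c]) auto
  qed
  have bound: "\<bar>Re (f z)\<bar> \<le> M * Re (p z)" if "cmod z < 1" for z
  proof (rule Re_bound_of_boundary[OF \<sigma> inj holp _ holA holB _ _ holf _ that])
    fix z :: complex assume z: "cmod z = 1"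
    show "A z / (\<Prod>k<n. \<sigma> k - 2 * z) \<in> \<real> \<and> \<bar>Re (A z / (\<Prod>k<n. \<sigma> k - 2 * z))\<bar> \<le> M"
      using trig_real[OF \<sigma> z, of x] M[OF z] abs_Re_le_cmod[of "A z / E z"] by (simp add: A_def E_def)
    have "trig \<sigma> n y z / E z \<in> \<real>" using trig_real[OF \<sigma> z] by (simp add: E_def)
    then have "Im (trig \<sigma> n y z / E z) = 0" by (simp only: complex_is_Real_iff)
    then have "Re (\<i> * (trig \<sigma> n y z / E z)) = 0" by (simp only: Re_i_times neg_0_equal_iff_equal)
    then show "Re (B z / (\<Prod>k<n. \<sigma> k - 2 * z)) = 0" by (simp add: B_def E_def)
  qed (use p Ef in \<open>auto simp: E_def less_imp_le\<close>)
  \<comment> \<open>Only \<open>y\<close> enters: in the limit at \<open>\<sigma> k\<close> the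
    contribution of \<open>x\<close> is multiplied by \<open>p\<close>, which tends to 0
    there.\<close>
  define d where "d = (\<lambda>k. 2 * Re (\<Theta> k (\<sigma> k)) * y k)"
  have lim: "angular_limit (\<lambda>z. f z / (1 - cnj (\<sigma> k) * z)) (\<sigma> k) (of_real (d k))" if k: "k < n" for k
  proof -
    have s: "cmod (\<sigma> k) = 1" using \<sigma> k by simp
    have s0: "\<sigma> k \<noteq> 0" using s by auto
    let ?Z = "\<lambda>z. 1 - cnj (\<sigma> k) * z"
    \<comment> \<open>\<open>?c\<close> is \<open>W / E\<close> with the double zero
      \<open>(?Z z)\<^sup>2\<close> divided out; one factor \<open>?Z z\<close> absorbs the pole of
      \<open>comb\<close>, the other the denominator of \<open>f z / ?Z z\<close>.\<close>
    let ?c = "\<lambda>z. \<Theta> k z * ((\<sigma> k)\<^sup>2 / ((2 * \<sigma> k - z) * (\<sigma> k - 2 * z)))"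
    have "(\<Theta> k \<longlongrightarrow> \<Theta> k (\<sigma> k)) (at (\<sigma> k))"
      unfolding \<Theta>_def omega_def using two_circle_neq[of _ "\<sigma> k"] two_circle_neq'[OF _ s] \<sigma> s
      by (intro tendsto_intros) auto
    then have "(?c \<longlongrightarrow> \<Theta> k (\<sigma> k) * ((\<sigma> k)\<^sup>2 / ((2 * \<sigma> k - \<sigma> k) * (\<sigma> k - 2 * \<sigma> k)))) (at (\<sigma> k))"
      using s0 by (intro tendsto_intros) auto
    moreover have "\<Theta> k (\<sigma> k) * ((\<sigma> k)\<^sup>2 / ((2 * \<sigma> k - \<sigma> k) * (\<sigma> k - 2 * \<sigma> k))) = - \<Theta> k (\<sigma> k)"
      using s0 by (simp add: power2_eq_square)
    ultimately have cl: "(?c \<longlongrightarrow> - \<Theta> k (\<sigma> k)) (at (\<sigma> k))" by simp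
    have "angular_limit (\<lambda>z. ?c z * ((?Z z * comb \<sigma> n x z) * p z + \<i> * (?Z z * comb \<sigma> n y z))) (\<sigma> k)
        (- \<Theta> k (\<sigma> k) * ((2 * (\<i> * of_real (x k))) * 0 + \<i> * (2 * (\<i> * of_real (y k)))))"
      by (rule angular_limit_mult[OF angular_limit_of_tendsto[OF cl] angular_limit_add[OF
            angular_limit_mult[OF angular_limit_of_tendsto[OF tendsto_comb_pole[OF \<sigma> inj k]] admissible_limit_0[OF ad \<sigma> k]]
            angular_limit_mult[OF angular_limit_of_tendsto[OF tendsto_const] angular_limit_of_tendsto[OF tendsto_comb_pole[OF \<sigma> inj k]]]]])
    moreover have "- \<Theta> k (\<sigma> k) * ((2 * (\<i> * of_real (x k))) * 0 + \<i> * (2 * (\<i> * of_real (y k)))) = of_real (d k)"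
    proof -
      have alg: "- T * (X * 0 + \<i> * (2 * (\<i> * Y))) = 2 * T * Y" for T X Y :: complex
        by (simp add: complex_eq_iff)
      show ?thesis unfolding alg d_def of_real_mult of_real_numeral \<Theta>real[OF k, symmetric] ..
    qed
    ultimately have L: "angular_limit (\<lambda>z. ?c z * ((?Z z * comb \<sigma> n x z) * p z + \<i> * (?Z z * comb \<sigma> n y z))) (\<sigma> k) (of_real (d k))"
      by (simp only:)
    have ne: "((\<lambda>z. \<Prod>j<n. \<sigma> j - 2 * z) \<longlongrightarrow> (\<Prod>j<n. \<sigma> j - 2 * \<sigma> k)) (at (\<sigma> k))" by (intro tendsto_intros)
    have "\<forall>\<^sub>F z in at (\<sigma> k). E z \<noteq> 0"
      unfolding E_def by (rule tendsto_imp_eventually_ne[OF ne]) (use E0[OF s] in \<open>simp add: E_def\<close>)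
    then have "\<forall>\<^sub>F z in at (\<sigma> k). cmod z < 1 \<longrightarrow>
       ?c z * ((?Z z * comb \<sigma> n x z) * p z + \<i> * (?Z z * comb \<sigma> n y z)) = f z / (1 - cnj (\<sigma> k) * z)"
    proof eventually_elim
      case (elim z)
      show ?case
      proof
        assume z: "cmod z < 1"
        have Z0: "?Z z \<noteq> 0" using disk_cnj_neq[of "\<sigma> k" z] s z by simp
        have sz: "\<sigma> k - z \<noteq> 0" by (rule circle_neq_disk[OF s z])
        have Wk: "W z = omega (\<sigma> k) z * (\<Prod>j\<in>{..<n} - {k}. omega (\<sigma> j) z)"
          unfolding W_def by (rule prod_lessThan_remove[OF k])
        have Ek: "E z = (\<sigma> k - 2 * z) * (\<Prod>j\<in>{..<n} - {k}. \<sigma> j - 2 * z)"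
          unfolding E_def by (rule prod_lessThan_remove[OF k])
        have "(cnj (\<sigma> k))\<^sup>2 * (\<sigma> k)\<^sup>2 = 1" using circle_cnj[OF s] by (simp add: power_mult_distrib[symmetric] mult.commute)
        then have "(\<sigma> k)\<^sup>2 * (?Z z)\<^sup>2 = (\<sigma> k - z)\<^sup>2"
          unfolding one_minus_cnj_circle[OF s] power_mult_distrib by (simp add: mult.assoc[symmetric] mult.commute)
        then have om: "omega (\<sigma> k) z = (\<sigma> k)\<^sup>2 / (2 * \<sigma> k - z) * (?Z z)\<^sup>2"
          by (simp add: omega_def)
        have c: "?c z * (?Z z)\<^sup>2 = W z / E z"
          unfolding Wk Ek om \<Theta>_def prod_dividef
          by (simp only: times_divide_eq_left times_divide_eq_right divide_divide_eq_left divide_divide_eq_right mult_ac)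
        have "f z = W z * h z / E z" using Ef[OF z] AB[OF z] elim by (simp add: field_simps)
        also have "\<dots> = ?c z * (?Z z)\<^sup>2 * h z" unfolding c by simp
        finally have "f z / ?Z z = ?c z * (?Z z * h z)" using Z0 by (simp add: power2_eq_square)
        then show "?c z * ((?Z z * comb \<sigma> n x z) * p z + \<i> * (?Z z * comb \<sigma> n y z)) = f z / ?Z z"
          by (simp add: h_def algebra_simps)
      qed
    qed
    then show ?thesis by (rule angular_limit_transform_eventually[OF L])
  qed
  have "(\<Sum>k<n. d k * (cmod (\<tau> - \<sigma> k))\<^sup>2) = 0"
    using sumq by (simp add: d_def q_def mult_ac)
  moreover have "comb \<sigma> n x z * p z + \<i> * comb \<sigma> n y z = 0" if z: "cmod z < 1" "f z = 0" for z
    using Ef[OF z(1)] AB[OF z(1)] W0[OF z(1)] z(2) by (simp add: h_def)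
  ultimately show thesis using xy holf bound lim by (intro that[of x y f M d]) auto
qed

lemma admissible_perturb:
  assumes ad: "admissible \<tau> \<sigma> n p a" and holf: "f holomorphic_on ball 0 1"
    and f: "\<And>z. cmod z < 1 \<Longrightarrow> \<bar>Re (f z)\<bar> \<le> M * Re (p z)"
    and lim: "\<And>k. k < n \<Longrightarrow> angular_limit (\<lambda>z. f z / (1 - cnj (\<sigma> k) * z)) (\<sigma> k) (of_real (d k))"
    and sum: "(\<Sum>k<n. d k * (cmod (\<tau> - \<sigma> k))\<^sup>2) = 0"
    and eM: "\<bar>e\<bar> * M < 1" and ed: "\<And>k. k < n \<Longrightarrow> \<bar>e * d k\<bar> < a k"
  shows "admissible \<tau> \<sigma> n (\<lambda>z. p z + of_real e * f z) (\<lambda>k. a k + e * d k)"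
  unfolding admissible_def
proof (intro conjI allI impI)
  show "(\<lambda>z. p z + of_real e * f z) holomorphic_on ball 0 1"
    using ad by (intro holomorphic_intros holf) (auto simp: admissible_def)
  fix z :: complex assume z: "cmod z < 1"
  have p: "Re (p z) > 0" using ad z by (simp add: admissible_def)
  have "\<bar>e * Re (f z)\<bar> \<le> \<bar>e\<bar> * (M * Re (p z))" unfolding abs_mult by (intro mult_left_mono f z) auto
  also have "\<dots> = (\<bar>e\<bar> * M) * Re (p z)" by simp
  also have "\<dots> < 1 * Re (p z)" using eM p by (intro mult_strict_right_mono)
  finally show "Re (p z + of_real e * f z) > 0" by simp
next
  fix k assume k: "k < n"
  show "a k + e * d k > 0" using ed[OF k] by linarith
  have "angular_limit (\<lambda>z. p z / (1 - cnj (\<sigma> k) * z) + of_real e * (f z / (1 - cnj (\<sigma> k) * z))) (\<sigma> k)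
      (of_real (a k) + of_real e * of_real (d k))"
    using ad k lim[OF k] by (intro angular_limit_add angular_limit_mult angular_limit_of_tendsto[OF tendsto_const]) (auto simp: admissible_def)
  then show "angular_limit (\<lambda>z. (p z + of_real e * f z) / (1 - cnj (\<sigma> k) * z)) (\<sigma> k) (of_real (a k + e * d k))"
    by (simp add: add_divide_distrib)
next
  have "(\<Sum>k<n. (a k + e * d k) * (cmod (\<tau> - \<sigma> k))\<^sup>2) =
      (\<Sum>k<n. a k * (cmod (\<tau> - \<sigma> k))\<^sup>2) + e * (\<Sum>k<n. d k * (cmod (\<tau> - \<sigma> k))\<^sup>2)"
    by (simp add: sum_distrib_left sum.distrib[symmetric] algebra_simps)
  then show "(\<Sum>k<n. (a k + e * d k) * (cmod (\<tau> - \<sigma> k))\<^sup>2) \<le> 1" using ad sum by (simp add: admissible_def)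
qed

lemma admissible_scale:
  assumes ad: "admissible \<tau> \<sigma> n p a" and c: "c > 0" "c * (\<Sum>k<n. a k * (cmod (\<tau> - \<sigma> k))\<^sup>2) \<le> 1"
  shows "admissible \<tau> \<sigma> n (\<lambda>z. of_real c * p z) (\<lambda>k. c * a k)"
  unfolding admissible_def
proof (intro conjI allI impI)
  show "(\<lambda>z. of_real c * p z) holomorphic_on ball 0 1"
    using ad by (intro holomorphic_intros) (auto simp: admissible_def)
  fix z :: complex assume z: "cmod z < 1"
  show "Re (of_real c * p z) > 0" using ad z c by (simp add: admissible_def)
next
  fix k assume k: "k < n"
  show "c * a k > 0" using ad k c by (simp add: admissible_def)
  have "angular_limit (\<lambda>z. of_real c * (p z / (1 - cnj (\<sigma> k) * z))) (\<sigma> k) (of_real c * of_real (a k))"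
    using ad k by (intro angular_limit_mult angular_limit_of_tendsto[OF tendsto_const]) (auto simp: admissible_def)
  then show "angular_limit (\<lambda>z. of_real c * p z / (1 - cnj (\<sigma> k) * z)) (\<sigma> k) (of_real (c * a k))" by simp
next
  show "(\<Sum>k<n. c * a k * (cmod (\<tau> - \<sigma> k))\<^sup>2) \<le> 1" using c(2) by (simp add: sum_distrib_left mult.assoc)
qed

lemma GenF_0_scale:
  assumes G: "G \<in> GenF \<tau> \<sigma> 0" and c: "c > 0"
  shows "(\<lambda>z. of_real c * G z) \<in> GenF \<tau> \<sigma> 0"
proof (cases "\<forall>z\<in>ball 0 1. G z = 0")
  case True
  then show ?thesis using G by (auto simp: GenF_def intro!: holomorphic_intros)
next
  case False
  with G obtain \<phi> where hs: "holo_semigroup \<phi>" and gen: "generates G \<phi>" and dw: "dw_point \<phi> \<tau>"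
    unfolding GenF_def by blast
  have holG: "(\<lambda>z. of_real c * G z) holomorphic_on ball 0 1"
    using gen by (auto simp: generates_def intro!: holomorphic_intros)
  define \<psi> where "\<psi> = (\<lambda>t. \<phi> (c * t))"
  have dpsi: "((\<lambda>s. \<psi> s z) has_vector_derivative of_real c * G (\<psi> t z)) (at t within {0..})"
    if z: "cmod z < 1" and t: "t \<ge> 0" for z t
  proof -
    have 1: "((\<lambda>s. c * s) has_vector_derivative c) (at t within {0..})"
      by (auto intro!: derivative_eq_intros simp: has_real_derivative_iff_has_vector_derivative[symmetric])
    have "((\<lambda>s. \<phi> s z) has_vector_derivative G (\<phi> (c * t) z)) (at (c * t) within {0..})"
      using gen z t c by (simp add: generates_def)
    then have "((\<lambda>s. \<phi> s z) has_vector_derivative G (\<phi> (c * t) z)) (at (c * t) within (*) c ` {0..})"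
      by (rule has_vector_derivative_within_subset) (use c in auto)
    from vector_diff_chain_within[OF 1 this] show ?thesis
      by (simp add: o_def \<psi>_def scaleR_conv_of_real)
  qed
  have "holo_semigroup \<psi>"
    unfolding holo_semigroup_def
  proof (intro conjI allI ballI impI)
    fix t :: real assume "t \<ge> 0"
    then have "c * t \<ge> 0" using c by simp
    then show "\<psi> t holomorphic_on ball 0 1" "\<psi> t ` ball 0 1 \<subseteq> ball 0 1"
      unfolding \<psi>_def using hs by (auto simp: holo_semigroup_def)
  next
    fix z :: complex assume z: "z \<in> ball 0 1"
    then show 0: "\<psi> 0 z = z" using hs by (simp add: \<psi>_def holo_semigroup_def)
    show "((\<lambda>t. \<psi> t z) \<longlongrightarrow> z) (at_right 0)"
      by (rule semigroup_continuous_at_0[of \<psi>, OF 0 dpsi]) (use z in auto)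
  next
    fix s t :: real and z :: complex assume "s \<ge> 0" "t \<ge> 0" "z \<in> ball 0 1"
    then show "\<psi> s (\<psi> t z) = \<psi> (s + t) z"
      using hs c by (simp add: \<psi>_def holo_semigroup_def distrib_left)
  qed
  moreover have "generates (\<lambda>z. of_real c * G z) \<psi>"
    using holG dpsi by (simp add: generates_def)
  moreover have "dw_point \<psi> \<tau>"
  proof (cases "cmod \<tau> < 1")
    case True
    then have 1: "\<forall>t\<ge>0. \<phi> t \<tau> = \<tau>" and "\<exists>t\<ge>0. \<exists>z\<in>ball 0 1. \<phi> t z \<noteq> z" using dw by (auto simp: dw_point_def)
    then obtain t z where t: "t \<ge> 0" "z \<in> ball 0 1" "\<phi> t z \<noteq> z" by blast
    have "\<psi> (t / c) z \<noteq> z" using t c by (simp add: \<psi>_def)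
    moreover have "t / c \<ge> 0" using t c by simp
    ultimately have "\<exists>t\<ge>0. \<exists>z\<in>ball 0 1. \<psi> t z \<noteq> z" using t(2) by blast
    moreover have "\<forall>t\<ge>0. \<psi> t \<tau> = \<tau>" using 1 c by (simp add: \<psi>_def)
    ultimately show ?thesis using True by (simp add: dw_point_def)
  next
    case False
    then have "cmod \<tau> = 1" "\<forall>z\<in>ball 0 1. ((\<lambda>t. \<phi> t z) \<longlongrightarrow> \<tau>) at_top" using dw by (auto simp: dw_point_def)
    moreover have "filterlim (\<lambda>t. c * t) at_top at_top"
      using c by (intro filterlim_tendsto_pos_mult_at_top[OF tendsto_const _ filterlim_ident])
    ultimately show ?thesis
      by (auto simp: dw_point_def \<psi>_def intro: filterlim_compose[of "\<lambda>t. \<phi> t _"])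
  qed
  ultimately show ?thesis unfolding GenF_def using holG by fastforce
qed

lemma extreme_point_midpoint:
  assumes ex: "extreme_point_Hol K G" and K: "G1 \<in> K" "G2 \<in> K"
    and G: "\<And>z. cmod z < 1 \<Longrightarrow> G z = of_real (1 / 2) * G1 z + of_real (1 - 1 / 2) * G2 z"
  shows "\<forall>z\<in>ball 0 1. G1 z = G2 z"
proof -
  have "0 < (1 / 2 :: real) \<and> 1 / 2 < (1 :: real) \<and>
      (\<forall>z\<in>ball 0 1. G z = of_real (1 / 2) * G1 z + of_real (1 - 1 / 2) * G2 z)"
    using G by auto
  then show ?thesis using ex K unfolding extreme_point_Hol_def by blast
qed

lemma not_extreme_of_scale:
  assumes ex: "extreme_point_Hol K G" and G0: "\<not> (\<forall>z\<in>ball 0 1. G z = 0)" and e: "0 < e" "e < 1"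
    and "(\<lambda>z. of_real (1 + e) * G z) \<in> K" "(\<lambda>z. of_real (1 - e) * G z) \<in> K"
  shows False
proof -
  have "G z = of_real (1 / 2) * (of_real (1 + e) * G z) + of_real (1 - 1 / 2) * (of_real (1 - e) * G z)" for z
    by (simp add: algebra_simps)
  then have "\<forall>z\<in>ball 0 1. of_real (1 + e) * G z = of_real (1 - e) * G z"
    using extreme_point_midpoint[OF ex assms(5,6)] by blast
  then have "\<forall>z\<in>ball 0 1. of_real (2 * e) * G z = 0" by (simp add: algebra_simps)
  then show False using G0 e by simp
qed

theorem formula_of_extreme_point:
  assumes \<sigma>: "\<forall>k<n. cmod (\<sigma> k) = 1" and inj: "inj_on \<sigma> {..<n}" and \<tau>: "cmod \<tau> \<le> 1"
    and \<tau>\<sigma>: "\<tau> \<notin> \<sigma> ` {..<n}" and G0: "\<not> (\<forall>z\<in>ball 0 1. G z = 0)"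
    and ex: "extreme_point_Hol (GenF \<tau> \<sigma> n) G"
  shows "\<exists>b lam. (\<forall>k<n. lam k < 0) \<and> (\<Sum>k<n. \<bar>lam k\<bar>) = 1 \<and>
    (\<forall>z\<in>ball 0 1. G z = (\<tau> - z) * (1 - cnj \<tau> * z) / (\<i> * of_real b + p0 \<tau> \<sigma> lam n z))"
proof -
  have GK: "G \<in> GenF \<tau> \<sigma> n" using ex by (simp add: extreme_point_Hol_def)
  have n: "n > 0"
  proof (rule ccontr)
    \<comment> \<open>For \<open>n = 0\<close> the class is a cone, in which no nonzero element is
      extreme.\<close>
    assume "\<not> n > 0"
    then have "n = 0" by simp
    then show False
      using not_extreme_of_scale[OF ex G0, of "1 / 2"] GenF_0_scale[of G \<tau> \<sigma> "1 + 1 / 2"] GenF_0_scale[of G \<tau> \<sigma> "1 - 1 / 2"] GK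
      by simp
  qed
  obtain p a where ad: "admissible \<tau> \<sigma> n p a" and Gp: "\<And>z. cmod z < 1 \<Longrightarrow> G z = (\<tau> - z) * (1 - cnj \<tau> * z) * p z"
    by (rule admissible_of_GenF[OF \<sigma> \<tau> \<tau>\<sigma> n GK G0]) (assumption | rule that)+
  have pnz: "p z \<noteq> 0" if "cmod z < 1" for z using ad that by (auto simp: admissible_def)
  have nz: "(\<tau> - z) * (1 - cnj \<tau> * z) \<noteq> 0" if "cmod z < 1" "z \<noteq> \<tau>" for z
    using that disk_cnj_neq[OF \<tau> that(1)] by simp
  have ts: "cmod (\<tau> - \<sigma> k) > 0" if "k < n" for k using \<tau>\<sigma> that by auto
  define S where "S = (\<Sum>k<n. a k * (cmod (\<tau> - \<sigma> k))\<^sup>2)"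
  have "S \<le> 1" using ad by (simp add: S_def admissible_def)
  have "S \<ge> 0" unfolding S_def using ad by (intro sum_nonneg) (auto simp: admissible_def less_imp_le)
  have S1: "S = 1"
  proof (rule ccontr)
    assume "S \<noteq> 1"
    then have "S < 1" using \<open>S \<le> 1\<close> by simp
    \<comment> \<open>With this \<open>e\<close>, \<open>(1 + e) * S\<close> is at most
      \<open>S + e = (1 + S) / 2\<close>, which is less than 1.\<close>
    define e where "e = (1 - S) / 2"
    have e: "0 < e" "e < 1" using \<open>S < 1\<close> \<open>S \<ge> 0\<close> by (auto simp: e_def)
    have "(1 + e) * S = S + e * S" by (simp add: algebra_simps)
    also have "e * S \<le> e * 1" using e \<open>S \<le> 1\<close> by (intro mult_left_mono) auto
    also have "S + e * 1 \<le> 1" using \<open>S < 1\<close> by (simp add: e_def field_simps)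
    finally have le1: "(1 + e) * S \<le> 1" by simp
    have le2: "(1 - e) * S \<le> 1" using e \<open>S \<le> 1\<close> \<open>S \<ge> 0\<close> by (intro mult_le_one) auto
    have mem: "(\<lambda>z. of_real c * G z) \<in> GenF \<tau> \<sigma> n" if "c > 0" "c * S \<le> 1" for c
      by (rule GenF_of_admissible[OF \<sigma> \<tau> admissible_scale[OF ad that(1)]])
         (use that(2) Gp in \<open>auto simp: S_def\<close>)
    show False
      by (rule not_extreme_of_scale[OF ex G0 e mem mem]) (use e le1 le2 in auto)
  qed
  obtain x y f d M where xy: "\<exists>j\<le>n. x j \<noteq> 0 \<or> y j \<noteq> 0" and holf: "f holomorphic_on ball 0 1" and
    fM: "\<And>z. cmod z < 1 \<Longrightarrow> \<bar>Re (f z)\<bar> \<le> M * Re (p z)" and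
    fd: "\<And>k. k < n \<Longrightarrow> angular_limit (\<lambda>z. f z / (1 - cnj (\<sigma> k) * z)) (\<sigma> k) (of_real (d k))" and
    sumd: "(\<Sum>k<n. d k * (cmod (\<tau> - \<sigma> k))\<^sup>2) = 0" and
    f0: "\<And>z. cmod z < 1 \<Longrightarrow> f z = 0 \<Longrightarrow> comb \<sigma> n x z * p z + \<i> * comb \<sigma> n y z = 0"
    by (rule exists_perturbation[OF \<sigma> inj ad]) (assumption | rule that)+
  obtain e where e: "e > 0" "e * M < 1" "\<And>k. k < n \<Longrightarrow> e * \<bar>d k\<bar> < a k"
  proof -
    have ev: "\<forall>\<^sub>F e in at_right 0. e * c < b" if "b > 0" for b c :: real
    proof -
      have "((\<lambda>e. e * c) \<longlongrightarrow> 0 * c) (at_right 0)" by (intro tendsto_intros)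
      then show ?thesis using that by (intro order_tendstoD(2)) auto
    qed
    have "\<forall>\<^sub>F e in at_right 0. e > 0 \<and> e * M < 1 \<and> (\<forall>k\<in>{..<n}. e * \<bar>d k\<bar> < a k)"
      by (intro eventually_conj eventually_ball_finite ballI ev eventually_at_right_less)
         (use ad in \<open>auto simp: admissible_def\<close>)
    then obtain e where "e > 0 \<and> e * M < 1 \<and> (\<forall>k\<in>{..<n}. e * \<bar>d k\<bar> < a k)"
      using eventually_happens'[OF trivial_limit_at_right_real] by blast
    then show thesis by (intro that) auto
  qed
  have mem: "(\<lambda>z. (\<tau> - z) * (1 - cnj \<tau> * z) * (p z + of_real s * f z)) \<in> GenF \<tau> \<sigma> n" if "\<bar>s\<bar> = e" for s
    by (rule GenF_of_admissible[OF \<sigma> \<tau> admissible_perturb[OF ad holf fM fd sumd]]) (use e that in \<open>auto simp: abs_mult\<close>)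
  have "\<forall>z\<in>ball 0 1. (\<tau> - z) * (1 - cnj \<tau> * z) * (p z + of_real e * f z) = (\<tau> - z) * (1 - cnj \<tau> * z) * (p z + of_real (- e) * f z)"
  proof (rule extreme_point_midpoint[OF ex mem mem])
    have alg: "c * P = of_real (1 / 2) * (c * (P + of_real e * F)) + of_real (1 - 1 / 2) * (c * (P + of_real (- e) * F))"
      for c P F :: complex by (simp add: field_simps)
    fix z :: complex assume "cmod z < 1"
    then show "G z = of_real (1 / 2) * ((\<tau> - z) * (1 - cnj \<tau> * z) * (p z + of_real e * f z)) +
        of_real (1 - 1 / 2) * ((\<tau> - z) * (1 - cnj \<tau> * z) * (p z + of_real (- e) * f z))"
      unfolding Gp[OF \<open>cmod z < 1\<close>] by (intro alg)
  qed (use e in auto)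
  then have "p z + of_real e * f z = p z + of_real (- e) * f z" if "cmod z < 1" "z \<noteq> \<tau>" for z
    using nz[OF that] that(1) by (metis mem_ball_0 mult_cancel_left)
  then have "f z = 0" if "cmod z < 1" "z \<noteq> \<tau>" for z
    using that e(1) by (auto simp: eq_neg_iff_add_eq_0)
  then have rel: "comb \<sigma> n x z * p z + \<i> * comb \<sigma> n y z = 0" if "cmod z < 1" "z \<noteq> \<tau>" for z
    using f0 that by blast
  have pole: "angular_limit (\<lambda>z. (1 - cnj (\<sigma> k) * z) * comb \<sigma> n x z) (\<sigma> k) (2 * (\<i> * of_real (x k)))" if "k < n" for k x
    by (rule angular_limit_of_tendsto[OF tendsto_comb_pole[OF \<sigma> inj that]])
  \<comment> \<open>Points close to \<open>\<sigma> k\<close> differ from \<tau>, so relations known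
    off \<tau> can be used in the limits at \<open>\<sigma> k\<close>.\<close>
  have near: "\<forall>\<^sub>F z in at (\<sigma> k). cmod z < 1 \<longrightarrow> P z" if k: "k < n" and P: "\<And>z. cmod z < 1 \<Longrightarrow> z \<noteq> \<tau> \<Longrightarrow> P z" for k P
  proof -
    have "\<forall>\<^sub>F z in at (\<sigma> k). z \<in> - {\<tau>} - {\<sigma> k}"
      by (rule eventually_at_in_open) (use ts[OF k] in auto)
    then show ?thesis by eventually_elim (use P in auto)
  qed
  have unique0: "L = 0" if "k < n" "angular_limit (\<lambda>_. 0) (\<sigma> k) L" for k L
    using angular_limit_unique[OF _ that(2) angular_limit_of_tendsto[OF tendsto_const]] \<sigma> that(1) by simp
  \<comment> \<open>Multiplied by \<open>1 - cnj (\<sigma> k) * z\<close>, the relation has the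
    limit \<open>- 2 * y k\<close> at \<open>\<sigma> k\<close>, because \<open>p\<close> tends to 0
    there.\<close>
  have y0: "y k = 0" if k: "k < n" for k
  proof -
    have "angular_limit (\<lambda>z. (1 - cnj (\<sigma> k) * z) * comb \<sigma> n x z * p z + \<i> * ((1 - cnj (\<sigma> k) * z) * comb \<sigma> n y z)) (\<sigma> k)
        (2 * (\<i> * of_real (x k)) * 0 + \<i> * (2 * (\<i> * of_real (y k))))"
      by (rule angular_limit_add[OF angular_limit_mult[OF pole[OF k] admissible_limit_0[OF ad \<sigma> k]]
            angular_limit_mult[OF angular_limit_of_tendsto[OF tendsto_const] pole[OF k]]])
    then have "angular_limit (\<lambda>_. 0) (\<sigma> k) (2 * (\<i> * of_real (x k)) * 0 + \<i> * (2 * (\<i> * of_real (y k))))"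
    proof (rule angular_limit_transform_eventually[OF _ near[OF k]])
      fix z assume "cmod z < 1" "z \<noteq> \<tau>"
      from rel[OF this] have "(1 - cnj (\<sigma> k) * z) * (comb \<sigma> n x z * p z + \<i> * comb \<sigma> n y z) = 0" by simp
      then show "(1 - cnj (\<sigma> k) * z) * comb \<sigma> n x z * p z + \<i> * ((1 - cnj (\<sigma> k) * z) * comb \<sigma> n y z) = 0"
        by (simp only: distrib_left mult_ac)
    qed
    from unique0[OF k this] show ?thesis by simp
  qed
  have comby: "comb \<sigma> n y z = of_real (y n)" for z using y0 by (simp add: comb_def)
  \<comment> \<open>If \<open>y n\<close> were 0 as well, \<open>comb \<sigma> n x\<close> would
    vanish off \<tau>, and comparing its poles would make all parameters zero.\<close>
  have yn: "y n \<noteq> 0"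
  proof
    assume "y n = 0"
    then have c0: "comb \<sigma> n x z = 0" if "cmod z < 1" "z \<noteq> \<tau>" for z
      using rel[OF that] pnz[OF that(1)] by (simp add: comby)
    have x0: "x k = 0" if k: "k < n" for k
    proof -
      have "angular_limit (\<lambda>_. 0) (\<sigma> k) (2 * (\<i> * of_real (x k)))"
        by (rule angular_limit_transform_eventually[OF pole[OF k] near[OF k]]) (use c0 in auto)
      from unique0[OF k this] show ?thesis by simp
    qed
    have "\<exists>z. cmod z < 1 \<and> z \<noteq> \<tau>"
      by (cases "\<tau> = 0") (auto intro: exI[of _ "1/2"] exI[of _ 0])
    then obtain z where z: "cmod z < 1" "z \<noteq> \<tau>" by blast
    have "x n = 0" using c0[OF z] x0 by (simp add: comb_def)
    then have "x j = 0 \<and> y j = 0" if "j \<le> n" for j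
      using that x0 y0 \<open>y n = 0\<close> by (cases "j = n") auto
    then show False using xy by blast
  qed
  define b where "b = x n / y n"
  have px: "p z * (\<i> * comb \<sigma> n x z / of_real (y n)) = 1" if "cmod z < 1" "z \<noteq> \<tau>" for z
  proof -
    have "comb \<sigma> n x z * p z = - \<i> * of_real (y n)"
      using rel[OF that] by (simp add: comby eq_neg_iff_add_eq_0)
    then have "p z * (\<i> * comb \<sigma> n x z / of_real (y n)) = \<i> * (- \<i> * of_real (y n)) / of_real (y n)"
      by (simp add: mult_ac)
    then show ?thesis using yn by simp
  qed
  \<comment> \<open>\<open>p\<close> divided by \<open>1 - cnj (\<sigma> k) * z\<close> tends to
    \<open>a k\<close>, and \<open>1 / p\<close> multiplied by it tends to twice the coefficient of
    the kernel at \<open>\<sigma> k\<close>; the product of the two limits is 1.\<close>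
  have ak: "- (x k / y n) = 1 / (2 * a k)" if k: "k < n" for k
  proof -
    have a0: "a k > 0" using ad k by (simp add: admissible_def)
    have s: "cmod (\<sigma> k) = 1" using \<sigma> k by simp
    have "angular_limit (\<lambda>z. p z / (1 - cnj (\<sigma> k) * z) * ((\<i> / of_real (y n)) * ((1 - cnj (\<sigma> k) * z) * comb \<sigma> n x z))) (\<sigma> k)
        (of_real (a k) * ((\<i> / of_real (y n)) * (2 * (\<i> * of_real (x k)))))"
      by (rule angular_limit_mult[OF _ angular_limit_mult[OF angular_limit_of_tendsto[OF tendsto_const] pole[OF k]]])
         (use ad k in \<open>auto simp: admissible_def\<close>)
    then have "angular_limit (\<lambda>_. 1) (\<sigma> k) (of_real (a k) * ((\<i> / of_real (y n)) * (2 * (\<i> * of_real (x k)))))"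
    proof (rule angular_limit_transform_eventually[OF _ near[OF k]])
      fix z assume z: "cmod z < 1" "z \<noteq> \<tau>"
      have "1 - cnj (\<sigma> k) * z \<noteq> 0" using disk_cnj_neq[of "\<sigma> k" z] s z by simp
      then have "p z / (1 - cnj (\<sigma> k) * z) * ((\<i> / of_real (y n)) * ((1 - cnj (\<sigma> k) * z) * comb \<sigma> n x z)) =
          p z * (\<i> * comb \<sigma> n x z / of_real (y n))" by simp
      then show "p z / (1 - cnj (\<sigma> k) * z) * ((\<i> / of_real (y n)) * ((1 - cnj (\<sigma> k) * z) * comb \<sigma> n x z)) = 1"
        using px[OF z] by simp
    qed
    from angular_limit_unique[OF s this angular_limit_of_tendsto[OF tendsto_const]]
    have "of_real (a k) * ((\<i> / of_real (y n)) * (2 * (\<i> * of_real (x k)))) = (1::complex)" .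
    moreover have "of_real (a k) * ((\<i> / of_real (y n)) * (2 * (\<i> * of_real (x k)))) = complex_of_real (- (2 * a k * x k / y n))"
      using yn by (simp add: field_simps)
    ultimately have "- (2 * a k * x k / y n) = 1" by (simp only: of_real_eq_1_iff)
    then show ?thesis using a0 yn by (simp add: field_simps)
  qed
  define lam where "lam = (\<lambda>k. - (a k * (cmod (\<tau> - \<sigma> k))\<^sup>2))"
  have a0: "a k > 0" if "k < n" for k using ad that by (simp add: admissible_def)
  have lam0: "lam k < 0" if k: "k < n" for k using a0[OF k] ts[OF k] by (simp add: lam_def)
  have "(\<Sum>k<n. \<bar>lam k\<bar>) = S"
    unfolding S_def lam_def using a0 by (intro sum.cong) (auto simp: abs_mult less_imp_le)
  then have suml: "(\<Sum>k<n. \<bar>lam k\<bar>) = 1" using S1 by simp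
  have p0: "p0 \<tau> \<sigma> lam n z = (\<Sum>k<n. of_real (1 / (2 * a k)) * herglotz (\<sigma> k) z)" for z
    unfolding p0_def herglotz_def
  proof (intro sum.cong arg_cong2[of _ _ _ _ "(*)"] refl arg_cong[of _ _ of_real])
    fix k assume "k \<in> {..<n}"
    then show "(cmod (\<tau> - \<sigma> k))\<^sup>2 / (2 * \<bar>lam k\<bar>) = 1 / (2 * a k)"
      using a0[of k] ts[of k] by (simp add: lam_def abs_mult)
  qed
  have q: "\<i> * of_real b + p0 \<tau> \<sigma> lam n z = \<i> * comb \<sigma> n x z / of_real (y n)" for z
  proof -
    have "\<i> * comb \<sigma> n x z / of_real (y n) = \<i> * of_real (x n / y n) + (\<Sum>k<n. of_real (- (x k / y n)) * herglotz (\<sigma> k) z)"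
    proof -
      have "\<i> * (\<Sum>k<n. (\<i> * of_real (x k)) * herglotz (\<sigma> k) z) / of_real (y n) = (\<Sum>k<n. of_real (- (x k / y n)) * herglotz (\<sigma> k) z)"
        unfolding sum_distrib_left sum_divide_distrib by (intro sum.cong) (auto simp flip: mult.assoc)
      then show ?thesis unfolding comb_def by (simp add: distrib_left add_divide_distrib)
    qed
    also have "(\<Sum>k<n. of_real (- (x k / y n)) * herglotz (\<sigma> k) z) = (\<Sum>k<n. of_real (1 / (2 * a k)) * herglotz (\<sigma> k) z)"
      by (intro sum.cong) (simp_all only: ak lessThan_iff)
    finally show ?thesis by (simp only: b_def p0)
  qed
  have "G z = (\<tau> - z) * (1 - cnj \<tau> * z) / (\<i> * of_real b + p0 \<tau> \<sigma> lam n z)" if z: "cmod z < 1" for z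
  \<comment> \<open>At \<tau> both sides vanish because of the numerator; elsewhere
    \<open>px\<close> gives the formula.\<close>
  proof (cases "z = \<tau>")
    case True
    then show ?thesis using Gp[OF z] by simp
  next
    case False
    have "p z = inverse (\<i> * comb \<sigma> n x z / of_real (y n))"
      using px[OF z False] by (metis inverse_unique mult.commute)
    then show ?thesis unfolding q Gp[OF z] by (simp only: divide_inverse)
  qed
  then show ?thesis using lam0 suml by (intro exI[of _ b] exI[of _ lam]) auto
qed

subsection \<open>The characterisation\<close>

theorem theorem6p16:
  fixes \<sigma> :: "nat \<Rightarrow> complex" and n :: nat and \<tau> :: complex
    and G :: "complex \<Rightarrow> complex"
  assumes "\<forall>k<n. cmod (\<sigma> k) = 1"
    and "inj_on \<sigma> {..<n}"
    and "cmod \<tau> \<le> 1"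
    and "\<tau> \<notin> \<sigma> ` {..<n}"
    and "\<not> (\<forall>z\<in>unit_disk. G z = 0)"
  shows "extreme_point_Hol (GenF \<tau> \<sigma> n) G \<longleftrightarrow>
    (\<exists>b::real. \<exists>lam::nat \<Rightarrow> real. (\<forall>k<n. lam k < 0) \<and> (\<Sum>k<n. \<bar>lam k\<bar>) = 1 \<and>
       (\<forall>z\<in>unit_disk. G z = (\<tau> - z) * (1 - cnj \<tau> * z) / (\<i> * of_real b + p0 \<tau> \<sigma> lam n z)))"
  using extreme_point_of_formula[OF assms(1-4)] formula_of_extreme_point[OF assms]
  by blast

end
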